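(* Let $K$ be a field, $S=K[x_1,\dots,x_m,y_1,\dots,y_n]$, $Q=(y_1,\dots,y_n)$. Let $\Delta$ be a simplicial complex with vertices $V\cup W$, $V=\{v_1,\dots,v_m\}$, $W=\{w_1,\dots,w_n\}$, and let $K[\Delta]=S/I_\Delta$ be its Stanley--Reisner ring. Then $$\operatorname{cd}(Q,K[\Delta])=\dim\Delta_W+1.$$
   Context: The vertices $v_1,\dots,v_m$ correspond to the variables $x_1,\dots,x_m$ and $w_1,\dots,w_n$ to $y_1,\dots,y_n$; $I_\Delta$ is the squarefree monomial ideal generated by the monomials corresponding to non-faces of $\Delta$. $\Delta_W=\{F\in\Delta: F\subseteq W\}$ is the restriction of $\Delta$ to $W$. The dimension of a simplicial complex is the maximum of $|F|-1$ over its faces $F$ (so $\dim\{\emptyset\}=-1$). The cohomological dimension $\operatorname{cd}(Q,M)$ is the largest $i$ with $H^i_Q(M)\neq0$. *)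

theory Defs
  imports
    "HOL-Algebra.Algebra"
    "HOL-Algebra.Algebraic_Closure_Type"
    "HOL-Library.Poly_Mapping"
    "HOL-Library.Extended_Real"
begin

section \<open>Modules\<close>

definition mod_hom ::
    "('a, 'e) ring_scheme \<Rightarrow> ('a, 'b) module \<Rightarrow> ('a, 'c) module \<Rightarrow> ('b \<Rightarrow> 'c) set"
  where "mod_hom R M N =
    {f \<in> hom (add_monoid M) (add_monoid N).
       \<forall>a \<in> carrier R. \<forall>x \<in> carrier M. f (a \<odot>\<^bsub>M\<^esub> x) = a \<odot>\<^bsub>N\<^esub> f x}"

text \<open>The library predicate \<^term>\<open>module\<close> does not constrain the fields \<open>mult\<close> and \<open>one\<close> of a
  module record.\<close>

definition quotient_module :: "('a, 'b) module \<Rightarrow> 'b set \<Rightarrow> ('a, 'b set) module"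
  where "quotient_module M N =
    \<lparr>carrier = a_rcosets\<^bsub>M\<^esub> N, monoid.mult = undefined, one = undefined, ring.zero = N, ring.add = set_add M,
     module.smult = (\<lambda>a C. \<Union>x\<in>C. N +>\<^bsub>M\<^esub> (a \<odot>\<^bsub>M\<^esub> x))\<rparr>"

definition quotient_ring_module :: "'a ring \<Rightarrow> 'a set \<Rightarrow> ('a, 'a set) module"
  where "quotient_ring_module R J =
    \<lparr>carrier = carrier (R Quot J), monoid.mult = monoid.mult (R Quot J), one = one (R Quot J),
     ring.zero = ring.zero (R Quot J), ring.add = ring.add (R Quot J),
     module.smult = (\<lambda>a C. (J +>\<^bsub>R\<^esub> a) \<otimes>\<^bsub>R Quot J\<^esub> C)\<rparr>"

section \<open>Local cohomology\<close>

text \<open>A module \<open>E\<close> is injective if every homomorphism from a submodule \<open>A\<close> of a module \<open>B\<close> to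
  \<open>E\<close> extends to \<open>B\<close>. A definition cannot quantify over all types, so \<open>B\<close> ranges over the modules
  carried by the type \<open>nat \<Rightarrow> 'a\<close>. Up to isomorphism these include \<open>R\<close> (as constant sequences)
  and all of its ideals, so by Baer's criterion nothing is lost.\<close>

definition injective_module :: "('a, 'e) ring_scheme \<Rightarrow> ('a, 'c) module \<Rightarrow> bool"
  where "injective_module R E \<longleftrightarrow> module R E \<and>
    (\<forall>(B :: ('a, nat \<Rightarrow> 'a) module) A f.
       module R B \<longrightarrow> submodule A R B \<longrightarrow> f \<in> mod_hom R (B\<lparr>carrier := A\<rparr>) E \<longrightarrow>
       (\<exists>g \<in> mod_hom R B E. \<forall>x \<in> A. g x = f x))"

definition injective_resolution ::
    "('a, 'e) ring_scheme \<Rightarrow> ('a, 'b) module \<Rightarrow>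
     (nat \<Rightarrow> ('a, 'c) module) \<Rightarrow> (nat \<Rightarrow> 'c \<Rightarrow> 'c) \<Rightarrow> ('b \<Rightarrow> 'c) \<Rightarrow> bool"
  where "injective_resolution R M E d \<epsilon> \<longleftrightarrow>
    (\<forall>i. injective_module R (E i)) \<and>
    \<epsilon> \<in> mod_hom R M (E 0) \<and> inj_on \<epsilon> (carrier M) \<and>
    (\<forall>i. d i \<in> mod_hom R (E i) (E (Suc i))) \<and>
    a_kernel (E 0) (E 1) (d 0) = \<epsilon> ` carrier M \<and>
    (\<forall>i. a_kernel (E (Suc i)) (E (Suc (Suc i))) (d (Suc i)) = d i ` carrier (E i))"

text \<open>\<open>\<Gamma>\<^sub>Q(M)\<close>: the elements annihilated by some power of the ideal \<open>Q\<close>. The power is taken in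
  the monoid \<^term>\<open>ideals_set R\<close>, whose multiplication is the product of ideals.\<close>

definition torsion_module :: "('a, 'e) ring_scheme \<Rightarrow> 'a set \<Rightarrow> ('a, 'b) module \<Rightarrow> ('a, 'b) module"
  where "torsion_module R Q M =
    M\<lparr>carrier := {x \<in> carrier M.
       \<exists>k::nat. \<forall>a \<in> Q [^]\<^bsub>ideals_set R\<^esub> k. a \<odot>\<^bsub>M\<^esub> x = \<zero>\<^bsub>M\<^esub>}\<rparr>"

text \<open>The cohomology of \<open>\<Gamma>\<^sub>Q(E\<^sup>0) \<rightarrow> \<Gamma>\<^sub>Q(E\<^sup>1) \<rightarrow> \<dots>\<close> in degree \<open>i\<close>.\<close>

definition torsion_cohomology ::
    "('a, 'e) ring_scheme \<Rightarrow> 'a set \<Rightarrow> (nat \<Rightarrow> ('a, 'c) module) \<Rightarrow> (nat \<Rightarrow> 'c \<Rightarrow> 'c) \<Rightarrow> nat \<Rightarrow>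
     ('a, 'c set) module"
  where "torsion_cohomology R Q E d i =
    quotient_module
      ((torsion_module R Q (E i))\<lparr>carrier :=
         a_kernel (torsion_module R Q (E i)) (torsion_module R Q (E (Suc i))) (d i)\<rparr>)
      (case i of 0 \<Rightarrow> {\<zero>\<^bsub>E 0\<^esub>} | Suc j \<Rightarrow> d j ` carrier (torsion_module R Q (E j)))"

text \<open>The right derived functors of \<open>\<Gamma>\<^sub>Q\<close>. The resolution is chosen among the modules carried by
  \<open>'a list \<Rightarrow> 'b\<close>; this type is large enough for every module \<open>M\<close> over every commutative ring \<open>R\<close>:
  \<open>M = 0\<close> is trivial, and otherwise \<open>U = ('a list \<Rightarrow> 'b)\<close> is infinite with \<open>|U ^ R| \<le> |U|\<close>. Embed
  an \<open>R\<close>-module \<open>N\<close> with \<open>|N| \<le> |U|\<close> into the injective module \<open>Hom\<^sub>\<int>(R, D)\<close>, where \<open>D\<close> is a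
  divisible hull of \<open>N\<close>; it and the cokernel have at most \<open>|U|\<close> elements, so this can be iterated.
  Up to isomorphism the cohomology does not depend on the choice.\<close>

definition local_cohomology ::
    "('a, 'e) ring_scheme \<Rightarrow> 'a set \<Rightarrow> ('a, 'b) module \<Rightarrow> nat \<Rightarrow> ('a, ('a list \<Rightarrow> 'b) set) module"
  where "local_cohomology R Q M i =
    (let (E, d) = (SOME (E, d). \<exists>\<epsilon>. injective_resolution R M E d \<epsilon>)
     in torsion_cohomology R Q E d i)"

text \<open>The largest \<open>i\<close> with \<open>H\<^sup>i\<^sub>Q(M) \<noteq> 0\<close>. As a supremum in the extended reals it is \<open>-\<infinity>\<close> if there
  is no such \<open>i\<close> and \<open>\<infinity>\<close> if they are unbounded; a finite value is attained.\<close>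

definition cohomological_dimension ::
    "('a, 'e) ring_scheme \<Rightarrow> 'a set \<Rightarrow> ('a, 'b) module \<Rightarrow> ereal"
  where "cohomological_dimension R Q M =
    Sup {ereal (real i) | i.
      carrier (local_cohomology R Q M i) \<noteq> {\<zero>\<^bsub>local_cohomology R Q M i\<^esub>}}"

section \<open>Polynomial rings and Stanley--Reisner rings\<close>

type_synonym ('v, 'k) mpoly = "('v \<Rightarrow>\<^sub>0 nat) \<Rightarrow>\<^sub>0 'k"

definition mvar :: "'v \<Rightarrow> ('v, 'k::field) mpoly"
  where "mvar v = Poly_Mapping.single (Poly_Mapping.single v 1) 1"

definition mpoly_ring :: "'v set \<Rightarrow> ('v, 'k::field) mpoly ring"
  where "mpoly_ring U =
    ring_of_type_algebra\<lparr>carrier :=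
      {p. \<forall>t \<in> Poly_Mapping.keys p. Poly_Mapping.keys t \<subseteq> U}\<rparr>"

text \<open>A vertex set \<open>U\<close> may contain points that are not faces. The empty set is always a face.\<close>

definition abstract_simplicial_complex :: "'v set \<Rightarrow> 'v set set \<Rightarrow> bool"
  where "abstract_simplicial_complex U \<Delta> \<longleftrightarrow>
    {} \<in> \<Delta> \<and> \<Delta> \<subseteq> Pow U \<and> (\<forall>F \<in> \<Delta>. \<forall>G. G \<subseteq> F \<longrightarrow> G \<in> \<Delta>)"

definition restriction :: "'v set set \<Rightarrow> 'v set \<Rightarrow> 'v set set"
  where "restriction \<Delta> W = {F \<in> \<Delta>. F \<subseteq> W}"

definition complex_dim :: "'v set set \<Rightarrow> int"
  where "complex_dim \<Delta> = Max ((\<lambda>F. int (card F) - 1) ` \<Delta>)"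

definition stanley_reisner_ideal :: "'v set \<Rightarrow> 'v set set \<Rightarrow> ('v, 'k::field) mpoly set"
  where "stanley_reisner_ideal U \<Delta> =
    Idl\<^bsub>mpoly_ring U\<^esub> {\<Prod>v\<in>F. mvar v | F. F \<subseteq> U \<and> F \<notin> \<Delta>}"

text \<open>\<open>K[\<Delta>] = S / I\<^sub>\<Delta>\<close> as an \<open>S\<close>-module; its \<open>mult\<close> and \<open>one\<close> fields are those of the quotient ring.\<close>

definition stanley_reisner_ring ::
    "'v set \<Rightarrow> 'v set set \<Rightarrow> (('v, 'k::field) mpoly, ('v, 'k) mpoly set) module"
  where "stanley_reisner_ring U \<Delta> =
    quotient_ring_module (mpoly_ring U) (stanley_reisner_ideal U \<Delta>)"

end

theory Submission
  imports Defs
begin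

text \<open>
  Write \<open>M = K[\<Delta>]\<close>, let \<open>E\<close> be an injective resolution of \<open>M\<close>, and for \<open>F \<subseteq> W\<close> let \<open>\<Gamma>\<^sub>F\<close> denote the
  elements killed by powers of each \<open>y\<^sub>v\<close> with \<open>v \<in> F\<close>, so that \<open>\<Gamma>\<^sub>Q = \<Gamma>\<^sub>W\<close>. Let \<open>d\<close> be the largest number of
  vertices of a face contained in \<open>W\<close>, and let \<open>y\<^sub>G\<close> be the product of the \<open>y\<^sub>v\<close> with \<open>v \<in> G\<close>. The local
  cohomology of \<open>M\<close> is the cohomology of the Cech complex with terms \<open>M[1/y\<^sub>G]\<close>, \<open>G \<subseteq> W\<close>. A term vanishes unless
  \<open>G\<close> is a face, so there is no cohomology above degree \<open>d\<close>; and if \<open>F\<close> is a face with \<open>d\<close> vertices,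
  then \<open>1/y\<^sub>F\<close> is not a sum of elements of the \<open>M[1/y\<^bsub>F - {w}\<^esub>]\<close> and gives a nonzero class in degree \<open>d\<close>.

  The proof runs this argument with elements of \<open>E\<close>, without localizations and without comparing
  complexes. It rests on one property of \<open>E\<close>, shown in \<open>injective_mpoly_module_divisible\<close>: an element of
  \<open>\<Gamma>\<^sub>F(E)\<close> can be divided by \<open>y\<^sub>w\<close> within \<open>\<Gamma>\<^sub>F(E)\<close> if \<open>w \<notin> F\<close>, because \<open>y\<^sub>w\<close> is a nonzerodivisor
  modulo powers of the other variables. This links \<open>\<Gamma>\<^bsub>F \<union> {w}\<^esub>(E)\<close> to \<open>\<Gamma>\<^sub>F(E)\<close>.

  Vanishing (\<open>local_vanishing_faces\<close>) is an induction on \<open>F\<close> for the statement that \<open>H\<^sup>i\<^sub>F(M)[1/y\<^sub>G] = 0\<close>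
  if all \<open>A \<subseteq> F\<close> for which \<open>A \<union> G\<close> is a face have fewer than \<open>i\<close> elements; the theorem uses \<open>F = W\<close>, \<open>G = \<emptyset>\<close>.

  Nonvanishing (\<open>nonvanishing\<close>) starts with \<open>y\<^sub>F \<in> M\<close>, divides by \<open>y\<^sub>w\<^sup>2\<close> and applies the
  differential, for each \<open>w \<in> F\<close> in turn. Since \<open>y\<^sub>F\<close> is killed by the variables in \<open>W - F\<close>, the result is a cocycle in
  \<open>\<Gamma>\<^sub>W(E\<^sup>d)\<close>. If it bounded in \<open>\<Gamma>\<^sub>F(E)\<close>, going back through the construction would express a monomial
  \<open>y\<^sub>F\<^sup>k\<^sup>+\<^sup>1\<close> modulo \<open>I\<^sub>\<Delta>\<close> by multiples of the \<open>y\<^sub>w\<^sup>k\<^sup>+\<^sup>2\<close>, which is impossible as its support is a face.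

  The definition of local cohomology chooses a resolution, so one has to exist on the type of functions on
  lists. The \<open>K\<close>-multilinear maps \<open>S\<^sup>n\<^sup>+\<^sup>1 \<rightarrow> M\<close> with the cobar differential form one (\<open>cobar_resolution\<close>).
\<close>

section \<open>Linear projections over a subfield\<close>

text \<open>Over a field every subspace has a complement. It comes from Zorn's lemma: a \<open>K\<close>-subspace that is
  maximal among those meeting \<open>A\<close> trivially is a complement of \<open>A\<close>. The projection is only
  \<open>K\<close>-linear, not \<open>R\<close>-linear, even though \<open>A\<close> is an \<open>R\<close>-submodule.\<close>
lemma (in module) subspace_projection:
  assumes K: "subfield K R" and A: "submodule A R M"
  obtains p where "\<And>x. x \<in> carrier M \<Longrightarrow> p x \<in> A" "\<And>x. x \<in> A \<Longrightarrow> p x = x"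
    "\<And>x y. x \<in> carrier M \<Longrightarrow> y \<in> carrier M \<Longrightarrow> p (x \<oplus>\<^bsub>M\<^esub> y) = p x \<oplus>\<^bsub>M\<^esub> p y"
    "\<And>c x. c \<in> K \<Longrightarrow> x \<in> carrier M \<Longrightarrow> p (c \<odot>\<^bsub>M\<^esub> x) = c \<odot>\<^bsub>M\<^esub> p x"
proof -
  note AE = submoduleE[OF A]
  have A0: "\<zero>\<^bsub>M\<^esub> \<in> A"
    using AE(1,2,4) smult_l_null by (metis R.zero_closed ex_in_conv subsetD)
  have KR: "c \<in> carrier R" if "c \<in> K" for c
    using that subfieldE(3)[OF K] by blast
  have Ksub: "subring K R" by (rule subfieldE(1)[OF K])
  have K1: "\<ominus> \<one> \<in> K"
    using subringE(3,5)[OF Ksub] by blast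
  \<comment> \<open>Negation is multiplication by \<open>-1 \<in> K\<close>, so these subsets are closed under it.\<close>
  define subsp where "subsp C \<longleftrightarrow> C \<subseteq> carrier M \<and> \<zero>\<^bsub>M\<^esub> \<in> C \<and> (\<forall>x\<in>C. \<forall>y\<in>C. x \<oplus>\<^bsub>M\<^esub> y \<in> C)
     \<and> (\<forall>c\<in>K. \<forall>x\<in>C. c \<odot>\<^bsub>M\<^esub> x \<in> C)" for C
  define Fam where "Fam = {C. subsp C \<and> C \<inter> A = {\<zero>\<^bsub>M\<^esub>}}"
  have "\<exists>C\<in>Fam. \<forall>Y\<in>Fam. C \<subseteq> Y \<longrightarrow> Y = C"
  proof (rule subset_Zorn_nonempty)
    have "{\<zero>\<^bsub>M\<^esub>} \<in> Fam"
      using A0 KR by (auto simp: Fam_def subsp_def)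
    then show "Fam \<noteq> {}" by blast
  next
    fix D assume ne: "D \<noteq> {}" and ch: "subset.chain Fam D"
    have sub: "C \<in> Fam" if "C \<in> D" for C
      using ch that by (auto simp: subset.chain_def)
    have lin: "C \<subseteq> C' \<or> C' \<subseteq> C" if "C \<in> D" "C' \<in> D" for C C'
      using ch that by (auto simp: subset.chain_def)
    have "subsp (\<Union>D)"
      unfolding subsp_def
    proof (intro conjI ballI)
      show "\<Union>D \<subseteq> carrier M"
        using sub by (intro Union_least) (simp add: Fam_def subsp_def)
      show "\<zero>\<^bsub>M\<^esub> \<in> \<Union>D"
        using sub ne by (auto simp: Fam_def subsp_def)
    next
      fix x y assume "x \<in> \<Union>D" "y \<in> \<Union>D"
      then obtain C where "C \<in> D" "x \<in> C" "y \<in> C" using lin by blast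
      moreover have "subsp C" using sub \<open>C \<in> D\<close> by (simp add: Fam_def)
      ultimately show "x \<oplus>\<^bsub>M\<^esub> y \<in> \<Union>D" unfolding subsp_def by blast
    next
      fix c x assume "c \<in> K" "x \<in> \<Union>D"
      with sub show "c \<odot>\<^bsub>M\<^esub> x \<in> \<Union>D" by (auto simp: Fam_def subsp_def)
    qed
    then show "\<Union>D \<in> Fam" using sub ne by (auto simp: Fam_def)
  qed
  then obtain C where "subsp C" and CA: "C \<inter> A = {\<zero>\<^bsub>M\<^esub>}"
    and maxC: "\<And>Y. subsp Y \<Longrightarrow> Y \<inter> A = {\<zero>\<^bsub>M\<^esub>} \<Longrightarrow> C \<subseteq> Y \<Longrightarrow> Y = C"
    by (auto simp: Fam_def)
  then have CM: "C \<subseteq> carrier M" and C0: "\<zero>\<^bsub>M\<^esub> \<in> C"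
    and Cadd: "\<And>x y. x \<in> C \<Longrightarrow> y \<in> C \<Longrightarrow> x \<oplus>\<^bsub>M\<^esub> y \<in> C"
    and Csc: "\<And>c x. c \<in> K \<Longrightarrow> x \<in> C \<Longrightarrow> c \<odot>\<^bsub>M\<^esub> x \<in> C"
    by (auto simp: subsp_def)
  have Cneg: "\<ominus>\<^bsub>M\<^esub> x \<in> C" if "x \<in> C" for x
  proof -
    have "(\<ominus> \<one>) \<odot>\<^bsub>M\<^esub> x \<in> C" using Csc K1 that by blast
    then show ?thesis using that CM by (simp add: smult_l_minus subsetD)
  qed
  have split: "\<exists>a\<in>A. \<exists>c\<in>C. b = a \<oplus>\<^bsub>M\<^esub> c" if b: "b \<in> carrier M" for b
  proof (cases "b \<in> C")
    case True
    then show ?thesis using A0 b by (metis M.l_zero)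
  next
    case False
    define Y where "Y = {c \<oplus>\<^bsub>M\<^esub> k \<odot>\<^bsub>M\<^esub> b | c k. c \<in> C \<and> k \<in> K}"
    have Xi: "c \<oplus>\<^bsub>M\<^esub> k \<odot>\<^bsub>M\<^esub> b \<in> Y" if "c \<in> C" "k \<in> K" for c k
      using that unfolding Y_def by blast
    have sX: "subsp Y"
      unfolding subsp_def
    proof (intro conjI ballI)
      show "Y \<subseteq> carrier M" using CM KR b by (auto simp: Y_def)
      show "\<zero>\<^bsub>M\<^esub> \<in> Y" using Xi[OF C0 subringE(2)[OF Ksub]] b by simp
    next
      fix x y assume "x \<in> Y" "y \<in> Y"
      then obtain c k c' k' where x: "x = c \<oplus>\<^bsub>M\<^esub> k \<odot>\<^bsub>M\<^esub> b" and y: "y = c' \<oplus>\<^bsub>M\<^esub> k' \<odot>\<^bsub>M\<^esub> b"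
        and m: "c \<in> C" "k \<in> K" "c' \<in> C" "k' \<in> K" unfolding Y_def by blast
      have "x \<oplus>\<^bsub>M\<^esub> y = (c \<oplus>\<^bsub>M\<^esub> c') \<oplus>\<^bsub>M\<^esub> (k \<oplus> k') \<odot>\<^bsub>M\<^esub> b"
        using m b KR CM by (simp add: x y smult_l_distr subsetD M.add.m_ac)
      then show "x \<oplus>\<^bsub>M\<^esub> y \<in> Y"
        using Xi m Cadd subringE(7)[OF Ksub] by simp
    next
      fix l x assume l: "l \<in> K" "x \<in> Y"
      then obtain c k where x: "x = c \<oplus>\<^bsub>M\<^esub> k \<odot>\<^bsub>M\<^esub> b"
        and m: "c \<in> C" "k \<in> K" unfolding Y_def by blast
      have "l \<odot>\<^bsub>M\<^esub> x = (l \<odot>\<^bsub>M\<^esub> c) \<oplus>\<^bsub>M\<^esub> (l \<otimes> k) \<odot>\<^bsub>M\<^esub> b"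
        using m b KR CM l by (simp add: x smult_r_distr subsetD smult_assoc1)
      then show "l \<odot>\<^bsub>M\<^esub> x \<in> Y"
        using Xi m l Csc subringE(6)[OF Ksub] by simp
    qed
    have CX: "C \<subseteq> Y"
    proof
      fix c assume "c \<in> C"
      then show "c \<in> Y" using Xi[OF _ subringE(2)[OF Ksub], of c] b CM by (simp add: subsetD)
    qed
    have "b \<in> Y" using Xi[OF C0 subringE(3)[OF Ksub]] b by simp
    with False have "Y \<noteq> C" by blast
    with maxC sX CX have "Y \<inter> A \<noteq> {\<zero>\<^bsub>M\<^esub>}" by blast
    moreover have "\<zero>\<^bsub>M\<^esub> \<in> Y \<inter> A" using A0 C0 CX by blast
    ultimately obtain a where a: "a \<in> Y" "a \<in> A" "a \<noteq> \<zero>\<^bsub>M\<^esub>" by blast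
    then obtain c k where ack: "a = c \<oplus>\<^bsub>M\<^esub> k \<odot>\<^bsub>M\<^esub> b" "c \<in> C" "k \<in> K" unfolding Y_def by blast
    have cM: "c \<in> carrier M" using ack CM by blast
    \<comment> \<open>The coefficient of \<open>b\<close> is invertible, so the relation \<open>a = c + k b\<close> can be solved for \<open>b\<close>.\<close>
    have "k \<noteq> \<zero>"
    proof
      assume "k = \<zero>"
      then have "a = c" using ack b cM by simp
      then show False using a ack CA by blast
    qed
    then have ik: "inv k \<in> K" "inv k \<otimes> k = \<one>"
      using subfield_m_inv[OF K, of k] ack(3) by auto
    have "inv k \<odot>\<^bsub>M\<^esub> a = inv k \<odot>\<^bsub>M\<^esub> c \<oplus>\<^bsub>M\<^esub> b"
      using ack ik KR b cM by (simp add: smult_r_distr smult_assoc1[symmetric])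
    moreover have "b = (inv k \<odot>\<^bsub>M\<^esub> c \<oplus>\<^bsub>M\<^esub> b) \<oplus>\<^bsub>M\<^esub> (\<ominus>\<^bsub>M\<^esub> (inv k \<odot>\<^bsub>M\<^esub> c))"
      using ik KR b cM by (simp add: M.a_comm[of _ b] M.a_assoc M.r_neg)
    ultimately have "b = inv k \<odot>\<^bsub>M\<^esub> a \<oplus>\<^bsub>M\<^esub> (\<ominus>\<^bsub>M\<^esub> (inv k \<odot>\<^bsub>M\<^esub> c))"
      by simp
    moreover have "inv k \<odot>\<^bsub>M\<^esub> a \<in> A" using AE(4) KR ik a by blast
    moreover have "\<ominus>\<^bsub>M\<^esub> (inv k \<odot>\<^bsub>M\<^esub> c) \<in> C" using Cneg Csc ik ack by blast
    ultimately show ?thesis by blast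
  qed
  have uniq: "a = a'" if "a \<oplus>\<^bsub>M\<^esub> c = a' \<oplus>\<^bsub>M\<^esub> c'" "a \<in> A" "a' \<in> A" "c \<in> C" "c' \<in> C" for a a' c c'
  proof -
    have cl: "a \<in> carrier M" "a' \<in> carrier M" "c \<in> carrier M" "c' \<in> carrier M"
      using that AE(1) CM by auto
    have "a \<oplus>\<^bsub>M\<^esub> \<ominus>\<^bsub>M\<^esub> a' = c' \<oplus>\<^bsub>M\<^esub> \<ominus>\<^bsub>M\<^esub> c"
    proof -
      have "a = a' \<oplus>\<^bsub>M\<^esub> c' \<oplus>\<^bsub>M\<^esub> \<ominus>\<^bsub>M\<^esub> c"
        using that(1) cl by (metis M.add.inv_solve_right M.add.m_closed)
      then have "a = a' \<oplus>\<^bsub>M\<^esub> (c' \<oplus>\<^bsub>M\<^esub> \<ominus>\<^bsub>M\<^esub> c)" using cl by (simp add: M.a_assoc)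
      then have "\<ominus>\<^bsub>M\<^esub> a' \<oplus>\<^bsub>M\<^esub> a = c' \<oplus>\<^bsub>M\<^esub> \<ominus>\<^bsub>M\<^esub> c" using cl by (simp add: M.r_neg1)
      then show ?thesis using cl by (simp add: M.a_comm[of a])
    qed
    moreover have "a \<oplus>\<^bsub>M\<^esub> \<ominus>\<^bsub>M\<^esub> a' \<in> A" using that AE by blast
    moreover have "c' \<oplus>\<^bsub>M\<^esub> \<ominus>\<^bsub>M\<^esub> c \<in> C" using that Cadd Cneg by blast
    ultimately have "a \<oplus>\<^bsub>M\<^esub> \<ominus>\<^bsub>M\<^esub> a' = \<zero>\<^bsub>M\<^esub>" using CA by (metis Int_iff singletonD)
    then show ?thesis using cl by (metis M.add.inv_closed M.add.inv_equality M.minus_minus)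
  qed
  define p where "p b = (THE a. a \<in> A \<and> (\<exists>c\<in>C. b = a \<oplus>\<^bsub>M\<^esub> c))" for b
  have pe: "p (a \<oplus>\<^bsub>M\<^esub> c) = a" if "a \<in> A" "c \<in> C" for a c
    unfolding p_def using that uniq by (intro the_equality) blast+
  show thesis
  proof
    fix x assume x: "x \<in> carrier M"
    then obtain a c where ac: "a \<in> A" "c \<in> C" "x = a \<oplus>\<^bsub>M\<^esub> c" using split by blast
    then show "p x \<in> A" using pe by simp
    { fix k assume k: "k \<in> K"
      have "k \<odot>\<^bsub>M\<^esub> x = k \<odot>\<^bsub>M\<^esub> a \<oplus>\<^bsub>M\<^esub> k \<odot>\<^bsub>M\<^esub> c"
        using ac k KR AE(1) CM by (simp add: smult_r_distr subsetD)
      then show "p (k \<odot>\<^bsub>M\<^esub> x) = k \<odot>\<^bsub>M\<^esub> p x"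
        using ac k KR AE(4) Csc by (simp add: pe) }
    fix y assume y: "y \<in> carrier M"
    then obtain a' c' where ac': "a' \<in> A" "c' \<in> C" "y = a' \<oplus>\<^bsub>M\<^esub> c'" using split by blast
    have "x \<oplus>\<^bsub>M\<^esub> y = (a \<oplus>\<^bsub>M\<^esub> a') \<oplus>\<^bsub>M\<^esub> (c \<oplus>\<^bsub>M\<^esub> c')"
      using ac ac' AE(1) CM by (simp add: subsetD M.add.m_ac)
    then show "p (x \<oplus>\<^bsub>M\<^esub> y) = p x \<oplus>\<^bsub>M\<^esub> p y"
      using ac ac' AE(5) Cadd by (simp add: pe)
  next
    fix x assume "x \<in> A"
    then show "p x = x" using pe[of x "\<zero>\<^bsub>M\<^esub>"] C0 AE(1) by (simp add: subsetD)
  qed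
qed

section \<open>The cobar resolution\<close>

locale module_over_field_algebra = module R M
  for R :: "('a, 'e) ring_scheme" (structure) and M :: "('a, 'c) module" (structure) +
  fixes K assumes subfield: "subfield K R"
begin

lemma K_in_R: "c \<in> K \<Longrightarrow> c \<in> carrier R"
  using subfieldE(3)[OF subfield] by blast

text \<open>A \<open>K\<close>-multilinear map \<open>R\<^sup>n \<rightarrow> M\<close> is a function on lists of length \<open>n\<close> over \<open>R\<close>; extending it by zero to
  all other lists makes the representation unique, so that equality of maps is equality of
  functions. The recursion is the currying isomorphism between multilinear maps \<open>R\<^sup>n\<^sup>+\<^sup>1 \<rightarrow> M\<close> and linear
  maps from \<open>R\<close> to the multilinear maps \<open>R\<^sup>n \<rightarrow> M\<close>.\<close>
primrec multilinear :: "nat \<Rightarrow> ('a list \<Rightarrow> 'c) \<Rightarrow> bool" where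
  "multilinear 0 f \<longleftrightarrow> f [] \<in> carrier M \<and> (\<forall>r. r \<noteq> [] \<longrightarrow> f r = \<zero>\<^bsub>M\<^esub>)"
| "multilinear (Suc n) f \<longleftrightarrow> f [] = \<zero>\<^bsub>M\<^esub> \<and>
     (\<forall>a r. a \<notin> carrier R \<longrightarrow> f (a # r) = \<zero>\<^bsub>M\<^esub>) \<and>
     (\<forall>a \<in> carrier R. multilinear n (\<lambda>r. f (a # r))) \<and>
     (\<forall>a \<in> carrier R. \<forall>b \<in> carrier R. \<forall>r. f ((a \<oplus> b) # r) = f (a # r) \<oplus>\<^bsub>M\<^esub> f (b # r)) \<and>
     (\<forall>c \<in> K. \<forall>a \<in> carrier R. \<forall>r. f ((c \<otimes> a) # r) = c \<odot>\<^bsub>M\<^esub> f (a # r))"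

lemma multilinear_closed: "multilinear n f \<Longrightarrow> f r \<in> carrier M"
proof (induction n arbitrary: f r)
  case 0
  then show ?case by (cases r) auto
next
  case (Suc n)
  show ?case
  proof (cases r)
    case Nil
    then show ?thesis using Suc.prems by simp
  next
    case (Cons a s)
    show ?thesis
    proof (cases "a \<in> carrier R")
      case True
      then have "multilinear n (\<lambda>r. f (a # r))" using Suc.prems by simp
      from Suc.IH[OF this, of s] show ?thesis by (simp add: Cons)
    next
      case False
      then show ?thesis using Suc.prems by (simp add: Cons)
    qed
  qed
qed

lemma multilinear_zero: "multilinear n (\<lambda>r. \<zero>\<^bsub>M\<^esub>)"
  by (induction n) (simp_all add: K_in_R)

lemma multilinear_add:
  "multilinear n f \<Longrightarrow> multilinear n g \<Longrightarrow> multilinear n (\<lambda>r. f r \<oplus>\<^bsub>M\<^esub> g r)"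
proof (induction n arbitrary: f g)
  case 0
  then show ?case by simp
next
  case (Suc n)
  have cl: "f r \<in> carrier M" "g r \<in> carrier M" for r
    using Suc.prems multilinear_closed by blast+
  show ?case using Suc.prems Suc.IH
    by (simp add: K_in_R cl smult_r_distr M.add.m_ac)
qed

lemma multilinear_smult:
  "multilinear n f \<Longrightarrow> a \<in> carrier R \<Longrightarrow> multilinear n (\<lambda>r. a \<odot>\<^bsub>M\<^esub> f r)"
proof (induction n arbitrary: f)
  case 0
  then show ?case by simp
next
  case (Suc n)
  have cl: "f r \<in> carrier M" for r
    using Suc.prems multilinear_closed by blast
  have "a \<odot>\<^bsub>M\<^esub> (c \<odot>\<^bsub>M\<^esub> f r) = c \<odot>\<^bsub>M\<^esub> (a \<odot>\<^bsub>M\<^esub> f r)" if "c \<in> K" for c r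
    using that Suc.prems(2) cl by (metis K_in_R R.m_comm smult_assoc1)
  then show ?case using Suc.prems Suc.IH
    by (simp add: K_in_R cl smult_r_distr)
qed

text \<open>The action of \<open>R\<close> on \<open>Hom\<^sub>K(R, N)\<close> that makes it the coinduced module.\<close>
definition head_smult :: "'a \<Rightarrow> ('a list \<Rightarrow> 'c) \<Rightarrow> 'a list \<Rightarrow> 'c" where
  "head_smult a f r = (case r of [] \<Rightarrow> \<zero>\<^bsub>M\<^esub>
     | b # s \<Rightarrow> if b \<in> carrier R then f ((a \<otimes> b) # s) else \<zero>\<^bsub>M\<^esub>)"

lemma head_smult_simps [simp]:
  "head_smult a f [] = \<zero>\<^bsub>M\<^esub>"
  "b \<in> carrier R \<Longrightarrow> head_smult a f (b # s) = f ((a \<otimes> b) # s)"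
  "b \<notin> carrier R \<Longrightarrow> head_smult a f (b # s) = \<zero>\<^bsub>M\<^esub>"
  by (simp_all add: head_smult_def)

lemma multilinear_head_smult:
  assumes f: "multilinear (Suc n) f" and a: "a \<in> carrier R"
  shows "multilinear (Suc n) (head_smult a f)"
proof -
  have "f ((a \<otimes> (c \<otimes> b)) # r) = c \<odot>\<^bsub>M\<^esub> f ((a \<otimes> b) # r)"
    if "c \<in> K" "b \<in> carrier R" for c b r
  proof -
    have "a \<otimes> (c \<otimes> b) = c \<otimes> (a \<otimes> b)" using that a K_in_R by (simp add: R.m_lcomm)
    then show ?thesis using f a that by simp
  qed
  then show ?thesis using f a by (simp add: K_in_R R.r_distr)
qed

text \<open>Degree \<open>n\<close> consists of the maps in \<open>n + 1\<close> arguments, which makes it a coinduced module also for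
  \<open>n = 0\<close>.\<close>
definition cobar :: "nat \<Rightarrow> ('a, 'a list \<Rightarrow> 'c) module" where
  "cobar n = \<lparr>carrier = {f. multilinear (Suc n) f}, monoid.mult = undefined, one = undefined,
     ring.zero = (\<lambda>r. \<zero>\<^bsub>M\<^esub>), ring.add = (\<lambda>f g r. f r \<oplus>\<^bsub>M\<^esub> g r), module.smult = head_smult\<rparr>"

lemma cobar_simps:
  "carrier (cobar n) = {f. multilinear (Suc n) f}" "\<zero>\<^bsub>cobar n\<^esub> = (\<lambda>r. \<zero>\<^bsub>M\<^esub>)"
  "f \<oplus>\<^bsub>cobar n\<^esub> g = (\<lambda>r. f r \<oplus>\<^bsub>M\<^esub> g r)" "a \<odot>\<^bsub>cobar n\<^esub> f = head_smult a f"
  by (simp_all add: cobar_def)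

lemma module_cobar: "module R (cobar n)"
proof (rule moduleI)
  show "cring R" by (rule R.is_cring)
  have cl: "f r \<in> carrier M" if "multilinear (Suc n) f" for f r
    using that by (rule multilinear_closed)
  show "abelian_group (cobar n)"
  proof (rule abelian_groupI)
    fix f assume "f \<in> carrier (cobar n)"
    then have f: "multilinear (Suc n) f" by (simp only: cobar_simps mem_Collect_eq)
    have "multilinear (Suc n) (\<lambda>r. (\<ominus> \<one>) \<odot>\<^bsub>M\<^esub> f r)"
      using f by (rule multilinear_smult) simp
    moreover have "(\<ominus> \<one>) \<odot>\<^bsub>M\<^esub> f r \<oplus>\<^bsub>M\<^esub> f r = \<zero>\<^bsub>M\<^esub>" for r
      using cl[OF f] by (simp add: smult_l_minus M.l_neg)
    ultimately show "\<exists>g\<in>carrier (cobar n). g \<oplus>\<^bsub>cobar n\<^esub> f = \<zero>\<^bsub>cobar n\<^esub>"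
      unfolding cobar_simps by (intro bexI[of _ "\<lambda>r. (\<ominus> \<one>) \<odot>\<^bsub>M\<^esub> f r"]) simp_all
  qed (auto simp only: cobar_simps mem_Collect_eq multilinear_zero multilinear_add M.l_zero
        M.a_assoc M.a_comm cl)
  fix a f assume "a \<in> carrier R" "f \<in> carrier (cobar n)"
  then have a: "a \<in> carrier R" and f: "multilinear (Suc n) f" by (simp_all only: cobar_simps mem_Collect_eq)
  show "a \<odot>\<^bsub>cobar n\<^esub> f \<in> carrier (cobar n)"
    using a f multilinear_head_smult by (simp only: cobar_simps mem_Collect_eq)
  { fix b assume b: "b \<in> carrier R"
    show "(a \<oplus> b) \<odot>\<^bsub>cobar n\<^esub> f = a \<odot>\<^bsub>cobar n\<^esub> f \<oplus>\<^bsub>cobar n\<^esub> b \<odot>\<^bsub>cobar n\<^esub> f"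
      unfolding cobar_simps
    proof
      fix r show "head_smult (a \<oplus> b) f r = head_smult a f r \<oplus>\<^bsub>M\<^esub> head_smult b f r"
        using a b f by (cases r; cases "hd r \<in> carrier R") (simp_all add: R.l_distr)
    qed
    show "(a \<otimes> b) \<odot>\<^bsub>cobar n\<^esub> f = a \<odot>\<^bsub>cobar n\<^esub> (b \<odot>\<^bsub>cobar n\<^esub> f)"
      unfolding cobar_simps
    proof
      fix r show "head_smult (a \<otimes> b) f r = head_smult a (head_smult b f) r"
        using a b by (cases r; cases "hd r \<in> carrier R") (simp_all add: R.m_ac)
    qed }
  { fix g
    show "a \<odot>\<^bsub>cobar n\<^esub> (f \<oplus>\<^bsub>cobar n\<^esub> g) = a \<odot>\<^bsub>cobar n\<^esub> f \<oplus>\<^bsub>cobar n\<^esub> a \<odot>\<^bsub>cobar n\<^esub> g"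
      unfolding cobar_simps by (auto simp: head_smult_def fun_eq_iff split: list.split) }
next
  fix f assume "f \<in> carrier (cobar n)"
  then have f: "multilinear (Suc n) f" by (simp only: cobar_simps mem_Collect_eq)
  show "\<one> \<odot>\<^bsub>cobar n\<^esub> f = f"
    unfolding cobar_simps
  proof
    fix r show "head_smult \<one> f r = f r"
      using f by (cases r; cases "hd r \<in> carrier R") simp_all
  qed
qed

text \<open>Coinduced modules \<open>Hom\<^sub>K(R, N)\<close> are injective: an \<open>R\<close>-linear map \<open>f\<close> into such a module is the same as
  the \<open>K\<close>-linear map \<open>x \<mapsto> f x 1\<close> into \<open>N\<close>, and \<open>K\<close>-linear maps extend from subspaces by composition
  with a projection.\<close>
lemma injective_cobar: "injective_module R (cobar n)"
  unfolding injective_module_def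
proof (intro conjI allI impI module_cobar)
  fix B :: "('a, nat \<Rightarrow> 'a) module" and A f
  assume B: "module R B" and A: "submodule A R B"
    and f: "f \<in> mod_hom R (B\<lparr>carrier := A\<rparr>) (cobar n)"
  interpret B: module R B by fact
  obtain p where pA: "\<And>x. x \<in> carrier B \<Longrightarrow> p x \<in> A" and pid: "\<And>x. x \<in> A \<Longrightarrow> p x = x"
    and padd: "\<And>x y. x \<in> carrier B \<Longrightarrow> y \<in> carrier B \<Longrightarrow> p (x \<oplus>\<^bsub>B\<^esub> y) = p x \<oplus>\<^bsub>B\<^esub> p y"
    and psm: "\<And>c x. c \<in> K \<Longrightarrow> x \<in> carrier B \<Longrightarrow> p (c \<odot>\<^bsub>B\<^esub> x) = c \<odot>\<^bsub>B\<^esub> p x"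
    using B.subspace_projection[OF subfield A] by blast
  have fE: "multilinear (Suc n) (f x)" if "x \<in> A" for x
    using f that by (auto simp: mod_hom_def hom_def cobar_simps simp del: multilinear.simps)
  have fadd: "f (x \<oplus>\<^bsub>B\<^esub> y) = (\<lambda>r. f x r \<oplus>\<^bsub>M\<^esub> f y r)" if "x \<in> A" "y \<in> A" for x y
    using f that by (auto simp: mod_hom_def hom_def cobar_simps)
  have fsm: "f (a \<odot>\<^bsub>B\<^esub> x) = head_smult a (f x)" if "a \<in> carrier R" "x \<in> A" for a x
    using f that by (auto simp: mod_hom_def hom_def cobar_simps)
  define g where "g b r = (case r of [] \<Rightarrow> \<zero>\<^bsub>M\<^esub>
      | a # s \<Rightarrow> if a \<in> carrier R then f (p (a \<odot>\<^bsub>B\<^esub> b)) (\<one> # s) else \<zero>\<^bsub>M\<^esub>)" for b r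
  have g_simps [simp]: "g b [] = \<zero>\<^bsub>M\<^esub>" "a \<notin> carrier R \<Longrightarrow> g b (a # s) = \<zero>\<^bsub>M\<^esub>"
    "a \<in> carrier R \<Longrightarrow> g b (a # s) = f (p (a \<odot>\<^bsub>B\<^esub> b)) (\<one> # s)" for a b s
    by (simp_all add: g_def)
  have gE: "multilinear (Suc n) (g b)" if b: "b \<in> carrier B" for b
    unfolding multilinear.simps
  proof (intro conjI ballI allI impI)
    fix a assume a: "a \<in> carrier R"
    have "p (a \<odot>\<^bsub>B\<^esub> b) \<in> A" using a b pA by simp
    then show "multilinear n (\<lambda>r. g b (a # r))" using fE a by simp
    { fix a' r assume a': "a' \<in> carrier R"
      show "g b ((a \<oplus> a') # r) = g b (a # r) \<oplus>\<^bsub>M\<^esub> g b (a' # r)"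
        using a a' b by (simp add: B.smult_l_distr padd fadd pA) }
    fix c r assume c: "c \<in> K"
    have "p ((c \<otimes> a) \<odot>\<^bsub>B\<^esub> b) = c \<odot>\<^bsub>B\<^esub> p (a \<odot>\<^bsub>B\<^esub> b)"
      using a b c psm K_in_R by (simp add: B.smult_assoc1)
    then have "g b ((c \<otimes> a) # r) = f (c \<odot>\<^bsub>B\<^esub> p (a \<odot>\<^bsub>B\<^esub> b)) (\<one> # r)"
      using a c K_in_R by simp
    also have "\<dots> = f (p (a \<odot>\<^bsub>B\<^esub> b)) ((c \<otimes> \<one>) # r)"
      using a b c pA by (simp add: fsm K_in_R del: R.r_one)
    also have "\<dots> = c \<odot>\<^bsub>M\<^esub> f (p (a \<odot>\<^bsub>B\<^esub> b)) (\<one> # r)"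
      using fE[OF pA] a b c by (simp del: R.r_one)
    finally show "g b ((c \<otimes> a) # r) = c \<odot>\<^bsub>M\<^esub> g b (a # r)" using a by simp
  qed (simp_all)
  have "g \<in> mod_hom R B (cobar n)"
    unfolding mod_hom_def hom_def
  proof (intro CollectI conjI ballI)
    show "g \<in> carrier (add_monoid B) \<rightarrow> carrier (add_monoid (cobar n))"
      using gE by (simp add: cobar_simps del: multilinear.simps)
  next
    fix x y assume "x \<in> carrier (add_monoid B)" "y \<in> carrier (add_monoid B)"
    then have xy: "x \<in> carrier B" "y \<in> carrier B" by simp_all
    have "g (x \<oplus>\<^bsub>B\<^esub> y) r = g x r \<oplus>\<^bsub>M\<^esub> g y r" for r
      using xy by (cases r; cases "hd r \<in> carrier R") (simp_all add: B.smult_r_distr padd fadd pA)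
    then show "g (x \<otimes>\<^bsub>add_monoid B\<^esub> y) = g x \<otimes>\<^bsub>add_monoid (cobar n)\<^esub> g y"
      by (simp add: cobar_simps fun_eq_iff)
  next
    fix a x assume ax: "a \<in> carrier R" "x \<in> carrier B"
    have "g (a \<odot>\<^bsub>B\<^esub> x) r = head_smult a (g x) r" for r
      using ax by (cases r; cases "hd r \<in> carrier R")
        (simp_all add: B.smult_assoc1[symmetric] R.m_comm)
    then show "g (a \<odot>\<^bsub>B\<^esub> x) = a \<odot>\<^bsub>cobar n\<^esub> g x"
      by (simp add: cobar_simps fun_eq_iff)
  qed
  moreover have "g x = f x" if x: "x \<in> A" for x
  proof
    fix r
    have xB: "x \<in> carrier B" using x B.submoduleE(1)[OF A] by blast
    show "g x r = f x r"
      using fE[OF x] x B.submoduleE(4)[OF A]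
      by (cases r; cases "hd r \<in> carrier R") (simp_all add: pid fsm)
  qed
  ultimately show "\<exists>g\<in>mod_hom R B (cobar n). \<forall>x\<in>A. g x = f x" by blast
qed

text \<open>The recursion unfolds to the alternating sum
  \<open>(df)(a\<^sub>0, \<dots>, a\<^sub>n) = \<Sum>\<^sub>i\<^sub><\<^sub>n (-1)\<^sup>i f(\<dots>, a\<^sub>i a\<^sub>i\<^sub>+\<^sub>1, \<dots>) + (-1)\<^sup>n a\<^sub>n f(a\<^sub>0, \<dots>, a\<^sub>n\<^sub>-\<^sub>1)\<close>.
  Peeling off the first argument spares all signs and index shifts in the proofs below. On
  maps without arguments, that is on elements \<open>m\<close> of \<open>M\<close>, it is the embedding \<open>m \<mapsto> (a \<mapsto> a m)\<close> of \<open>M\<close>.\<close>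
fun cobar_diff :: "('a list \<Rightarrow> 'c) \<Rightarrow> 'a list \<Rightarrow> 'c" where
  "cobar_diff f [] = \<zero>\<^bsub>M\<^esub>"
| "cobar_diff f [a] = (if a \<in> carrier R then a \<odot>\<^bsub>M\<^esub> f [] else \<zero>\<^bsub>M\<^esub>)"
| "cobar_diff f (a # b # r) = (if a \<in> carrier R \<and> b \<in> carrier R
     then f ((a \<otimes> b) # r) \<ominus>\<^bsub>M\<^esub> cobar_diff (\<lambda>s. f (a # s)) (b # r) else \<zero>\<^bsub>M\<^esub>)"

lemma cobar_diff_closed: "(\<And>r. f r \<in> carrier M) \<Longrightarrow> cobar_diff f r \<in> carrier M"
  by (induction f r rule: cobar_diff.induct) simp_all

lemma cobar_diff_zero: "cobar_diff (\<lambda>r. \<zero>\<^bsub>M\<^esub>) r = \<zero>\<^bsub>M\<^esub>"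
  by (induction "\<lambda>r::'a list. \<zero>\<^bsub>M\<^esub>" r rule: cobar_diff.induct) (simp_all add: M.minus_eq)

lemma cobar_diff_add:
  assumes "\<And>r. f r \<in> carrier M" "\<And>r. g r \<in> carrier M"
  shows "cobar_diff (\<lambda>r. f r \<oplus>\<^bsub>M\<^esub> g r) r = cobar_diff f r \<oplus>\<^bsub>M\<^esub> cobar_diff g r"
  using assms
proof (induction f r arbitrary: g rule: cobar_diff.induct)
  case (3 f a b r)
  have cl: "cobar_diff (\<lambda>s. f (a # s)) (b # r) \<in> carrier M" "cobar_diff (\<lambda>s. g (a # s)) (b # r) \<in> carrier M"
    using 3 by (auto intro: cobar_diff_closed)
  show ?case
  proof (cases "a \<in> carrier R \<and> b \<in> carrier R")
    case True
    show ?thesis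
      using 3(1)[OF True, of "\<lambda>s. g (a # s)"] 3(2,3) True cl
      by (simp add: M.minus_eq M.minus_add M.add.m_ac)
  qed auto
qed (simp_all add: smult_r_distr)

lemma cobar_diff_smult:
  assumes "\<And>r. f r \<in> carrier M" and c: "c \<in> carrier R"
  shows "cobar_diff (\<lambda>r. c \<odot>\<^bsub>M\<^esub> f r) r = c \<odot>\<^bsub>M\<^esub> cobar_diff f r"
  using assms(1)
proof (induction f r rule: cobar_diff.induct)
  case (2 f a)
  then show ?case using c by (simp add: smult_assoc1[symmetric] R.m_comm)
next
  case (3 f a b r)
  have cl: "cobar_diff (\<lambda>s. f (a # s)) (b # r) \<in> carrier M"
    using 3 by (auto intro: cobar_diff_closed)
  show ?case
    using 3 cl c by (simp add: M.minus_eq smult_r_distr smult_r_minus)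
qed (use c in simp_all)

lemma cobar_diff_head_smult:
  assumes f: "multilinear (Suc n) f" and c: "c \<in> carrier R"
  shows "cobar_diff (head_smult c f) r = head_smult c (cobar_diff f) r"
proof (cases r)
  case Nil
  then show ?thesis by simp
next
  case (Cons a s)
  have f0: "f [] = \<zero>\<^bsub>M\<^esub>" using f by simp
  show ?thesis
  proof (cases s)
    case Nil
    then show ?thesis using Cons c f0 by (simp add: head_smult_def)
  next
    case (Cons b t)
    have "(\<lambda>s. head_smult c f (a # s)) = (\<lambda>s. f ((c \<otimes> a) # s))" if "a \<in> carrier R"
      using that by simp
    then show ?thesis using \<open>r = a # s\<close> Cons c
      by (cases "a \<in> carrier R") (simp_all add: R.m_assoc)
  qed
qed

lemma cobar_diff_not_carrier: "a \<notin> carrier R \<Longrightarrow> cobar_diff f (a # r) = \<zero>\<^bsub>M\<^esub>"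
  by (cases r) simp_all

lemma cobar_diff_0:
  assumes "multilinear 0 f"
  shows "cobar_diff f (a # r) = (if a \<in> carrier R then a \<odot>\<^bsub>M\<^esub> f r else \<zero>\<^bsub>M\<^esub>)"
proof (cases r)
  case (Cons b s)
  have "(\<lambda>t. f (a # t)) = (\<lambda>t. \<zero>\<^bsub>M\<^esub>)" using assms by auto
  then show ?thesis using assms Cons by (simp add: cobar_diff_zero M.minus_eq)
qed simp

text \<open>The recursion equation as an identity between functions of the remaining arguments. The sign
  is a scalar so that the additivity and homogeneity of the differential apply to it.\<close>
lemma cobar_diff_Cons:
  assumes f: "multilinear (Suc n) f" and a: "a \<in> carrier R"
  shows "cobar_diff f (a # s)
      = head_smult a f s \<oplus>\<^bsub>M\<^esub> (\<ominus> \<one>) \<odot>\<^bsub>M\<^esub> cobar_diff (\<lambda>s. f (a # s)) s"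
proof (cases s)
  case Nil
  then show ?thesis using f a by simp
next
  case (Cons b t)
  have cl: "f r \<in> carrier M" for r using f by (rule multilinear_closed)
  show ?thesis using a cl cobar_diff_closed[of "\<lambda>s. f (a # s)" "b # t", OF cl] Cons
    by (cases "b \<in> carrier R") (simp_all add: M.minus_eq smult_l_minus cobar_diff_not_carrier)
qed

lemma multilinear_cobar_diff: "multilinear n f \<Longrightarrow> multilinear (Suc n) (cobar_diff f)"
proof (induction n arbitrary: f)
  case 0
  show ?case
    using 0 multilinear_closed[OF 0] multilinear_smult[OF 0]
    by (simp add: cobar_diff_0[OF 0] K_in_R smult_l_distr smult_assoc1)
next
  case (Suc n)
  have cl: "f r \<in> carrier M" for r using Suc.prems by (rule multilinear_closed)
  have tl: "multilinear n (\<lambda>s. f (a # s))" if "a \<in> carrier R" for a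
    using Suc.prems that by simp
  note dcl = cobar_diff_closed[of "\<lambda>s. f (_ # s)", OF cl]
  note tail_eq = cobar_diff_Cons[OF Suc.prems]
  show ?case
    unfolding multilinear.simps(2)[of "Suc n"]
  proof (intro conjI ballI allI impI)
    fix a assume a: "a \<in> carrier R"
    show "multilinear (Suc n) (\<lambda>r. cobar_diff f (a # r))"
      unfolding tail_eq[OF a]
      by (intro multilinear_add multilinear_smult multilinear_head_smult Suc.prems a Suc.IH tl) simp
    { fix b r assume b: "b \<in> carrier R"
      have "(\<lambda>s. f ((a \<oplus> b) # s)) = (\<lambda>s. f (a # s) \<oplus>\<^bsub>M\<^esub> f (b # s))"
        using Suc.prems a b by simp
      then have "cobar_diff (\<lambda>s. f ((a \<oplus> b) # s)) r
          = cobar_diff (\<lambda>s. f (a # s)) r \<oplus>\<^bsub>M\<^esub> cobar_diff (\<lambda>s. f (b # s)) r"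
        using cl by (simp add: cobar_diff_add)
      moreover have "head_smult (a \<oplus> b) f r = head_smult a f r \<oplus>\<^bsub>M\<^esub> head_smult b f r"
        using Suc.prems a b by (cases r; cases "hd r \<in> carrier R") (simp_all add: R.l_distr)
      moreover have "head_smult c f r \<in> carrier M" for c
        using cl by (simp add: head_smult_def split: list.split)
      ultimately show "cobar_diff f ((a \<oplus> b) # r) = cobar_diff f (a # r) \<oplus>\<^bsub>M\<^esub> cobar_diff f (b # r)"
        using a b dcl by (simp add: tail_eq smult_r_distr M.add.m_ac) }
    fix c r assume c: "c \<in> K"
    have "(\<lambda>s. f ((c \<otimes> a) # s)) = (\<lambda>s. c \<odot>\<^bsub>M\<^esub> f (a # s))"
      using Suc.prems a c by simp
    then have "cobar_diff (\<lambda>s. f ((c \<otimes> a) # s)) r = c \<odot>\<^bsub>M\<^esub> cobar_diff (\<lambda>s. f (a # s)) r"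
      using cl c by (simp add: cobar_diff_smult K_in_R)
    moreover have "head_smult (c \<otimes> a) f r = c \<odot>\<^bsub>M\<^esub> head_smult a f r"
      using Suc.prems a c K_in_R by (cases r; cases "hd r \<in> carrier R") (simp_all add: R.m_assoc)
    moreover have "head_smult a f r \<in> carrier M"
      using cl by (simp add: head_smult_def split: list.split)
    moreover have "(\<ominus> \<one>) \<odot>\<^bsub>M\<^esub> (c \<odot>\<^bsub>M\<^esub> x) = c \<odot>\<^bsub>M\<^esub> ((\<ominus> \<one>) \<odot>\<^bsub>M\<^esub> x)" if "x \<in> carrier M" for x
      using that c K_in_R by (simp add: smult_l_minus smult_r_minus)
    ultimately show "cobar_diff f ((c \<otimes> a) # r) = c \<odot>\<^bsub>M\<^esub> cobar_diff f (a # r)"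
      using a c dcl K_in_R by (simp add: tail_eq smult_r_distr)
  qed (simp_all add: cobar_diff_not_carrier)
qed

text \<open>Expanding \<open>df\<close> in its first argument \<open>a\<close>, the differential of \<open>b, r \<mapsto> (df)(a, b, r)\<close> is \<open>d(a f)\<close> up to
  a term \<open>d(d(f(a, \<cdot>)))\<close>, which vanishes by induction; and \<open>d(a f) = a (df)\<close> cancels against the
  first term of \<open>d(df)\<close>.\<close>
lemma cobar_diff_diff: "multilinear n f \<Longrightarrow> cobar_diff (cobar_diff f) r = \<zero>\<^bsub>M\<^esub>"
proof (induction n arbitrary: f r)
  case 0
  have cl: "f r \<in> carrier M" for r using 0 by (rule multilinear_closed)
  have *: "cobar_diff (cobar_diff f) (a # b # r) = \<zero>\<^bsub>M\<^esub>" if ab: "a \<in> carrier R" "b \<in> carrier R" for a b r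
  proof -
    have "cobar_diff (\<lambda>s. cobar_diff f (a # s)) (b # r) = cobar_diff (\<lambda>s. a \<odot>\<^bsub>M\<^esub> f s) (b # r)"
      using ab by (simp add: cobar_diff_0[OF 0])
    also have "\<dots> = (a \<otimes> b) \<odot>\<^bsub>M\<^esub> f r"
      using ab cl by (simp add: cobar_diff_smult cobar_diff_0[OF 0] smult_assoc1)
    finally show ?thesis using ab cl by (simp add: cobar_diff_0[OF 0] M.minus_eq M.r_neg)
  qed
  show ?case
  proof (cases r rule: remdups_adj.cases)
    case (3 a b s)
    then show ?thesis using * by (cases "a \<in> carrier R \<and> b \<in> carrier R") (blast, auto)
  qed simp_all
next
  case (Suc n)
  have cl: "f r \<in> carrier M" for r using Suc.prems by (rule multilinear_closed)
  have *: "cobar_diff (cobar_diff f) (a # b # r) = \<zero>\<^bsub>M\<^esub>" if ab: "a \<in> carrier R" "b \<in> carrier R" for a b r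
  proof -
    have fa: "multilinear n (\<lambda>s. f (a # s))" using Suc.prems ab by simp
    have hcl: "head_smult a f s \<in> carrier M" for s
      using multilinear_closed[OF multilinear_head_smult[OF Suc.prems ab(1)]] .
    have dcl: "cobar_diff (\<lambda>s. f (a # s)) s \<in> carrier M" for s
      by (rule cobar_diff_closed[OF cl])
    have "cobar_diff (\<lambda>s. cobar_diff f (a # s)) (b # r)
        = cobar_diff (head_smult a f) (b # r)
          \<oplus>\<^bsub>M\<^esub> (\<ominus> \<one>) \<odot>\<^bsub>M\<^esub> cobar_diff (cobar_diff (\<lambda>s. f (a # s))) (b # r)"
      using hcl dcl by (simp add: cobar_diff_Cons[OF Suc.prems ab(1)] cobar_diff_add cobar_diff_smult
          del: cobar_diff.simps)
    also have "\<dots> = cobar_diff f ((a \<otimes> b) # r)"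
      using ab cobar_diff_closed[OF cl]
      by (simp add: Suc.IH[OF fa] cobar_diff_head_smult[OF Suc.prems] del: cobar_diff.simps)
    finally show ?thesis using ab cobar_diff_closed[of f, OF cl]
      by (simp add: cobar_diff.simps(3)[of "cobar_diff f"] M.minus_eq M.r_neg del: cobar_diff.simps)
  qed
  show ?case
  proof (cases r rule: remdups_adj.cases)
    case (3 a b s)
    then show ?thesis using * by (cases "a \<in> carrier R \<and> b \<in> carrier R") (blast, auto)
  qed simp_all
qed

text \<open>Inserting \<open>1\<close> as first argument is a contracting homotopy: \<open>(df)(1, a, s) = f(a, s) - (dg)(a, s)\<close>
  with \<open>g = f(1, \<cdot>)\<close>.\<close>
lemma cobar_diff_exact:
  assumes f: "multilinear (Suc n) f" and 0: "\<And>r. cobar_diff f r = \<zero>\<^bsub>M\<^esub>"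
  shows "multilinear n (\<lambda>r. f (\<one> # r)) \<and> f = cobar_diff (\<lambda>r. f (\<one> # r))"
proof
  show g: "multilinear n (\<lambda>r. f (\<one> # r))" using f by simp
  have cl: "f r \<in> carrier M" for r using f by (rule multilinear_closed)
  show "f = cobar_diff (\<lambda>r. f (\<one> # r))"
  proof
    fix r
    show "f r = cobar_diff (\<lambda>r. f (\<one> # r)) r"
    proof (cases r)
      case Nil
      then show ?thesis using f by simp
    next
      case (Cons a s)
      show ?thesis
      proof (cases "a \<in> carrier R")
        case True
        have c1: "cobar_diff (\<lambda>r. f (\<one> # r)) (a # s) \<in> carrier M"
          by (rule cobar_diff_closed[OF cl])
        have "f (a # s) \<ominus>\<^bsub>M\<^esub> cobar_diff (\<lambda>r. f (\<one> # r)) (a # s) = \<zero>\<^bsub>M\<^esub>"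
          using 0[of "\<one> # a # s"] True by simp
        then show ?thesis using cl c1 Cons by (metis M.minus_eq M.add.inv_solve_right M.l_zero M.zero_closed)
      next
        case False
        then show ?thesis using f Cons by (simp add: cobar_diff_not_carrier)
      qed
    qed
  qed
qed

definition cobar_unit :: "'c \<Rightarrow> 'a list \<Rightarrow> 'c" where
  "cobar_unit x = cobar_diff (\<lambda>r. if r = [] then x else \<zero>\<^bsub>M\<^esub>)"

lemma multilinear_const: "x \<in> carrier M \<Longrightarrow> multilinear 0 (\<lambda>r. if r = [] then x else \<zero>\<^bsub>M\<^esub>)"
  by simp

lemma cobar_unit_hom: "cobar_unit \<in> mod_hom R M (cobar 0)"
  unfolding mod_hom_def hom_def
proof (intro CollectI conjI ballI)
  show "cobar_unit \<in> carrier (add_monoid M) \<rightarrow> carrier (add_monoid (cobar 0))"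
    using multilinear_cobar_diff[OF multilinear_const]
    by (simp add: cobar_unit_def cobar_simps del: multilinear.simps)
next
  fix x y assume "x \<in> carrier (add_monoid M)" "y \<in> carrier (add_monoid M)"
  then have xy: "x \<in> carrier M" "y \<in> carrier M" by simp_all
  have "(\<lambda>r. if r = [] then x \<oplus>\<^bsub>M\<^esub> y else \<zero>\<^bsub>M\<^esub>)
      = (\<lambda>r::'a list. (if r = [] then x else \<zero>\<^bsub>M\<^esub>) \<oplus>\<^bsub>M\<^esub> (if r = [] then y else \<zero>\<^bsub>M\<^esub>))"
    by auto
  then show "cobar_unit (x \<otimes>\<^bsub>add_monoid M\<^esub> y)
      = cobar_unit x \<otimes>\<^bsub>add_monoid (cobar 0)\<^esub> cobar_unit y"
    using xy by (simp add: cobar_unit_def cobar_simps cobar_diff_add fun_eq_iff)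
next
  fix a x assume ax: "a \<in> carrier R" "x \<in> carrier M"
  then have sx: "a \<odot>\<^bsub>M\<^esub> x \<in> carrier M" by simp
  have "cobar_unit (a \<odot>\<^bsub>M\<^esub> x) r = head_smult a (cobar_unit x) r" for r
    using ax sx cobar_diff_0[OF multilinear_const[OF ax(2)]] cobar_diff_0[OF multilinear_const[OF sx]]
    by (cases r; cases "hd r \<in> carrier R")
      (simp_all add: cobar_unit_def smult_assoc1[symmetric] R.m_comm del: cobar_diff.simps(2,3))
  then show "cobar_unit (a \<odot>\<^bsub>M\<^esub> x) = a \<odot>\<^bsub>cobar 0\<^esub> cobar_unit x"
    by (simp add: cobar_simps fun_eq_iff)
qed

lemma cobar_diff_hom: "cobar_diff \<in> mod_hom R (cobar n) (cobar (Suc n))"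
  unfolding mod_hom_def hom_def
proof (intro CollectI conjI ballI)
  show "cobar_diff \<in> carrier (add_monoid (cobar n)) \<rightarrow> carrier (add_monoid (cobar (Suc n)))"
    using multilinear_cobar_diff by (simp add: cobar_simps del: multilinear.simps)
next
  fix f g assume "f \<in> carrier (add_monoid (cobar n))" "g \<in> carrier (add_monoid (cobar n))"
  then have fg: "multilinear (Suc n) f" "multilinear (Suc n) g"
    by (simp_all add: cobar_simps del: multilinear.simps)
  then show "cobar_diff (f \<otimes>\<^bsub>add_monoid (cobar n)\<^esub> g)
      = cobar_diff f \<otimes>\<^bsub>add_monoid (cobar (Suc n))\<^esub> cobar_diff g"
    by (simp add: cobar_simps cobar_diff_add multilinear_closed[OF fg(1)] multilinear_closed[OF fg(2)]
        fun_eq_iff del: multilinear.simps)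
next
  fix a f assume "a \<in> carrier R" "f \<in> carrier (cobar n)"
  then show "cobar_diff (a \<odot>\<^bsub>cobar n\<^esub> f) = a \<odot>\<^bsub>cobar (Suc n)\<^esub> cobar_diff f"
    by (simp add: cobar_simps cobar_diff_head_smult fun_eq_iff del: multilinear.simps)
qed

theorem cobar_resolution: "injective_resolution R M cobar (\<lambda>n. cobar_diff) cobar_unit"
  unfolding injective_resolution_def
proof (intro conjI allI injective_cobar cobar_unit_hom cobar_diff_hom)
  show "inj_on cobar_unit (carrier M)"
  proof (rule inj_onI)
    fix x y assume xy: "x \<in> carrier M" "y \<in> carrier M" "cobar_unit x = cobar_unit y"
    then have "cobar_unit x [\<one>] = cobar_unit y [\<one>]" by simp
    then show "x = y" using xy(1,2) by (simp add: cobar_unit_def)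
  qed
  show "a_kernel (cobar 0) (cobar 1) cobar_diff = cobar_unit ` carrier M"
  proof (intro equalityI subsetI)
    fix f assume "f \<in> a_kernel (cobar 0) (cobar 1) cobar_diff"
    then have f: "multilinear (Suc 0) f" and "cobar_diff f = (\<lambda>r. \<zero>\<^bsub>M\<^esub>)"
      by (simp_all add: a_kernel_def' cobar_simps del: multilinear.simps)
    then have *: "multilinear 0 (\<lambda>r. f (\<one> # r))" "f = cobar_diff (\<lambda>r. f (\<one> # r))"
      using cobar_diff_exact[OF f] by simp_all
    then have x: "f [\<one>] \<in> carrier M" and "(\<lambda>r. f (\<one> # r)) = (\<lambda>r. if r = [] then f [\<one>] else \<zero>\<^bsub>M\<^esub>)"
      by auto
    then have "f = cobar_unit (f [\<one>])" using *(2) by (simp add: cobar_unit_def)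
    then show "f \<in> cobar_unit ` carrier M" using x by blast
  next
    fix f assume "f \<in> cobar_unit ` carrier M"
    then obtain x where x: "x \<in> carrier M" "f = cobar_unit x" by blast
    have "f \<in> carrier (cobar 0)"
      using cobar_unit_hom x by (auto simp: mod_hom_def hom_def)
    then show "f \<in> a_kernel (cobar 0) (cobar 1) cobar_diff"
      using cobar_diff_diff[OF multilinear_const[OF x(1)]]
      by (simp add: a_kernel_def' cobar_simps x(2) cobar_unit_def fun_eq_iff)
  qed
  fix n
  show "a_kernel (cobar (Suc n)) (cobar (Suc (Suc n))) cobar_diff = cobar_diff ` carrier (cobar n)"
  proof (intro equalityI subsetI)
    fix f assume "f \<in> a_kernel (cobar (Suc n)) (cobar (Suc (Suc n))) cobar_diff"
    then have "multilinear (Suc (Suc n)) f" and "cobar_diff f = (\<lambda>r. \<zero>\<^bsub>M\<^esub>)"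
      by (simp_all add: a_kernel_def' cobar_simps del: multilinear.simps)
    then show "f \<in> cobar_diff ` carrier (cobar n)"
      using cobar_diff_exact[of "Suc n" f] by (auto simp: cobar_simps simp del: multilinear.simps)
  next
    fix f assume "f \<in> cobar_diff ` carrier (cobar n)"
    then obtain g where g: "multilinear (Suc n) g" "f = cobar_diff g"
      by (auto simp: cobar_simps simp del: multilinear.simps)
    show "f \<in> a_kernel (cobar (Suc n)) (cobar (Suc (Suc n))) cobar_diff"
      unfolding g(2) using cobar_diff_diff[OF g(1)] multilinear_cobar_diff[OF g(1)]
      by (simp add: a_kernel_def' cobar_simps fun_eq_iff del: multilinear.simps)
  qed
qed

end

section \<open>Division in injective modules\<close>

text \<open>Injectivity is tested on modules carried by the type \<open>nat \<Rightarrow> 'a\<close>; constant sequences place the ring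
  itself there.\<close>
definition ring_as_sequence_module :: "('a, 'e) ring_scheme \<Rightarrow> ('a, nat \<Rightarrow> 'a) module" where
  "ring_as_sequence_module R = \<lparr>carrier = (\<lambda>a n. a) ` carrier R, monoid.mult = undefined, one = undefined,
     ring.zero = (\<lambda>n. \<zero>\<^bsub>R\<^esub>), ring.add = (\<lambda>f g n. f n \<oplus>\<^bsub>R\<^esub> g n),
     module.smult = (\<lambda>a f n. a \<otimes>\<^bsub>R\<^esub> f n)\<rparr>"

lemma (in cring) module_ring_as_sequence_module: "module R (ring_as_sequence_module R)"
proof (rule moduleI)
  show "abelian_group (ring_as_sequence_module R)"
  proof (rule abelian_groupI)
    fix x assume "x \<in> carrier (ring_as_sequence_module R)"
    then obtain a where a: "a \<in> carrier R" "x = (\<lambda>n. a)" by (auto simp: ring_as_sequence_module_def)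
    then show "\<exists>y\<in>carrier (ring_as_sequence_module R).
        y \<oplus>\<^bsub>ring_as_sequence_module R\<^esub> x = \<zero>\<^bsub>ring_as_sequence_module R\<^esub>"
      by (intro bexI[of _ "\<lambda>n. \<ominus> a"]) (auto simp: ring_as_sequence_module_def l_neg)
  qed (auto simp: ring_as_sequence_module_def a_ac)
qed (auto simp: ring_as_sequence_module_def is_cring m_assoc l_distr r_distr)

text \<open>If \<open>y\<close> is a nonzerodivisor modulo \<open>J\<close> and \<open>J x = 0\<close>, then \<open>a y + j \<mapsto> a x\<close> is a well-defined homomorphism
  from the ideal \<open>(y) + J\<close> to \<open>E\<close>. The value at \<open>1\<close> of an extension to \<open>R\<close> is a quotient of \<open>x\<close> by \<open>y\<close> that
  is still annihilated by \<open>J\<close>.\<close>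
lemma (in cring) injective_module_divide:
  assumes E: "injective_module R E" and J: "ideal J R" and y: "y \<in> carrier R"
    and reg: "\<And>a. a \<in> carrier R \<Longrightarrow> a \<otimes> y \<in> J \<Longrightarrow> a \<in> J"
    and x: "x \<in> carrier E" and Jx: "\<And>a. a \<in> J \<Longrightarrow> a \<odot>\<^bsub>E\<^esub> x = \<zero>\<^bsub>E\<^esub>"
  obtains x' where "x' \<in> carrier E" "y \<odot>\<^bsub>E\<^esub> x' = x" "\<And>a. a \<in> J \<Longrightarrow> a \<odot>\<^bsub>E\<^esub> x' = \<zero>\<^bsub>E\<^esub>"
proof -
  interpret E: module R E using E by (simp add: injective_module_def)
  interpret J: ideal J R by fact
  define B where "B = ring_as_sequence_module R"
  interpret B: module R B unfolding B_def by (rule module_ring_as_sequence_module)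
  have JR: "j \<in> carrier R" if "j \<in> J" for j using that by (rule J.a_Hcarr)
  define I where "I = {p \<in> carrier R. \<exists>a \<in> carrier R. p \<ominus> a \<otimes> y \<in> J}"
  have uniq: "a \<odot>\<^bsub>E\<^esub> x = b \<odot>\<^bsub>E\<^esub> x"
    if p: "p \<in> carrier R" and a: "a \<in> carrier R" "p \<ominus> a \<otimes> y \<in> J" and b: "b \<in> carrier R" "p \<ominus> b \<otimes> y \<in> J" for p a b
  proof -
    have "(a \<ominus> b) \<otimes> y = (p \<ominus> b \<otimes> y) \<oplus> \<ominus> (p \<ominus> a \<otimes> y)"
      using p a(1) b(1) y by algebra
    also have "\<dots> \<in> J" using a b by (intro J.a_closed J.a_inv_closed)
    finally have "a \<ominus> b \<in> J" by (rule reg[OF minus_closed[OF a(1) b(1)]])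
    then have 0: "(a \<ominus> b) \<odot>\<^bsub>E\<^esub> x = \<zero>\<^bsub>E\<^esub>" by (rule Jx)
    have "a = (a \<ominus> b) \<oplus> b" using a b by algebra
    then have "a \<odot>\<^bsub>E\<^esub> x = (a \<ominus> b) \<odot>\<^bsub>E\<^esub> x \<oplus>\<^bsub>E\<^esub> b \<odot>\<^bsub>E\<^esub> x"
      using E.smult_l_distr[of "a \<ominus> b" b x] a b x by simp
    then show ?thesis using 0 b x by simp
  qed
  define \<phi> where "\<phi> p = (SOME a. a \<in> carrier R \<and> p \<ominus> a \<otimes> y \<in> J) \<odot>\<^bsub>E\<^esub> x" for p
  have \<phi>: "\<phi> p = a \<odot>\<^bsub>E\<^esub> x" if "p \<in> carrier R" "a \<in> carrier R" "p \<ominus> a \<otimes> y \<in> J" for p a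
  proof -
    let ?b = "SOME a. a \<in> carrier R \<and> p \<ominus> a \<otimes> y \<in> J"
    have "?b \<in> carrier R \<and> p \<ominus> ?b \<otimes> y \<in> J" using that by (intro someI_ex[of "\<lambda>a. a \<in> carrier R \<and> p \<ominus> a \<otimes> y \<in> J"]) blast
    then show ?thesis unfolding \<phi>_def using uniq that by blast
  qed
  define A where "A = (\<lambda>a (n::nat). a) ` I"
  define f where "f h = \<phi> (h 0)" for h :: "nat \<Rightarrow> 'a"
  have f: "f (\<lambda>n. p) = \<phi> p" for p by (simp add: f_def)
  have Iadd: "p \<oplus> q \<in> I \<and> \<phi> (p \<oplus> q) = \<phi> p \<oplus>\<^bsub>E\<^esub> \<phi> q" if pq: "p \<in> I" "q \<in> I" for p q
  proof -
    obtain a b where p: "p \<in> carrier R" and q: "q \<in> carrier R"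
      and a: "a \<in> carrier R" "p \<ominus> a \<otimes> y \<in> J" and b: "b \<in> carrier R" "q \<ominus> b \<otimes> y \<in> J"
      using pq by (auto simp: I_def)
    have "p \<oplus> q \<ominus> (a \<oplus> b) \<otimes> y = (p \<ominus> a \<otimes> y) \<oplus> (q \<ominus> b \<otimes> y)"
      using p q a(1) b(1) y by algebra
    also have "\<dots> \<in> J" using a b by (intro J.a_closed)
    finally have *: "p \<oplus> q \<ominus> (a \<oplus> b) \<otimes> y \<in> J" .
    then have "p \<oplus> q \<in> I" using p q a b by (auto simp: I_def)
    moreover have "\<phi> (p \<oplus> q) = (a \<oplus> b) \<odot>\<^bsub>E\<^esub> x" using \<phi> * p q a b by simp
    ultimately show ?thesis using \<phi>[OF p a] \<phi>[OF q b] a b x by (simp add: E.smult_l_distr)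
  qed
  have Ism: "c \<otimes> p \<in> I \<and> \<phi> (c \<otimes> p) = c \<odot>\<^bsub>E\<^esub> \<phi> p" if c: "c \<in> carrier R" and "p \<in> I" for c p
  proof -
    obtain a where p: "p \<in> carrier R" and a: "a \<in> carrier R" "p \<ominus> a \<otimes> y \<in> J"
      using \<open>p \<in> I\<close> by (auto simp: I_def)
    have "c \<otimes> p \<ominus> (c \<otimes> a) \<otimes> y = c \<otimes> (p \<ominus> a \<otimes> y)"
      using p a(1) c y by algebra
    also have "\<dots> \<in> J" using a c by (intro J.I_l_closed)
    finally have *: "c \<otimes> p \<ominus> (c \<otimes> a) \<otimes> y \<in> J" .
    then have "c \<otimes> p \<in> I" using p c a m_closed[OF c a(1)] by (auto simp: I_def)
    moreover have "\<phi> (c \<otimes> p) = (c \<otimes> a) \<odot>\<^bsub>E\<^esub> x" using \<phi> * p c a by simp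
    ultimately show ?thesis using \<phi>[OF p a] a c x by (simp add: E.smult_assoc1)
  qed
  have I0: "\<zero> \<in> I" unfolding I_def using y by (auto intro!: bexI[of _ \<zero>] simp: minus_eq)
  have IR: "p \<in> carrier R" if "p \<in> I" for p using that by (simp add: I_def)
  have B_simps: "carrier B = (\<lambda>a n. a) ` carrier R" "\<zero>\<^bsub>B\<^esub> = (\<lambda>n. \<zero>)"
     "\<And>f g. f \<oplus>\<^bsub>B\<^esub> g = (\<lambda>n. f n \<oplus> g n)" "\<And>a f. a \<odot>\<^bsub>B\<^esub> f = (\<lambda>n. a \<otimes> f n)"
    by (simp_all add: B_def ring_as_sequence_module_def)
  have "submodule A R B"
  proof (rule B.submoduleI)
    show "A \<subseteq> carrier B" using IR by (auto simp: A_def B_simps)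
    show "\<zero>\<^bsub>B\<^esub> \<in> A" using I0 by (auto simp: A_def B_simps)
    fix g assume "g \<in> A"
    then obtain p where p: "p \<in> I" "g = (\<lambda>n. p)" by (auto simp: A_def)
    { fix c assume "c \<in> carrier R"
      then show "c \<odot>\<^bsub>B\<^esub> g \<in> A" using Ism p by (auto simp: A_def B_simps) }
    note sm = this
    have "g \<in> carrier B" using p IR by (auto simp: B_simps)
    then have "\<ominus>\<^bsub>B\<^esub> g = (\<ominus> \<one>) \<odot>\<^bsub>B\<^esub> g" by (simp add: B.smult_l_minus)
    then show "\<ominus>\<^bsub>B\<^esub> g \<in> A" using sm by simp
    fix h assume "h \<in> A"
    then obtain q where q: "q \<in> I" "h = (\<lambda>n. q)" by (auto simp: A_def)
    show "g \<oplus>\<^bsub>B\<^esub> h \<in> A" using p q Iadd by (auto simp: A_def B_simps)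
  qed
  moreover have "f \<in> mod_hom R (B\<lparr>carrier := A\<rparr>) E"
    unfolding mod_hom_def hom_def
  proof (intro CollectI conjI ballI)
    have "\<phi> p \<in> carrier E" if p: "p \<in> I" for p
    proof -
      obtain a where "a \<in> carrier R" "p \<ominus> a \<otimes> y \<in> J" using p by (auto simp: I_def)
      with \<phi>[OF IR[OF p]] x show ?thesis by simp
    qed
    then show "f \<in> carrier (add_monoid (B\<lparr>carrier := A\<rparr>)) \<rightarrow> carrier (add_monoid E)"
      by (auto simp: f A_def)
  qed (auto simp: A_def B_simps f Iadd Ism)
  ultimately obtain g where g: "g \<in> mod_hom R B E" and gA: "\<And>h. h \<in> A \<Longrightarrow> g h = f h"
    using E B.module_axioms unfolding injective_module_def by blast
  define x' where "x' = g (\<lambda>n. \<one>)"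
  have oneB: "(\<lambda>n. \<one>) \<in> carrier B" by (auto simp: B_simps)
  have x'E: "x' \<in> carrier E" using g oneB by (auto simp: x'_def mod_hom_def hom_def)
  have gsm: "a \<odot>\<^bsub>E\<^esub> x' = g (\<lambda>n. a)" if "a \<in> carrier R" for a
  proof -
    have "g (a \<odot>\<^bsub>B\<^esub> (\<lambda>n. \<one>)) = a \<odot>\<^bsub>E\<^esub> x'" using g oneB that by (auto simp: x'_def mod_hom_def)
    then show ?thesis using that by (simp add: B_simps)
  qed
  have "y \<ominus> \<one> \<otimes> y = \<zero>" using y by algebra
  then have y1: "y \<ominus> \<one> \<otimes> y \<in> J" by simp
  then have "y \<in> I" unfolding I_def using y one_closed by blast
  then have "y \<odot>\<^bsub>E\<^esub> x' = x" using gsm[OF y] gA \<phi>[OF y one_closed y1] x by (auto simp: A_def f)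
  moreover have "j \<odot>\<^bsub>E\<^esub> x' = \<zero>\<^bsub>E\<^esub>" if j: "j \<in> J" for j
  proof -
    have "j \<ominus> \<zero> \<otimes> y = j" using JR[OF j] y by algebra
    then have j0: "j \<ominus> \<zero> \<otimes> y \<in> J" using j by simp
    then have "j \<in> I" using JR[OF j] by (auto simp: I_def)
    then show ?thesis using gsm[OF JR[OF j]] gA \<phi>[OF JR[OF j] zero_closed j0] x by (auto simp: A_def f)
  qed
  ultimately show thesis using that x'E by blast
qed

section \<open>Torsion with respect to an ideal\<close>

lemma ideals_set_simps:
  "\<one>\<^bsub>ideals_set R\<^esub> = carrier R" "I \<otimes>\<^bsub>ideals_set R\<^esub> J = I \<cdot>\<^bsub>R\<^esub> J"
  by (simp_all add: ideals_set_def)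

lemma (in cring) ideal_power_closed: "ideal Q R \<Longrightarrow> ideal (Q [^]\<^bsub>ideals_set R\<^esub> (k::nat)) R"
  by (induction k) (auto simp: ideals_set_simps oneideal ideal_prod_is_ideal)

lemma (in cring) ideal_power_Suc_subset:
  assumes "ideal Q R"
  shows "Q [^]\<^bsub>ideals_set R\<^esub> (Suc k) \<subseteq> Q [^]\<^bsub>ideals_set R\<^esub> (k::nat)"
  using ideal_prod_inter[OF ideal_power_closed[OF assms] assms] by (auto simp: ideals_set_simps)

lemma (in cring) ideal_power_antimono:
  assumes "ideal Q R" "k \<le> l"
  shows "Q [^]\<^bsub>ideals_set R\<^esub> (l::nat) \<subseteq> Q [^]\<^bsub>ideals_set R\<^esub> (k::nat)"
  using assms(2)
proof (induction l rule: dec_induct)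
  case (step n)
  then show ?case using ideal_power_Suc_subset[OF assms(1), of n] by blast
qed simp

lemma (in cring) nat_pow_in_ideal_power:
  assumes "a \<in> Q" "a \<in> carrier R"
  shows "a [^] k \<in> Q [^]\<^bsub>ideals_set R\<^esub> (k::nat)"
  by (induction k) (auto simp: ideals_set_simps assms intro: ideal_prod.prod)

text \<open>If \<open>(Y)\<^sup>n\<close> kills \<open>y x\<close> for all generators \<open>y\<close>, then it kills \<open>q x\<close> for all \<open>q \<in> (Y)\<close>, so \<open>(Y)\<^sup>n\<^sup>+\<^sup>1\<close> kills \<open>x\<close>.\<close>
lemma (in module) ideal_power_torsion_step:
  assumes Y: "finite Y" "Y \<subseteq> carrier R" and x: "x \<in> carrier M"
    and tor: "\<And>y. y \<in> Y \<Longrightarrow> \<exists>k::nat. \<forall>a \<in> (Idl Y) [^]\<^bsub>ideals_set R\<^esub> k. a \<odot>\<^bsub>M\<^esub> (y \<odot>\<^bsub>M\<^esub> x) = \<zero>\<^bsub>M\<^esub>"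
  shows "\<exists>k::nat. \<forall>a \<in> (Idl Y) [^]\<^bsub>ideals_set R\<^esub> k. a \<odot>\<^bsub>M\<^esub> x = \<zero>\<^bsub>M\<^esub>"
proof -
  have Q: "ideal (Idl Y) R" using Y by (intro genideal_ideal)
  obtain k where k: "\<And>y a. y \<in> Y \<Longrightarrow> a \<in> (Idl Y) [^]\<^bsub>ideals_set R\<^esub> (k y :: nat) \<Longrightarrow> a \<odot>\<^bsub>M\<^esub> (y \<odot>\<^bsub>M\<^esub> x) = \<zero>\<^bsub>M\<^esub>"
    using tor by metis
  define n where "n = (\<Sum>y\<in>Y. k y)"
  have kn: "k y \<le> n" if "y \<in> Y" for y
    unfolding n_def using that Y(1) by (intro member_le_sum) auto
  have cl: "a \<in> carrier R" if "a \<in> (Idl Y) [^]\<^bsub>ideals_set R\<^esub> (m::nat)" for a m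
    using that ideal.Icarr[OF ideal_power_closed[OF Q]] by blast
  have yx: "a \<odot>\<^bsub>M\<^esub> (q \<odot>\<^bsub>M\<^esub> x) = \<zero>\<^bsub>M\<^esub>" if a: "a \<in> (Idl Y) [^]\<^bsub>ideals_set R\<^esub> n" and q: "q \<in> Idl Y" for a q
  proof -
    have aR: "a \<in> carrier R" using cl a .
    define T where "T = {q \<in> carrier R. a \<odot>\<^bsub>M\<^esub> (q \<odot>\<^bsub>M\<^esub> x) = \<zero>\<^bsub>M\<^esub>}"
    have sc: "c \<otimes> q \<in> T" if "c \<in> carrier R" "q \<in> T" for c q
    proof -
      have q: "q \<in> carrier R" using that by (simp add: T_def)
      have "a \<odot>\<^bsub>M\<^esub> ((c \<otimes> q) \<odot>\<^bsub>M\<^esub> x) = c \<odot>\<^bsub>M\<^esub> (a \<odot>\<^bsub>M\<^esub> (q \<odot>\<^bsub>M\<^esub> x))"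
        using that(1) q aR x by (simp add: smult_assoc1[symmetric] R.m_ac)
      then show ?thesis using that by (simp add: T_def)
    qed
    have "ideal T R"
    proof (rule idealI)
      show "subgroup T (add_monoid R)"
      proof (rule subgroup.intro)
        show "inv\<^bsub>add_monoid R\<^esub> q \<in> T" if "q \<in> T" for q
        proof -
          have "q \<in> carrier R" using that by (simp add: T_def)
          then have "inv\<^bsub>add_monoid R\<^esub> q = (\<ominus> \<one>) \<otimes> q" by (simp add: a_inv_def[symmetric] R.l_minus)
          then show ?thesis using sc that by simp
        qed
        show "p \<otimes>\<^bsub>add_monoid R\<^esub> q \<in> T" if "p \<in> T" "q \<in> T" for p q
          using that aR x by (simp add: T_def smult_l_distr smult_r_distr)
        show "\<one>\<^bsub>add_monoid R\<^esub> \<in> T" using aR x by (simp add: T_def)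
      qed (auto simp: T_def)
      show "q \<otimes> c \<in> T" if "q \<in> T" "c \<in> carrier R" for q c
        using sc[OF that(2,1)] that by (simp add: T_def R.m_comm)
    qed (use sc R.ring_axioms in auto)
    moreover have "y \<in> T" if y: "y \<in> Y" for y
      using k[OF y, of a] ideal_power_antimono[OF Q kn[OF y]] a y Y(2) by (auto simp: T_def)
    then have "Y \<subseteq> T" by blast
    ultimately have "Idl Y \<subseteq> T" by (rule genideal_minimal)
    then show ?thesis using q by (auto simp: T_def)
  qed
  have QR: "q \<in> carrier R" if "q \<in> Idl Y" for q using that ideal.Icarr[OF Q] by blast
  have "a \<in> carrier R \<and> a \<odot>\<^bsub>M\<^esub> x = \<zero>\<^bsub>M\<^esub>" if "a \<in> (Idl Y) [^]\<^bsub>ideals_set R\<^esub> Suc n" for a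
  proof -
    have "a \<in> ((Idl Y) [^]\<^bsub>ideals_set R\<^esub> n) \<cdot>\<^bsub>R\<^esub> (Idl Y)"
      using that by (simp add: ideals_set_simps)
    then show ?thesis
    proof (induction rule: ideal_prod.induct)
      case (prod b q)
      then show ?case using yx[OF prod] cl QR x by (simp add: smult_assoc1)
    next
      case (sum b c)
      then show ?case using x by (simp add: smult_l_distr)
    qed
  qed
  then show ?thesis by blast
qed

text \<open>For a finitely generated ideal, torsion can be tested on the generators separately. In place of the
  pigeonhole principle on monomials there is an induction on the sum of the exponents, which drops
  when \<open>x\<close> is replaced by \<open>y x\<close>.\<close>
lemma (in module) ideal_power_torsion_iff:
  assumes Y: "finite Y" "Y \<subseteq> carrier R" and x: "x \<in> carrier M"
  shows "(\<exists>k::nat. \<forall>a \<in> (Idl Y) [^]\<^bsub>ideals_set R\<^esub> k. a \<odot>\<^bsub>M\<^esub> x = \<zero>\<^bsub>M\<^esub>)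
    \<longleftrightarrow> (\<forall>y \<in> Y. \<exists>k::nat. (y [^] k) \<odot>\<^bsub>M\<^esub> x = \<zero>\<^bsub>M\<^esub>)" (is "?tor x \<longleftrightarrow> _")
proof
  assume "?tor x"
  then show "\<forall>y \<in> Y. \<exists>k::nat. (y [^] k) \<odot>\<^bsub>M\<^esub> x = \<zero>\<^bsub>M\<^esub>"
    using nat_pow_in_ideal_power[of _ "Idl Y"] genideal_self[OF Y(2)] Y(2) by (meson subsetD)
next
  assume "\<forall>y \<in> Y. \<exists>k::nat. (y [^] k) \<odot>\<^bsub>M\<^esub> x = \<zero>\<^bsub>M\<^esub>"
  then obtain k :: "'a \<Rightarrow> nat" where "\<And>y. y \<in> Y \<Longrightarrow> (y [^] k y) \<odot>\<^bsub>M\<^esub> x = \<zero>\<^bsub>M\<^esub>" by metis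
  then show "?tor x" using x
  proof (induction "\<Sum>y\<in>Y. k y" arbitrary: k x rule: less_induct)
    case less
    show ?case
    proof (cases "\<exists>y\<in>Y. k y = 0")
      case True
      then have "x = \<zero>\<^bsub>M\<^esub>" using less.prems by fastforce
      then show ?thesis
        using ideal.Icarr[OF ideal_power_closed[OF genideal_ideal[OF Y(2)]], of _ 0]
        by (intro exI[of _ 0]) auto
    next
      case False
      show ?thesis
      proof (rule ideal_power_torsion_step[OF Y less.prems(2)])
        fix y assume y: "y \<in> Y"
        have yR: "y \<in> carrier R" using y Y(2) by blast
        let ?k = "k(y := k y - 1)"
        have lt: "(\<Sum>z\<in>Y. ?k z) < (\<Sum>z\<in>Y. k z)"
          using Y(1) y False by (intro sum_strict_mono_ex1) auto
        show "?tor (y \<odot>\<^bsub>M\<^esub> x)"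
        proof (rule less.hyps[OF lt])
          fix z assume z: "z \<in> Y"
          have zR: "z \<in> carrier R" using z Y(2) by blast
          show "(z [^] ?k z) \<odot>\<^bsub>M\<^esub> (y \<odot>\<^bsub>M\<^esub> x) = \<zero>\<^bsub>M\<^esub>"
          proof (cases "z = y")
            case True
            obtain m where m: "k y = Suc m" using False y by (metis not0_implies_Suc)
            then show ?thesis using less.prems(1)[OF y] True less.prems(2) yR
              by (simp add: smult_assoc1)
          next
            case ne: False
            have "(z [^] k z) \<odot>\<^bsub>M\<^esub> (y \<odot>\<^bsub>M\<^esub> x) = y \<odot>\<^bsub>M\<^esub> ((z [^] k z) \<odot>\<^bsub>M\<^esub> x)"
              using zR yR less.prems(2) by (simp add: smult_assoc1[symmetric] R.m_comm)
            then show ?thesis using ne less.prems(1)[OF z] yR by simp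
          qed
        next
          show "y \<odot>\<^bsub>M\<^esub> x \<in> carrier M" using yR less.prems(2) by simp
        qed
      qed
    qed
  qed
qed

section \<open>Cohomology of torsion in a complex of divisible modules\<close>

text \<open>The properties of an injective resolution \<open>E\<close> from which its local cohomology is computed. The last one says
  that an element killed by powers of the \<open>y\<^sub>v\<close> with \<open>v \<in> F\<close> has a quotient by \<open>y\<^sub>w\<close> with the same property,
  so that \<open>0 \<rightarrow> \<Gamma>\<^bsub>F \<union> {w}\<^esub>(E) \<rightarrow> \<Gamma>\<^sub>F(E) \<rightarrow> \<Gamma>\<^sub>F(E)[1/y\<^sub>w] \<rightarrow> 0\<close> is exact. Degree \<open>0\<close> is left
  open: the kernel of the first differential is the resolved module.\<close>
locale divisible_complex = R?: cring R for R :: "('a, 'e) ring_scheme" (structure) +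
  fixes E :: "nat \<Rightarrow> ('a, 'c) module" and d :: "nat \<Rightarrow> 'c \<Rightarrow> 'c" and y :: "'v \<Rightarrow> 'a" and W :: "'v set"
  assumes module_E: "module R (E i)"
    and d_hom: "d i \<in> mod_hom R (E i) (E (Suc i))"
    and d_d: "x \<in> carrier (E i) \<Longrightarrow> d (Suc i) (d i x) = \<zero>\<^bsub>E (Suc (Suc i))\<^esub>"
    and exact: "x \<in> carrier (E (Suc i)) \<Longrightarrow> d (Suc i) x = \<zero>\<^bsub>E (Suc (Suc i))\<^esub>
      \<Longrightarrow> x \<in> d i ` carrier (E i)"
    and finite_W: "finite W"
    and y_closed: "v \<in> W \<Longrightarrow> y v \<in> carrier R"
    and divisible: "F \<subseteq> W \<Longrightarrow> w \<in> W - F \<Longrightarrow> x \<in> carrier (E i) \<Longrightarrow>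
      (\<And>v. v \<in> F \<Longrightarrow> \<exists>k::nat. (y v [^] k) \<odot>\<^bsub>E i\<^esub> x = \<zero>\<^bsub>E i\<^esub>) \<Longrightarrow>
      \<exists>x' \<in> carrier (E i). y w \<odot>\<^bsub>E i\<^esub> x' = x \<and>
        (\<forall>v \<in> F. \<exists>k::nat. (y v [^] k) \<odot>\<^bsub>E i\<^esub> x' = \<zero>\<^bsub>E i\<^esub>)"
begin

sublocale E: module R "E i" for i by (rule module_E)

lemma d_closed: "x \<in> carrier (E i) \<Longrightarrow> d i x \<in> carrier (E (Suc i))"
  using d_hom[of i] by (auto simp: mod_hom_def hom_def)

lemma d_add: "x \<in> carrier (E i) \<Longrightarrow> z \<in> carrier (E i) \<Longrightarrow>
    d i (x \<oplus>\<^bsub>E i\<^esub> z) = d i x \<oplus>\<^bsub>E (Suc i)\<^esub> d i z"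
  using d_hom[of i] by (auto simp: mod_hom_def hom_def)

lemma d_smult: "a \<in> carrier R \<Longrightarrow> x \<in> carrier (E i) \<Longrightarrow>
    d i (a \<odot>\<^bsub>E i\<^esub> x) = a \<odot>\<^bsub>E (Suc i)\<^esub> d i x"
  using d_hom[of i] by (auto simp: mod_hom_def hom_def)

lemma d_zero: "d i \<zero>\<^bsub>E i\<^esub> = \<zero>\<^bsub>E (Suc i)\<^esub>"
  using d_smult[of \<zero> "\<zero>\<^bsub>E i\<^esub>" i] d_closed[of "\<zero>\<^bsub>E i\<^esub>" i] by simp

lemma d_minus: "x \<in> carrier (E i) \<Longrightarrow> z \<in> carrier (E i) \<Longrightarrow>
    d i (x \<ominus>\<^bsub>E i\<^esub> z) = d i x \<ominus>\<^bsub>E (Suc i)\<^esub> d i z"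
  using d_smult[of "\<ominus> \<one>" z i] d_closed[of z i]
  by (simp add: a_minus_def d_add E.smult_l_minus)

definition tors :: "'v set \<Rightarrow> nat \<Rightarrow> 'c set" where
  "tors F i = {x \<in> carrier (E i). \<forall>v \<in> F. \<exists>k::nat. (y v [^] k) \<odot>\<^bsub>E i\<^esub> x = \<zero>\<^bsub>E i\<^esub>}"

definition cocycles :: "'v set \<Rightarrow> nat \<Rightarrow> 'c set" where
  "cocycles F i = {x \<in> tors F i. d i x = \<zero>\<^bsub>E (Suc i)\<^esub>}"

text \<open>The term before degree \<open>0\<close> is zero, so the coboundaries in degree \<open>0\<close> are zero.\<close>
definition coboundaries :: "'v set \<Rightarrow> nat \<Rightarrow> 'c set" where
  "coboundaries F i = (case i of 0 \<Rightarrow> {\<zero>\<^bsub>E 0\<^esub>} | Suc j \<Rightarrow> d j ` tors F j)"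

lemma tors_carrier: "x \<in> tors F i \<Longrightarrow> x \<in> carrier (E i)"
  by (simp add: tors_def)

lemma tors_mono: "F \<subseteq> G \<Longrightarrow> tors G i \<subseteq> tors F i"
  by (auto simp: tors_def)

lemma tors_empty: "tors {} i = carrier (E i)"
  by (simp add: tors_def)

lemma tors_insert: "x \<in> tors (insert w F) i \<longleftrightarrow>
    x \<in> tors F i \<and> (\<exists>k::nat. (y w [^] k) \<odot>\<^bsub>E i\<^esub> x = \<zero>\<^bsub>E i\<^esub>)"
  by (auto simp: tors_def)

lemma annihilated_by_larger_power:
  assumes "(a [^] (k::nat)) \<odot>\<^bsub>E i\<^esub> x = \<zero>\<^bsub>E i\<^esub>" "a \<in> carrier R" "x \<in> carrier (E i)" "k \<le> l"
  shows "(a [^] l) \<odot>\<^bsub>E i\<^esub> x = \<zero>\<^bsub>E i\<^esub>"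
proof -
  have "a [^] l = a [^] (l - k) \<otimes> a [^] k" using assms by (simp add: nat_pow_mult)
  then show ?thesis using assms by (simp add: E.smult_assoc1)
qed

lemma tors_smult:
  assumes F: "F \<subseteq> W" and x: "x \<in> tors F i" and a: "a \<in> carrier R"
  shows "a \<odot>\<^bsub>E i\<^esub> x \<in> tors F i"
proof -
  have "\<exists>k::nat. (y v [^] k) \<odot>\<^bsub>E i\<^esub> (a \<odot>\<^bsub>E i\<^esub> x) = \<zero>\<^bsub>E i\<^esub>" if v: "v \<in> F" for v
  proof -
    obtain k :: nat where k: "(y v [^] k) \<odot>\<^bsub>E i\<^esub> x = \<zero>\<^bsub>E i\<^esub>" using x v by (auto simp: tors_def)
    have "(y v [^] k) \<odot>\<^bsub>E i\<^esub> (a \<odot>\<^bsub>E i\<^esub> x) = a \<odot>\<^bsub>E i\<^esub> ((y v [^] k) \<odot>\<^bsub>E i\<^esub> x)"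
      using F v x a y_closed tors_carrier by (simp add: E.smult_assoc1[symmetric] m_comm subset_iff)
    then show ?thesis using k a by auto
  qed
  then show ?thesis using x a by (auto simp: tors_def)
qed

lemma tors_add:
  assumes F: "F \<subseteq> W" and x: "x \<in> tors F i" and z: "z \<in> tors F i"
  shows "x \<oplus>\<^bsub>E i\<^esub> z \<in> tors F i"
proof -
  have "\<exists>k::nat. (y v [^] k) \<odot>\<^bsub>E i\<^esub> (x \<oplus>\<^bsub>E i\<^esub> z) = \<zero>\<^bsub>E i\<^esub>" if v: "v \<in> F" for v
  proof -
    have yv: "y v \<in> carrier R" using v F y_closed by blast
    obtain k l :: nat where "(y v [^] k) \<odot>\<^bsub>E i\<^esub> x = \<zero>\<^bsub>E i\<^esub>" "(y v [^] l) \<odot>\<^bsub>E i\<^esub> z = \<zero>\<^bsub>E i\<^esub>"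
      using x z v unfolding tors_def by blast
    then have "(y v [^] (k + l)) \<odot>\<^bsub>E i\<^esub> x = \<zero>\<^bsub>E i\<^esub>" "(y v [^] (k + l)) \<odot>\<^bsub>E i\<^esub> z = \<zero>\<^bsub>E i\<^esub>"
      using annihilated_by_larger_power yv x z tors_carrier by auto
    then have "(y v [^] (k + l)) \<odot>\<^bsub>E i\<^esub> (x \<oplus>\<^bsub>E i\<^esub> z) = \<zero>\<^bsub>E i\<^esub>"
      using yv x z tors_carrier by (simp add: E.smult_r_distr)
    then show ?thesis by blast
  qed
  then show ?thesis using x z by (auto simp: tors_def)
qed

lemma tors_minus:
  assumes "F \<subseteq> W" "x \<in> tors F i" "z \<in> tors F i"
  shows "x \<ominus>\<^bsub>E i\<^esub> z \<in> tors F i"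
proof -
  have "x \<ominus>\<^bsub>E i\<^esub> z = x \<oplus>\<^bsub>E i\<^esub> (\<ominus> \<one>) \<odot>\<^bsub>E i\<^esub> z"
    using assms tors_carrier by (simp add: a_minus_def E.smult_l_minus)
  also have "\<dots> \<in> tors F i" using assms by (intro tors_add tors_smult) auto
  finally show ?thesis .
qed

lemma tors_zero: "F \<subseteq> W \<Longrightarrow> \<zero>\<^bsub>E i\<^esub> \<in> tors F i"
  using y_closed by (auto simp: tors_def subset_iff)

lemma d_tors:
  assumes F: "F \<subseteq> W" and x: "x \<in> tors F i"
  shows "d i x \<in> tors F (Suc i)"
proof -
  have "\<exists>k::nat. (y v [^] k) \<odot>\<^bsub>E (Suc i)\<^esub> d i x = \<zero>\<^bsub>E (Suc i)\<^esub>" if v: "v \<in> F" for v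
  proof -
    obtain k :: nat where "(y v [^] k) \<odot>\<^bsub>E i\<^esub> x = \<zero>\<^bsub>E i\<^esub>" using x v by (auto simp: tors_def)
    moreover have "y v \<in> carrier R" using v F y_closed by blast
    ultimately have "(y v [^] k) \<odot>\<^bsub>E (Suc i)\<^esub> d i x = \<zero>\<^bsub>E (Suc i)\<^esub>"
      using x tors_carrier d_smult[of "y v [^] k" x i] d_zero by simp
    then show ?thesis by blast
  qed
  then show ?thesis using x d_closed by (auto simp: tors_def)
qed

lemma coboundaries_minus:
  assumes "F \<subseteq> W" "a \<in> coboundaries F i" "b \<in> coboundaries F i"
  shows "a \<ominus>\<^bsub>E i\<^esub> b \<in> coboundaries F i"
proof (cases i)
  case 0
  then show ?thesis using assms by (simp add: coboundaries_def a_minus_def)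
next
  case (Suc j)
  then obtain u v where "u \<in> tors F j" "v \<in> tors F j" "a = d j u" "b = d j v"
    using assms by (auto simp: coboundaries_def)
  moreover from this have "a \<ominus>\<^bsub>E i\<^esub> b = d j (u \<ominus>\<^bsub>E j\<^esub> v)"
    using tors_carrier by (simp add: d_minus Suc)
  ultimately show ?thesis using tors_minus[OF assms(1)] by (auto simp: coboundaries_def Suc)
qed

lemma coboundaries_zero: "F \<subseteq> W \<Longrightarrow> \<zero>\<^bsub>E i\<^esub> \<in> coboundaries F i"
  using tors_zero d_zero by (cases i) (auto simp: coboundaries_def intro!: image_eqI)

lemma coboundaries_carrier: "a \<in> coboundaries F i \<Longrightarrow> a \<in> carrier (E i)"
  using tors_carrier d_closed by (cases i) (auto simp: coboundaries_def)

lemma cocycles_smult: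
  "F \<subseteq> W \<Longrightarrow> x \<in> cocycles F i \<Longrightarrow> a \<in> carrier R \<Longrightarrow> a \<odot>\<^bsub>E i\<^esub> x \<in> cocycles F i"
  using tors_carrier by (auto simp: cocycles_def tors_smult d_smult)

lemma tors_divide_power:
  assumes F: "F \<subseteq> W" and w: "w \<in> W - F"
  shows "x \<in> tors F i \<Longrightarrow> \<exists>x' \<in> tors F i. (y w [^] (n::nat)) \<odot>\<^bsub>E i\<^esub> x' = x"
proof (induction n arbitrary: x)
  case 0
  then show ?case using tors_carrier by auto
next
  case (Suc n)
  have yw: "y w \<in> carrier R" using w y_closed by blast
  obtain x1 where x1: "x1 \<in> tors F i" "y w \<odot>\<^bsub>E i\<^esub> x1 = x"
    using divisible[OF F w, of x i] Suc.prems by (auto simp: tors_def)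
  obtain x2 where x2: "x2 \<in> tors F i" "(y w [^] n) \<odot>\<^bsub>E i\<^esub> x2 = x1"
    using Suc.IH[OF x1(1)] by blast
  have "(y w [^] Suc n) \<odot>\<^bsub>E i\<^esub> x2 = x"
    using x1 x2 tors_carrier yw by (simp add: m_comm E.smult_assoc1)
  then show ?case using x2 by blast
qed

lemma coboundary_divide_power:
  assumes F: "F \<subseteq> W" and w: "w \<in> W - F" and c: "c \<in> coboundaries F i"
  shows "\<exists>z \<in> cocycles F i. (y w [^] (n::nat)) \<odot>\<^bsub>E i\<^esub> z = c"
proof (cases i)
  case 0
  have "y w \<in> carrier R" using w y_closed by blast
  then show ?thesis using 0 c tors_zero[OF F, of 0]
    by (intro bexI[of _ "\<zero>\<^bsub>E i\<^esub>"]) (auto simp: coboundaries_def cocycles_def d_zero)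
next
  case (Suc j)
  have yw: "y w \<in> carrier R" using w y_closed by blast
  obtain u where u: "u \<in> tors F j" "c = d j u" using c Suc by (auto simp: coboundaries_def)
  obtain u' where u': "u' \<in> tors F j" "(y w [^] n) \<odot>\<^bsub>E j\<^esub> u' = u"
    using tors_divide_power[OF F w u(1)] by blast
  have "(y w [^] n) \<odot>\<^bsub>E i\<^esub> d j u' = c"
    using u u' yw tors_carrier by (auto simp: Suc d_smult)
  moreover have "d j u' \<in> cocycles F i"
    using u' tors_carrier d_tors[OF F] d_d by (auto simp: Suc cocycles_def)
  ultimately show ?thesis by blast
qed

text \<open>Localization is exact, so this is the vanishing of \<open>H\<^sup>i\<^sub>F(M)[1/g]\<close>, stated without fractions.\<close>
definition local_vanishing :: "'v set \<Rightarrow> 'a \<Rightarrow> nat \<Rightarrow> bool" where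
  "local_vanishing F g i \<longleftrightarrow>
    (\<forall>x \<in> cocycles F i. \<exists>k::nat. (g [^] k) \<odot>\<^bsub>E i\<^esub> x \<in> coboundaries F i)"

text \<open>The exact sequence \<open>H\<^sup>i\<^sup>-\<^sup>1\<^sub>F(M)[1/(g y\<^sub>w)] \<rightarrow> H\<^sup>i\<^bsub>F \<union> {w}\<^esub>(M)[1/g] \<rightarrow> H\<^sup>i\<^sub>F(M)[1/g]\<close>, chased with
  elements: a cocycle \<open>x\<close> is \<open>d z\<close> with \<open>z\<close> in \<open>\<Gamma>\<^sub>F\<close>, up to a power of \<open>g\<close>; a multiple of \<open>z\<close> by a power of \<open>y\<^sub>w\<close>
  is a cocycle, hence a coboundary after a further multiplication; dividing that coboundary by the power
  of \<open>y\<^sub>w\<close> corrects \<open>z\<close> to an element of \<open>\<Gamma>\<^bsub>F \<union> {w}\<^esub>\<close>.\<close>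
lemma local_vanishing_insert:
  assumes F: "F \<subseteq> W" and w: "w \<in> W - F" and g: "g \<in> carrier R"
    and van: "local_vanishing F g i"
    and van': "\<And>j. i = Suc j \<Longrightarrow> local_vanishing F (g \<otimes> y w) j"
  shows "local_vanishing (insert w F) g i"
  unfolding local_vanishing_def
proof
  fix x assume "x \<in> cocycles (insert w F) i"
  then have xF: "x \<in> cocycles F i" and xw: "\<exists>l::nat. (y w [^] l) \<odot>\<^bsub>E i\<^esub> x = \<zero>\<^bsub>E i\<^esub>"
    by (auto simp: cocycles_def tors_insert)
  obtain k :: nat where k: "(g [^] k) \<odot>\<^bsub>E i\<^esub> x \<in> coboundaries F i"
    using van xF by (auto simp: local_vanishing_def)
  show "\<exists>k::nat. (g [^] k) \<odot>\<^bsub>E i\<^esub> x \<in> coboundaries (insert w F) i"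
  proof (cases i)
    case 0
    then show ?thesis using k by (auto simp: coboundaries_def)
  next
    case (Suc j)
    have yw: "y w \<in> carrier R" using w y_closed by blast
    have xE: "x \<in> carrier (E i)" using xF tors_carrier by (auto simp: cocycles_def)
    obtain l :: nat where l: "(y w [^] l) \<odot>\<^bsub>E i\<^esub> x = \<zero>\<^bsub>E i\<^esub>" using xw by blast
    obtain z where z: "z \<in> tors F j" "(g [^] k) \<odot>\<^bsub>E i\<^esub> x = d j z"
      using k Suc by (auto simp: coboundaries_def)
    have zE: "z \<in> carrier (E j)" using z tors_carrier by blast
    have "d j ((y w [^] l) \<odot>\<^bsub>E j\<^esub> z) = (y w [^] l) \<odot>\<^bsub>E i\<^esub> ((g [^] k) \<odot>\<^bsub>E i\<^esub> x)"
      using z zE yw by (simp add: d_smult Suc)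
    also have "\<dots> = (g [^] k) \<odot>\<^bsub>E i\<^esub> ((y w [^] l) \<odot>\<^bsub>E i\<^esub> x)"
      using g yw xE by (simp add: E.smult_assoc1[symmetric] m_comm)
    finally have "(y w [^] l) \<odot>\<^bsub>E j\<^esub> z \<in> cocycles F j"
      using l g tors_smult[OF F z(1)] yw by (simp add: cocycles_def Suc)
    then obtain k' :: nat where
      "((g \<otimes> y w) [^] k') \<odot>\<^bsub>E j\<^esub> ((y w [^] l) \<odot>\<^bsub>E j\<^esub> z) \<in> coboundaries F j"
      using van'[OF Suc] by (auto simp: local_vanishing_def)
    then obtain z0 where z0: "z0 \<in> cocycles F j"
      "(y w [^] (k' + l)) \<odot>\<^bsub>E j\<^esub> z0 = ((g \<otimes> y w) [^] k') \<odot>\<^bsub>E j\<^esub> ((y w [^] l) \<odot>\<^bsub>E j\<^esub> z)"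
      using coboundary_divide_power[OF F w] by blast
    have z0E: "z0 \<in> carrier (E j)" using z0 tors_carrier by (auto simp: cocycles_def)
    define z' where "z' = (g [^] k') \<odot>\<^bsub>E j\<^esub> z \<ominus>\<^bsub>E j\<^esub> z0"
    have z'F: "z' \<in> tors F j"
      unfolding z'_def using z z0 g by (intro tors_minus tors_smult F) (auto simp: cocycles_def)
    have "((g \<otimes> y w) [^] k') \<odot>\<^bsub>E j\<^esub> ((y w [^] l) \<odot>\<^bsub>E j\<^esub> z)
        = (y w [^] (k' + l)) \<odot>\<^bsub>E j\<^esub> ((g [^] k') \<odot>\<^bsub>E j\<^esub> z)"
    proof -
      have "(g \<otimes> y w) [^] k' \<otimes> y w [^] l = y w [^] (k' + l) \<otimes> g [^] k'"
        using g yw by (simp add: nat_pow_distrib nat_pow_mult[symmetric] m_ac)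
      then show ?thesis using g yw zE by (simp add: E.smult_assoc1[symmetric])
    qed
    then have "(y w [^] (k' + l)) \<odot>\<^bsub>E j\<^esub> z' = \<zero>\<^bsub>E j\<^esub>"
      using z0(2) g yw zE z0E
      by (simp add: z'_def a_minus_def E.smult_r_distr E.smult_r_minus E.M.r_neg)
    then have "z' \<in> tors (insert w F) j" using z'F by (auto simp: tors_insert)
    moreover have "d j z' = (g [^] (k' + k)) \<odot>\<^bsub>E i\<^esub> x"
    proof -
      have "d j z' = d j ((g [^] k') \<odot>\<^bsub>E j\<^esub> z) \<ominus>\<^bsub>E (Suc j)\<^esub> d j z0"
        unfolding z'_def using g zE z0E by (intro d_minus) auto
      also have "\<dots> = (g [^] k') \<odot>\<^bsub>E (Suc j)\<^esub> d j z"
        using g zE z0 d_closed[OF zE] by (simp add: d_smult cocycles_def a_minus_def)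
      also have "\<dots> = (g [^] (k' + k)) \<odot>\<^bsub>E i\<^esub> x"
        using g xE z(2) by (simp add: Suc[symmetric] z(2)[symmetric] nat_pow_mult[symmetric] E.smult_assoc1)
      finally show ?thesis .
    qed
    ultimately have "(g [^] (k' + k)) \<odot>\<^bsub>E i\<^esub> x \<in> coboundaries (insert w F) i"
      using imageI[of z' "tors (insert w F) j" "d j"] by (simp add: coboundaries_def Suc)
    then show ?thesis by blast
  qed
qed

lemma local_vanishing_Suc: "g \<in> carrier R \<Longrightarrow> local_vanishing {} g (Suc i)"
  unfolding local_vanishing_def
proof
  fix x assume x: "x \<in> cocycles {} (Suc i)"
  then have "(g [^] (0::nat)) \<odot>\<^bsub>E (Suc i)\<^esub> x \<in> coboundaries {} (Suc i)"
    using exact[of x i] by (auto simp: cocycles_def coboundaries_def tors_empty)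
  then show "\<exists>k::nat. (g [^] k) \<odot>\<^bsub>E (Suc i)\<^esub> x \<in> coboundaries {} (Suc i)" by blast
qed

text \<open>If \<open>M[1/y\<^sub>G] = 0\<close> for all \<open>G \<notin> \<Delta>\<close>, a nonzero \<open>H\<^sup>i\<^sub>F(M)[1/y\<^sub>G]\<close> requires \<open>A \<subseteq> F\<close> with at
  least \<open>i\<close> elements and \<open>A \<union> G \<in> \<Delta>\<close>. In the induction on \<open>F\<close> the new vertex \<open>w\<close> either stays outside \<open>A\<close>
  or moves into \<open>G\<close> while the degree drops by one.\<close>
lemma local_vanishing_faces:
  assumes base: "\<And>G. G \<subseteq> W \<Longrightarrow> G \<notin> \<Delta> \<Longrightarrow> local_vanishing {} (\<Otimes>v\<in>G. y v) 0"
    and F: "F \<subseteq> W"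
  shows "G \<subseteq> W - F \<Longrightarrow> (\<And>A. A \<subseteq> F \<Longrightarrow> A \<union> G \<in> \<Delta> \<Longrightarrow> card A < i) \<Longrightarrow>
    local_vanishing F (\<Otimes>v\<in>G. y v) i"
  using finite_subset[OF F finite_W] F
proof (induction F arbitrary: G i rule: finite_induct)
  case empty
  have "(\<Otimes>v\<in>G. y v) \<in> carrier R" using empty y_closed by (intro finprod_closed) auto
  then show ?case
    using base[of G] empty local_vanishing_Suc by (cases i) auto
next
  case (insert w F)
  have fG: "finite G" using insert.prems(1) finite_W finite_subset by blast
  show ?case
  proof (rule local_vanishing_insert)
    show "F \<subseteq> W" "w \<in> W - F" using insert by auto
    show "(\<Otimes>v\<in>G. y v) \<in> carrier R" using insert.prems y_closed by (intro finprod_closed) auto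
    show "local_vanishing F (\<Otimes>v\<in>G. y v) i"
    proof (rule insert.IH)
      show "G \<subseteq> W - F" "F \<subseteq> W" using insert.prems by auto
      show "card A < i" if "A \<subseteq> F" "A \<union> G \<in> \<Delta>" for A using insert.prems(2)[of A] that by auto
    qed
    fix j assume i: "i = Suc j"
    have cl: "y v \<in> carrier R" if "v \<in> insert w G" for v
      using that insert.prems y_closed by blast
    have "(\<Otimes>v\<in>insert w G. y v) = y w \<otimes> (\<Otimes>v\<in>G. y v)"
      using insert.prems fG cl by (intro finprod_insert) auto
    then have "(\<Otimes>v\<in>G. y v) \<otimes> y w = (\<Otimes>v\<in>insert w G. y v)"
      using cl by (simp add: m_comm)
    moreover have "local_vanishing F (\<Otimes>v\<in>insert w G. y v) j"
    proof (rule insert.IH)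
      show "insert w G \<subseteq> W - F" "F \<subseteq> W" using insert by auto
      fix A assume A: "A \<subseteq> F" "A \<union> insert w G \<in> \<Delta>"
      have "card (insert w A) < i"
        using insert.prems(2)[of "insert w A"] A by auto
      moreover have "card (insert w A) = Suc (card A)"
        using A insert.hyps finite_subset by (intro card_insert_disjoint) auto
      ultimately show "card A < j" using i by simp
    qed
    ultimately show "local_vanishing F ((\<Otimes>v\<in>G. y v) \<otimes> y w) j" by simp
  qed
qed

text \<open>The case where all sets are faces, which is the bound by the number of generators.\<close>
lemma vanishing_above_card:
  assumes F: "F \<subseteq> W" and i: "card F < i" and x: "x \<in> cocycles F i"
  shows "x \<in> coboundaries F i"
proof -
  have "local_vanishing F (\<Otimes>v\<in>{}. y v) i"
  proof (rule local_vanishing_faces[of UNIV])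
    fix A assume "A \<subseteq> F"
    then show "card A < i" using i card_mono[of F A] finite_subset[OF F finite_W] by linarith
  qed (use F in auto)
  then obtain k :: nat where "(\<one> [^] k) \<odot>\<^bsub>E i\<^esub> x \<in> coboundaries F i"
    using x by (auto simp: local_vanishing_def)
  moreover have "x \<in> carrier (E i)" using x tors_carrier by (auto simp: cocycles_def)
  ultimately show ?thesis by simp
qed

text \<open>The elements \<open>\<Sum>\<^sub>w \<^sub>\<in> \<^sub>G y\<^sub>w\<^sup>m c\<^sub>w\<close> with cocycles \<open>c\<^sub>w\<close>.\<close>
inductive_set power_span :: "'v set \<Rightarrow> 'v set \<Rightarrow> nat \<Rightarrow> nat \<Rightarrow> 'c set"
  for A G :: "'v set" and m i :: nat where
  zero: "\<zero>\<^bsub>E i\<^esub> \<in> power_span A G m i"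
| gen: "w \<in> G \<Longrightarrow> c \<in> cocycles A i \<Longrightarrow> (y w [^] m) \<odot>\<^bsub>E i\<^esub> c \<in> power_span A G m i"
| add: "s \<in> power_span A G m i \<Longrightarrow> t \<in> power_span A G m i \<Longrightarrow> s \<oplus>\<^bsub>E i\<^esub> t \<in> power_span A G m i"

lemma power_span_carrier:
  assumes "G \<subseteq> W" "s \<in> power_span A G m i"
  shows "s \<in> carrier (E i)"
  using assms(2)
proof induction
  case (gen w c)
  then show ?case using assms(1) y_closed tors_carrier by (auto simp: cocycles_def)
qed auto

lemma power_span_smult:
  assumes A: "A \<subseteq> W" and G: "G \<subseteq> W" and a: "a \<in> carrier R" and s: "s \<in> power_span A G m i"
  shows "a \<odot>\<^bsub>E i\<^esub> s \<in> power_span A G m i"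
  using s
proof induction
  case zero
  then show ?case using a power_span.zero by simp
next
  case (gen w c)
  have yw: "y w \<in> carrier R" using gen G y_closed by blast
  have "c \<in> carrier (E i)" using gen tors_carrier by (auto simp: cocycles_def)
  then have "a \<odot>\<^bsub>E i\<^esub> ((y w [^] m) \<odot>\<^bsub>E i\<^esub> c) = (y w [^] m) \<odot>\<^bsub>E i\<^esub> (a \<odot>\<^bsub>E i\<^esub> c)"
    using a yw by (simp add: E.smult_assoc1[symmetric] m_comm)
  then show ?case using power_span.gen[OF gen(1) cocycles_smult[OF A gen(2) a]] by simp
next
  case (add s t)
  then show ?case using power_span.add a power_span_carrier[OF G] by (simp add: E.smult_r_distr)
qed

lemma power_span_mono: "G \<subseteq> H \<Longrightarrow> s \<in> power_span A G m i \<Longrightarrow> s \<in> power_span A H m i"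
  by (rotate_tac, induction rule: power_span.induct) (auto intro: power_span.intros)

text \<open>In \<open>H\<^sup>i\<^sub>A(M)[1/y\<^sub>G]\<close>, the class of \<open>z/y\<^sub>G\<^sup>2\<close> lies in the sum of the images of \<open>H\<^sup>i\<^sub>A(M)[1/y\<^bsub>G - {w}\<^esub>]\<close>
  for \<open>w \<in> G\<close>. If \<open>A\<close> has \<open>i\<close> elements, this says that the class in \<open>H\<^bsup>i + |G|\<^esup>\<^bsub>A \<union> G\<^esub>(M)\<close> obtained from \<open>z/y\<^sub>G\<^sup>2\<close>
  by connecting homomorphisms vanishes.\<close>
definition over_divisible :: "'v set \<Rightarrow> 'v set \<Rightarrow> nat \<Rightarrow> 'c \<Rightarrow> bool" where
  "over_divisible A G i z \<longleftrightarrow> (\<exists>k::nat. \<exists>s \<in> power_span A G (k + 2) i. \<exists>b \<in> coboundaries A i.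
     ((\<Otimes>v\<in>G. y v) [^] k) \<odot>\<^bsub>E i\<^esub> z = s \<oplus>\<^bsub>E i\<^esub> b)"

text \<open>A combination of cocycles in degree \<open>i + 1\<close> is lifted along \<open>d\<close> term by term, which is possible because
  \<open>A\<close> has at most \<open>i\<close> elements. The lift of a term is multiplied into a cocycle by the power of \<open>y\<^sub>w\<close> that
  kills the term. The exponent \<open>N\<close> has to serve all terms of a sum at once, hence the bound \<open>N0\<close>.\<close>
lemma power_span_lift:
  assumes A: "A \<subseteq> W" and w: "w \<in> W - A" and G: "G \<subseteq> W" and Ai: "card A \<le> i"
    and s: "s \<in> power_span (insert w A) G m (Suc i)"
  shows "\<exists>e \<in> tors A i. d i e = s \<and> (\<exists>N0. \<forall>N\<ge>N0.
    (y w [^] N) \<odot>\<^bsub>E i\<^esub> (((\<Otimes>v\<in>G. y v) [^] N) \<odot>\<^bsub>E i\<^esub> e) \<in> power_span A G (m + N) i)"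
  using s
proof induction
  case zero
  have "y w \<in> carrier R" "(\<Otimes>v\<in>G. y v) \<in> carrier R" using w G y_closed by (auto intro!: finprod_closed)
  then show ?case using tors_zero[OF A] power_span.zero
    by (intro bexI[of _ "\<zero>\<^bsub>E i\<^esub>"]) (auto simp: d_zero)
next
  case (gen v c)
  have yw: "y w \<in> carrier R" and yv: "y v \<in> carrier R" using w gen G y_closed by auto
  have cE: "c \<in> carrier (E (Suc i))" using gen tors_carrier by (auto simp: cocycles_def)
  have cA: "c \<in> cocycles A (Suc i)" using gen by (auto simp: cocycles_def tors_insert)
  obtain l :: nat where l: "(y w [^] l) \<odot>\<^bsub>E (Suc i)\<^esub> c = \<zero>\<^bsub>E (Suc i)\<^esub>"
    using gen by (auto simp: cocycles_def tors_insert)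
  obtain e where e: "e \<in> tors A i" "d i e = c"
    using vanishing_above_card[OF A _ cA] Ai by (auto simp: coboundaries_def)
  have eE: "e \<in> carrier (E i)" using e tors_carrier by blast
  define P where "P = (\<Otimes>v\<in>G - {v}. y v)"
  have P: "P \<in> carrier R" unfolding P_def using G y_closed by (auto intro!: finprod_closed)
  have fG: "finite G" using finite_subset[OF G finite_W] .
  have "(\<Otimes>v\<in>insert v (G - {v}). y v) = y v \<otimes> P"
    unfolding P_def using fG G y_closed yv by (intro finprod_insert) auto
  then have PG: "(\<Otimes>v\<in>G. y v) = y v \<otimes> P" using gen(1) by (simp add: insert_absorb)
  have "(y w [^] N) \<odot>\<^bsub>E i\<^esub> (((\<Otimes>v\<in>G. y v) [^] N) \<odot>\<^bsub>E i\<^esub> ((y v [^] m) \<odot>\<^bsub>E i\<^esub> e))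
      \<in> power_span A G (m + N) i" if N: "N \<ge> l" for N
  proof -
    have "y w [^] N \<otimes> ((y v \<otimes> P) [^] N \<otimes> y v [^] m) = y v [^] (m + N) \<otimes> (P [^] N \<otimes> y w [^] N)"
      using yw yv P by (simp add: nat_pow_distrib nat_pow_mult[symmetric] m_ac)
    then have "(y w [^] N) \<odot>\<^bsub>E i\<^esub> (((\<Otimes>v\<in>G. y v) [^] N) \<odot>\<^bsub>E i\<^esub> ((y v [^] m) \<odot>\<^bsub>E i\<^esub> e))
        = (y v [^] (m + N)) \<odot>\<^bsub>E i\<^esub> ((P [^] N) \<odot>\<^bsub>E i\<^esub> ((y w [^] N) \<odot>\<^bsub>E i\<^esub> e))"
      using yw yv P eE by (simp add: PG E.smult_assoc1[symmetric])
    moreover have "(y w [^] N) \<odot>\<^bsub>E i\<^esub> e \<in> cocycles A i"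
      using annihilated_by_larger_power[OF l yw cE N] tors_smult[OF A e(1)] yw eE e(2)
      by (simp add: cocycles_def d_smult)
    ultimately show ?thesis using cocycles_smult[OF A] P power_span.gen[OF gen(1)] by simp
  qed
  then show ?case using tors_smult[OF A e(1)] yv eE e(2)
    by (intro bexI[of _ "(y v [^] m) \<odot>\<^bsub>E i\<^esub> e"]) (auto simp: d_smult)
next
  case (add s t)
  then obtain e f M N where e: "e \<in> tors A i" "d i e = s"
      "\<And>k. k \<ge> M \<Longrightarrow> (y w [^] k) \<odot>\<^bsub>E i\<^esub> (((\<Otimes>v\<in>G. y v) [^] k) \<odot>\<^bsub>E i\<^esub> e) \<in> power_span A G (m + k) i"
    and f: "f \<in> tors A i" "d i f = t"
      "\<And>k. k \<ge> N \<Longrightarrow> (y w [^] k) \<odot>\<^bsub>E i\<^esub> (((\<Otimes>v\<in>G. y v) [^] k) \<odot>\<^bsub>E i\<^esub> f) \<in> power_span A G (m + k) i"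
    by metis
  have yw: "y w \<in> carrier R" and PR: "(\<Otimes>v\<in>G. y v) \<in> carrier R"
    using w G y_closed by (auto intro!: finprod_closed)
  have cl: "e \<in> carrier (E i)" "f \<in> carrier (E i)" using e f tors_carrier by auto
  have "(y w [^] k) \<odot>\<^bsub>E i\<^esub> (((\<Otimes>v\<in>G. y v) [^] k) \<odot>\<^bsub>E i\<^esub> (e \<oplus>\<^bsub>E i\<^esub> f)) \<in> power_span A G (m + k) i"
    if "k \<ge> M + N" for k
    using power_span.add[OF e(3) f(3), of k] that yw PR cl by (simp add: E.smult_r_distr)
  then show ?case using tors_add[OF A e(1) f(1)] cl e(2) f(2)
    by (intro bexI[of _ "e \<oplus>\<^bsub>E i\<^esub> f"]) (auto simp: d_add)
qed

text \<open>One step back along the connecting homomorphism. From \<open>y\<^sub>G\<^sup>k d\<zeta> = s + d\<eta>\<close> and a lift \<open>e\<close> of \<open>s\<close>, the element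
  \<open>c = y\<^sub>G\<^sup>k \<zeta> - e - \<eta>\<close> is a cocycle. Multiplication by a large power of \<open>y\<^sub>w\<close> kills \<open>\<eta>\<close> and turns the multiple
  of \<open>e\<close> into a combination of cocycles, while \<open>c\<close> provides the new term with a power of \<open>y\<^sub>w\<close>.\<close>
lemma over_divisible_step:
  assumes A: "A \<subseteq> W" and w: "w \<in> W - A" and G: "G \<subseteq> W - insert w A" and Ai: "card A \<le> i"
    and \<zeta>: "\<zeta> \<in> tors A i" and bad: "over_divisible (insert w A) G (Suc i) (d i \<zeta>)"
  shows "over_divisible A (insert w G) i ((y w [^] (2::nat)) \<odot>\<^bsub>E i\<^esub> \<zeta>)"
proof -
  have GW: "G \<subseteq> W" using G by blast
  define P where "P = (\<Otimes>v\<in>G. y v)"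
  have yw: "y w \<in> carrier R" and P: "P \<in> carrier R"
    unfolding P_def using w GW y_closed by (auto intro!: finprod_closed)
  have PI: "(\<Otimes>v\<in>insert w G. y v) = y w \<otimes> P"
    unfolding P_def using G y_closed yw finite_subset[OF GW finite_W] by (intro finprod_insert) auto
  obtain k s \<eta> where s: "s \<in> power_span (insert w A) G (k + 2) (Suc i)"
    and \<eta>: "\<eta> \<in> tors (insert w A) i"
    and eq: "(P [^] k) \<odot>\<^bsub>E (Suc i)\<^esub> d i \<zeta> = s \<oplus>\<^bsub>E (Suc i)\<^esub> d i \<eta>"
    using bad by (auto simp: over_divisible_def coboundaries_def P_def)
  obtain e N0 where e: "e \<in> tors A i" "d i e = s" and eN: "\<And>N. N \<ge> N0 \<Longrightarrow>
      (y w [^] N) \<odot>\<^bsub>E i\<^esub> ((P [^] N) \<odot>\<^bsub>E i\<^esub> e) \<in> power_span A G (k + 2 + N) i"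
    using power_span_lift[OF A w GW Ai s] unfolding P_def by blast
  have \<eta>A: "\<eta> \<in> tors A i" using \<eta> by (simp add: tors_insert)
  obtain l :: nat where l: "(y w [^] l) \<odot>\<^bsub>E i\<^esub> \<eta> = \<zero>\<^bsub>E i\<^esub>" using \<eta> by (auto simp: tors_insert)
  have cl: "\<zeta> \<in> carrier (E i)" "e \<in> carrier (E i)" "\<eta> \<in> carrier (E i)"
    using \<zeta> e \<eta>A tors_carrier by auto
  define c where "c = (P [^] k) \<odot>\<^bsub>E i\<^esub> \<zeta> \<ominus>\<^bsub>E i\<^esub> (e \<oplus>\<^bsub>E i\<^esub> \<eta>)"
  have cA: "c \<in> tors A i" unfolding c_def using \<zeta> e \<eta>A P by (intro tors_minus tors_add tors_smult A) auto
  have "d i c = d i ((P [^] k) \<odot>\<^bsub>E i\<^esub> \<zeta>) \<ominus>\<^bsub>E (Suc i)\<^esub> d i (e \<oplus>\<^bsub>E i\<^esub> \<eta>)"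
    unfolding c_def using cl P by (intro d_minus) auto
  also have "\<dots> = \<zero>\<^bsub>E (Suc i)\<^esub>"
    using cl P eq e(2) d_closed[OF cl(2)] d_closed[OF cl(3)]
    by (simp add: d_add d_smult a_minus_def E.M.r_neg)
  finally have "d i c = \<zero>\<^bsub>E (Suc i)\<^esub>" .
  with cA have cZ: "c \<in> cocycles A i" by (simp add: cocycles_def)
  have cE: "c \<in> carrier (E i)" using cA tors_carrier by blast
  define N where "N = N0 + l"
  have \<eta>0: "(y w [^] N) \<odot>\<^bsub>E i\<^esub> \<eta> = \<zero>\<^bsub>E i\<^esub>"
    by (rule annihilated_by_larger_power[OF l yw cl(3)]) (simp add: N_def)
  have "(P [^] k) \<odot>\<^bsub>E i\<^esub> \<zeta> = c \<oplus>\<^bsub>E i\<^esub> (e \<oplus>\<^bsub>E i\<^esub> \<eta>)"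
  proof -
    have "(P [^] k) \<odot>\<^bsub>E i\<^esub> \<zeta> \<in> carrier (E i)" using cl P by simp
    then show ?thesis unfolding c_def a_minus_def using cl
      by (simp add: E.M.a_assoc E.M.l_neg)
  qed
  then have "(y w [^] (k + 2) \<otimes> (y w [^] N \<otimes> P [^] N)) \<odot>\<^bsub>E i\<^esub> ((P [^] k) \<odot>\<^bsub>E i\<^esub> \<zeta>)
      = (y w [^] (k + 2) \<otimes> (y w [^] N \<otimes> P [^] N)) \<odot>\<^bsub>E i\<^esub> (c \<oplus>\<^bsub>E i\<^esub> (e \<oplus>\<^bsub>E i\<^esub> \<eta>))" by simp
  also have "\<dots> = (y w [^] (k + 2) \<otimes> (y w [^] N \<otimes> P [^] N)) \<odot>\<^bsub>E i\<^esub> c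
      \<oplus>\<^bsub>E i\<^esub> ((y w [^] (k + 2) \<otimes> (y w [^] N \<otimes> P [^] N)) \<odot>\<^bsub>E i\<^esub> e
      \<oplus>\<^bsub>E i\<^esub> (y w [^] (k + 2) \<otimes> (y w [^] N \<otimes> P [^] N)) \<odot>\<^bsub>E i\<^esub> \<eta>)"
    using cl cE yw P by (simp add: E.smult_r_distr)
  also have "(y w [^] (k + 2) \<otimes> (y w [^] N \<otimes> P [^] N)) \<odot>\<^bsub>E i\<^esub> c
      = (y w [^] ((k + N) + 2)) \<odot>\<^bsub>E i\<^esub> ((P [^] N) \<odot>\<^bsub>E i\<^esub> c)"
  proof -
    have "y w [^] (k + 2) \<otimes> (y w [^] N \<otimes> P [^] N) = y w [^] ((k + 2) + N) \<otimes> P [^] N"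
      using yw P by (simp only: nat_pow_mult[symmetric] m_assoc nat_pow_closed m_closed)
    also have "(k + 2) + N = (k + N) + 2" by simp
    finally show ?thesis using yw P cE by (simp add: E.smult_assoc1)
  qed
  also have "(y w [^] (k + 2) \<otimes> (y w [^] N \<otimes> P [^] N)) \<odot>\<^bsub>E i\<^esub> e
      = (y w [^] (k + 2)) \<odot>\<^bsub>E i\<^esub> ((y w [^] N) \<odot>\<^bsub>E i\<^esub> ((P [^] N) \<odot>\<^bsub>E i\<^esub> e))"
    using yw P cl by (simp add: E.smult_assoc1)
  also have "(y w [^] (k + 2) \<otimes> (y w [^] N \<otimes> P [^] N)) \<odot>\<^bsub>E i\<^esub> \<eta> = \<zero>\<^bsub>E i\<^esub>"
  proof -
    have "y w [^] (k + 2) \<otimes> (y w [^] N \<otimes> P [^] N) = (y w [^] (k + 2) \<otimes> P [^] N) \<otimes> y w [^] N"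
      using yw P by (simp add: m_ac)
    then show ?thesis using \<eta>0 yw P cl by (simp add: E.smult_assoc1)
  qed
  finally have main: "(y w [^] (k + 2) \<otimes> (y w [^] N \<otimes> P [^] N)) \<odot>\<^bsub>E i\<^esub> ((P [^] k) \<odot>\<^bsub>E i\<^esub> \<zeta>)
      = (y w [^] ((k + N) + 2)) \<odot>\<^bsub>E i\<^esub> ((P [^] N) \<odot>\<^bsub>E i\<^esub> c)
      \<oplus>\<^bsub>E i\<^esub> ((y w [^] (k + 2)) \<odot>\<^bsub>E i\<^esub> ((y w [^] N) \<odot>\<^bsub>E i\<^esub> ((P [^] N) \<odot>\<^bsub>E i\<^esub> e)) \<oplus>\<^bsub>E i\<^esub> \<zero>\<^bsub>E i\<^esub>)"
    (is "_ = ?s1 \<oplus>\<^bsub>E i\<^esub> (?s2 \<oplus>\<^bsub>E i\<^esub> _)") .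
  \<comment> \<open>The exponent of \<open>y w\<close> on the right is \<open>(k + N) + 2\<close>; the two extra factors belong to \<open>y\<^sub>w\<^sup>2 \<zeta>\<close>.\<close>
  have lhs: "((y w \<otimes> P) [^] (k + N)) \<odot>\<^bsub>E i\<^esub> ((y w [^] (2::nat)) \<odot>\<^bsub>E i\<^esub> \<zeta>)
     = (y w [^] (k + 2) \<otimes> (y w [^] N \<otimes> P [^] N)) \<odot>\<^bsub>E i\<^esub> ((P [^] k) \<odot>\<^bsub>E i\<^esub> \<zeta>)"
  proof -
    have "(y w \<otimes> P) [^] (k + N) \<otimes> y w [^] (2::nat) = (y w [^] (k + 2) \<otimes> (y w [^] N \<otimes> P [^] N)) \<otimes> P [^] k"
      using yw P by (simp only: nat_pow_distrib nat_pow_mult[symmetric] m_ac nat_pow_closed m_closed)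
    then show ?thesis using yw P cl by (simp only: E.smult_assoc1[symmetric] nat_pow_closed m_closed)
  qed
  have s1: "?s1 \<in> power_span A (insert w G) ((k + N) + 2) i"
    using P by (intro power_span.gen cocycles_smult A cZ) auto
  have "(y w [^] N) \<odot>\<^bsub>E i\<^esub> ((P [^] N) \<odot>\<^bsub>E i\<^esub> e) \<in> power_span A G ((k + N) + 2) i"
    using eN[of N] by (simp add: N_def add_ac)
  from power_span_smult[OF A GW nat_pow_closed[OF yw] this]
  have "?s2 \<in> power_span A G ((k + N) + 2) i" .
  then have s2: "?s2 \<in> power_span A (insert w G) ((k + N) + 2) i"
    using power_span_mono[of G "insert w G"] by blast
  have cls: "?s1 \<in> carrier (E i)" "?s2 \<in> carrier (E i)" using yw P cE cl by simp_all
  have "((y w \<otimes> P) [^] (k + N)) \<odot>\<^bsub>E i\<^esub> ((y w [^] (2::nat)) \<odot>\<^bsub>E i\<^esub> \<zeta>) = (?s1 \<oplus>\<^bsub>E i\<^esub> ?s2) \<oplus>\<^bsub>E i\<^esub> \<zero>\<^bsub>E i\<^esub>"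
    unfolding lhs main using cls by simp
  then show ?thesis
    unfolding over_divisible_def PI using power_span.add[OF s1 s2] coboundaries_zero[OF A] by blast
qed

text \<open>The class of \<open>z/y\<^sub>G\<^sup>2\<close> is pushed to degree \<open>i + |G|\<close> by alternately dividing by \<open>y\<^sub>w\<^sup>2\<close> and applying \<open>d\<close>, for
  the \<open>w \<in> G\<close> in turn. All divisions can be made within the elements killed by powers of the \<open>y\<^sub>v\<close> with
  \<open>v \<in> N\<close>, so \<open>N\<close> is carried along in the support of the result, while nonvanishing is only
  tested against the larger group of coboundaries with support in \<open>A \<union> G\<close>.\<close>
lemma nonvanishing:
  assumes N: "N \<subseteq> W" and G: "finite G"
  shows "A \<subseteq> W - N \<Longrightarrow> G \<subseteq> W - N - A \<Longrightarrow> card A \<le> i \<Longrightarrow> z \<in> cocycles (A \<union> N) i \<Longrightarrow>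
    \<not> over_divisible A G i z \<Longrightarrow>
    \<exists>\<xi> \<in> cocycles (A \<union> G \<union> N) (i + card G). \<xi> \<notin> coboundaries (A \<union> G) (i + card G)"
  using G
proof (induction G arbitrary: A i z rule: finite_induct)
  case empty
  have "z \<notin> coboundaries A i"
  proof
    assume z: "z \<in> coboundaries A i"
    have "z \<in> carrier (E i)" using empty tors_carrier by (auto simp: cocycles_def)
    then have "((\<Otimes>v\<in>{}. y v) [^] (0::nat)) \<odot>\<^bsub>E i\<^esub> z = \<zero>\<^bsub>E i\<^esub> \<oplus>\<^bsub>E i\<^esub> z" by simp
    then have "over_divisible A {} i z"
      unfolding over_divisible_def using z power_span.zero by blast
    then show False using empty by blast
  qed
  then show ?case using empty by (intro bexI[of _ z]) auto
next
  case (insert w G)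
  have w: "w \<in> W - (A \<union> N)" and AN: "A \<union> N \<subseteq> W" and wN: "w \<notin> N" "w \<notin> A" using insert N by auto
  have yw: "y w \<in> carrier R" using w y_closed by blast
  have zt: "z \<in> tors (A \<union> N) i" using insert by (simp add: cocycles_def)
  obtain \<zeta> where \<zeta>: "\<zeta> \<in> tors (A \<union> N) i" "(y w [^] (2::nat)) \<odot>\<^bsub>E i\<^esub> \<zeta> = z"
    using tors_divide_power[OF AN w zt] by blast
  have \<zeta>E: "\<zeta> \<in> carrier (E i)" using \<zeta> tors_carrier by blast
  have "(y w [^] (2::nat)) \<odot>\<^bsub>E (Suc i)\<^esub> d i \<zeta> = d i z"
    using \<zeta>(2) d_smult[OF nat_pow_closed[OF yw] \<zeta>E] by metis
  also have "\<dots> = \<zero>\<^bsub>E (Suc i)\<^esub>" using insert by (simp add: cocycles_def)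
  finally have "d i \<zeta> \<in> tors (insert w (A \<union> N)) (Suc i)"
    using d_tors[OF AN \<zeta>(1)] by (auto simp: tors_insert)
  then have c: "d i \<zeta> \<in> cocycles (insert w A \<union> N) (Suc i)"
    using d_d[OF \<zeta>E] by (simp add: cocycles_def)
  have "\<not> over_divisible (insert w A) G (Suc i) (d i \<zeta>)"
  proof
    assume *: "over_divisible (insert w A) G (Suc i) (d i \<zeta>)"
    have "over_divisible A (insert w G) i ((y w [^] (2::nat)) \<odot>\<^bsub>E i\<^esub> \<zeta>)"
    proof (rule over_divisible_step[OF _ _ _ _ _ *])
      show "\<zeta> \<in> tors A i" using \<zeta> tors_mono[of A "A \<union> N"] by blast
    qed (use insert N in auto)
    then show False using \<zeta>(2) insert by simp
  qed
  note bad = this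
  have sub: "insert w A \<subseteq> W - N" "G \<subseteq> W - N - insert w A"
    using insert wN w by auto
  have "card (insert w A) \<le> Suc i"
    using insert.prems(3) card_insert_le_m1[of "Suc i" A w] by simp
  then have "\<exists>\<xi>\<in>cocycles (insert w A \<union> G \<union> N) (Suc i + card G). \<xi> \<notin> coboundaries (insert w A \<union> G) (Suc i + card G)"
    by (intro insert.IH[OF sub _ c bad])
  moreover have "Suc i + card G = i + card (insert w G)" using insert by simp
  moreover have "insert w A \<union> G = A \<union> insert w G" by blast
  ultimately show ?case by metis
qed

lemma torsion_module_eq: "torsion_module R (Idl (y ` W)) (E i) = (E i)\<lparr>carrier := tors W i\<rparr>"
proof -
  have "y ` W \<subseteq> carrier R" "finite (y ` W)" using y_closed finite_W by auto
  note E.ideal_power_torsion_iff[OF this(2,1), of _ i]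
  then have "{x \<in> carrier (E i). \<exists>k::nat. \<forall>a\<in>Idl (y ` W) [^]\<^bsub>ideals_set R\<^esub> k. a \<odot>\<^bsub>E i\<^esub> x = \<zero>\<^bsub>E i\<^esub>} = tors W i"
    unfolding tors_def by auto
  then show ?thesis unfolding torsion_module_def by simp
qed

text \<open>A coset of the coboundaries is the zero element exactly if its representative is a coboundary.\<close>
lemma torsion_cohomology_nonzero_iff:
  "carrier (torsion_cohomology R (Idl (y ` W)) E d i)
      \<noteq> {\<zero>\<^bsub>torsion_cohomology R (Idl (y ` W)) E d i\<^esub>}
    \<longleftrightarrow> \<not> cocycles W i \<subseteq> coboundaries W i"
proof -
  let ?N = "coboundaries W i"
  define coset where "coset a = (\<Union>h\<in>?N. {h \<oplus>\<^bsub>E i\<^esub> a})" for a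
  have N: "(case i of 0 \<Rightarrow> {\<zero>\<^bsub>E 0\<^esub>}
      | Suc j \<Rightarrow> d j ` carrier (torsion_module R (Idl (y ` W)) (E j))) = ?N"
    by (simp add: coboundaries_def torsion_module_eq split: nat.split)
  have Z: "a_kernel ((E i)\<lparr>carrier := tors W i\<rparr>) ((E (Suc i))\<lparr>carrier := tors W (Suc i)\<rparr>) (d i) = cocycles W i"
    by (simp add: a_kernel_def' cocycles_def)
  have H: "carrier (torsion_cohomology R (Idl (y ` W)) E d i) = coset ` cocycles W i"
    "\<zero>\<^bsub>torsion_cohomology R (Idl (y ` W)) E d i\<^esub> = ?N"
    by (auto simp: torsion_cohomology_def torsion_module_eq Z N quotient_module_def A_RCOSETS_def' a_r_coset_def'
        coset_def)
  have coset_iff: "coset a = ?N \<longleftrightarrow> a \<in> ?N" if a: "a \<in> cocycles W i" for a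
  proof
    have aE: "a \<in> carrier (E i)" using a tors_carrier by (auto simp: cocycles_def)
    { assume "coset a = ?N"
      moreover have "\<zero>\<^bsub>E i\<^esub> \<oplus>\<^bsub>E i\<^esub> a \<in> coset a"
        unfolding coset_def using coboundaries_zero[of W i] by blast
      ultimately show "a \<in> ?N" using aE by simp }
    assume aN: "a \<in> ?N"
    have "h \<oplus>\<^bsub>E i\<^esub> a \<in> ?N" if h: "h \<in> ?N" for h
    proof -
      have "\<zero>\<^bsub>E i\<^esub> \<ominus>\<^bsub>E i\<^esub> a \<in> ?N" by (rule coboundaries_minus[OF order_refl coboundaries_zero[OF order_refl] aN])
      then have "h \<ominus>\<^bsub>E i\<^esub> (\<zero>\<^bsub>E i\<^esub> \<ominus>\<^bsub>E i\<^esub> a) \<in> ?N" by (rule coboundaries_minus[OF order_refl h])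
      then show ?thesis using aE coboundaries_carrier[OF h] by (simp add: a_minus_def)
    qed
    moreover have "h \<in> coset a" if h: "h \<in> ?N" for h
    proof -
      have "h \<ominus>\<^bsub>E i\<^esub> a \<in> ?N" by (intro coboundaries_minus h aN order_refl)
      moreover have "(h \<ominus>\<^bsub>E i\<^esub> a) \<oplus>\<^bsub>E i\<^esub> a = h"
        using aE coboundaries_carrier[OF h] by (simp add: a_minus_def E.M.a_assoc E.M.l_neg)
      ultimately show ?thesis unfolding coset_def by force
    qed
    ultimately show "coset a = ?N" unfolding coset_def by blast
  qed
  have "\<zero>\<^bsub>E i\<^esub> \<in> cocycles W i" using tors_zero[of W i] d_zero by (simp add: cocycles_def)
  then have "coset ` cocycles W i = {?N} \<longleftrightarrow> (\<forall>a \<in> cocycles W i. coset a = ?N)" by blast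
  also have "\<dots> \<longleftrightarrow> cocycles W i \<subseteq> ?N" using coset_iff by blast
  finally show ?thesis unfolding H by blast
qed

end

section \<open>Local cohomology by resolutions\<close>

text \<open>The cobar resolution shows that the choice in the definition of local cohomology is made among actual
  resolutions; the chosen one can be any of them.\<close>
lemma local_cohomology_by_resolution:
  fixes R :: "('a, 'e) ring_scheme" and M :: "('a, 'b) module"
  assumes "module R M" "subfield K R"
  obtains E d \<epsilon> where "injective_resolution R M (E :: nat \<Rightarrow> ('a, 'a list \<Rightarrow> 'b) module) d \<epsilon>"
    "\<And>Q i. local_cohomology R Q M i = torsion_cohomology R Q E d i"
proof -
  interpret module_over_field_algebra R M K
    by (rule module_over_field_algebra.intro[OF assms(1) module_over_field_algebra_axioms.intro[OF assms(2)]])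
  define P where "P = (\<lambda>(E :: nat \<Rightarrow> ('a, 'a list \<Rightarrow> 'b) module, d). \<exists>\<epsilon>. injective_resolution R M E d \<epsilon>)"
  have "P (cobar, \<lambda>n. cobar_diff)" unfolding P_def using cobar_resolution by auto
  then have P: "P (SOME x. P x)" by (rule someI)
  obtain E d where Ed: "(SOME x. P x) = (E, d)" by (cases "SOME x. P x") blast
  have "local_cohomology R Q M i = torsion_cohomology R Q E d i" for Q i
    unfolding local_cohomology_def using Ed unfolding P_def by simp
  moreover obtain \<epsilon> where "injective_resolution R M E d \<epsilon>" using P unfolding Ed by (auto simp: P_def)
  ultimately show thesis using that by blast
qed

section \<open>Polynomial rings and monomial ideals\<close>

lemma mpoly_ring_simps [simp]:
  "carrier (mpoly_ring U) = {p. \<forall>t \<in> Poly_Mapping.keys p. Poly_Mapping.keys t \<subseteq> U}"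
  "p \<otimes>\<^bsub>mpoly_ring U\<^esub> q = p * q" "p \<oplus>\<^bsub>mpoly_ring U\<^esub> q = p + q"
  "\<one>\<^bsub>mpoly_ring U\<^esub> = 1" "\<zero>\<^bsub>mpoly_ring U\<^esub> = 0"
  by (simp_all add: mpoly_ring_def ring_of_type_algebra_def)

lemma keys_add_nat: "Poly_Mapping.keys ((s :: 'v \<Rightarrow>\<^sub>0 nat) + t) = Poly_Mapping.keys s \<union> Poly_Mapping.keys t"
  by (auto simp: in_keys_iff lookup_add)

lemma cring_mpoly_ring: "cring (mpoly_ring U :: ('v, 'k::field) mpoly ring)"
proof (rule cringI)
  have add: "p + q \<in> carrier (mpoly_ring U)" if "p \<in> carrier (mpoly_ring U)" "q \<in> carrier (mpoly_ring U)"
    for p q :: "('v, 'k) mpoly"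
    using that Poly_Mapping.keys_add[of p q] by auto
  have mult: "p * q \<in> carrier (mpoly_ring U)" if "p \<in> carrier (mpoly_ring U)" "q \<in> carrier (mpoly_ring U)"
    for p q :: "('v, 'k) mpoly"
  proof -
    have "Poly_Mapping.keys t \<subseteq> U" if t: "t \<in> Poly_Mapping.keys (p * q)" for t
    proof -
      obtain a b where "t = a + b" "a \<in> Poly_Mapping.keys p" "b \<in> Poly_Mapping.keys q"
        using t keys_mult[of p q] by blast
      then show ?thesis using \<open>p \<in> _\<close> \<open>q \<in> _\<close> by (auto simp: keys_add_nat)
    qed
    then show ?thesis by simp
  qed
  have neg: "- p \<in> carrier (mpoly_ring U)" if "p \<in> carrier (mpoly_ring U)" for p :: "('v, 'k) mpoly"
    using that by (auto simp: in_keys_iff)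
  show "abelian_group (mpoly_ring U :: ('v, 'k) mpoly ring)"
  proof (rule abelian_groupI)
    fix p :: "('v, 'k) mpoly" assume "p \<in> carrier (mpoly_ring U)"
    then show "\<exists>q\<in>carrier (mpoly_ring U). q \<oplus>\<^bsub>mpoly_ring U\<^esub> p = \<zero>\<^bsub>mpoly_ring U\<^esub>"
      using neg by (intro bexI[of _ "- p"]) simp_all
  qed (use add in \<open>auto simp: add_ac simp del: mpoly_ring_simps(1)\<close>, simp)
  show "comm_monoid (mpoly_ring U :: ('v, 'k) mpoly ring)"
    by (rule comm_monoidI) (use mult in \<open>auto simp: mult_ac simp del: mpoly_ring_simps(1)\<close>, simp)
qed (simp add: algebra_simps)

lemma mpoly_nat_pow: "p [^]\<^bsub>mpoly_ring U\<^esub> (k::nat) = (p :: ('v, 'k::field) mpoly) ^ k"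
proof -
  interpret S: cring "mpoly_ring U :: ('v, 'k) mpoly ring" by (rule cring_mpoly_ring)
  show ?thesis by (induction k) (simp_all add: S.nat_pow_Suc mult.commute del: mpoly_ring_simps(1))
qed

lemma mvar_closed: "v \<in> U \<Longrightarrow> mvar v \<in> carrier (mpoly_ring U)"
  by (simp add: mvar_def)

lemma mpoly_finprod:
  assumes "finite G" "G \<subseteq> U"
  shows "(\<Otimes>\<^bsub>mpoly_ring U\<^esub>v\<in>G. mvar v) = (\<Prod>v\<in>G. mvar v :: ('v, 'k::field) mpoly)"
proof -
  interpret S: cring "mpoly_ring U :: ('v, 'k) mpoly ring" by (rule cring_mpoly_ring)
  from assms show ?thesis
  proof (induction G rule: finite_induct)
    case (insert v G)
    then have "mvar u \<in> carrier (mpoly_ring U :: ('v, 'k) mpoly ring)" if "u \<in> insert v G" for u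
      using that by (intro mvar_closed) blast
    then have "(\<Otimes>\<^bsub>mpoly_ring U\<^esub>v\<in>insert v G. mvar v)
        = (mvar v :: ('v, 'k) mpoly) \<otimes>\<^bsub>mpoly_ring U\<^esub> (\<Otimes>\<^bsub>mpoly_ring U\<^esub>v\<in>G. mvar v)"
      using insert.hyps by (intro S.finprod_insert) (auto simp del: mpoly_ring_simps(1))
    then show ?case using insert by (simp del: mpoly_ring_simps(1))
  qed simp
qed

lemma mvar_power: "(mvar v :: ('v, 'k::field) mpoly) ^ k = Poly_Mapping.single (Poly_Mapping.single v k) 1"
  by (induction k) (simp_all add: mvar_def mult_single single_add[symmetric])

lemma prod_mvar_power:
  "finite G \<Longrightarrow> (\<Prod>v\<in>G. mvar v :: ('v, 'k::field) mpoly) ^ k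
    = Poly_Mapping.single (\<Sum>v\<in>G. Poly_Mapping.single v k) 1"
  by (induction G rule: finite_induct)
    (simp_all add: power_mult_distrib mvar_power mult_single)

lemma lookup_sum_single:
  "finite G \<Longrightarrow> Poly_Mapping.lookup (\<Sum>v\<in>G. Poly_Mapping.single v (k::nat)) u = (if u \<in> G then k else 0)"
  by (simp add: lookup_sum lookup_single when_def)

lemma keys_sum_single:
  "finite G \<Longrightarrow> k > 0 \<Longrightarrow> Poly_Mapping.keys (\<Sum>v\<in>G. Poly_Mapping.single v (k::nat)) = G"
  by (rule Set.set_eqI) (simp add: in_keys_iff lookup_sum_single)

lemma mpoly_induct [case_names zero monomial]:
  assumes "P 0"
    and step: "\<And>t c p. t \<notin> Poly_Mapping.keys p \<Longrightarrow> c \<noteq> 0 \<Longrightarrow> P p \<Longrightarrow> P (Poly_Mapping.single t c + p)"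
  shows "P (p :: 'a \<Rightarrow>\<^sub>0 'b::comm_monoid_add)"
proof (induction p rule: update_induct)
  case (update p t c)
  have "Poly_Mapping.update t c p = Poly_Mapping.single t c + p"
    using update by (intro poly_mapping_eqI)
      (auto simp: lookup_update lookup_add lookup_single when_def in_keys_iff)
  then show ?case using step update by simp
qed fact

lemma lookup_mult_monomial:
  "Poly_Mapping.lookup (p * Poly_Mapping.single s 1) (t + s) = Poly_Mapping.lookup (p :: ('v, 'k::field) mpoly) t"
  by (induction p rule: mpoly_induct)
    (simp_all add: distrib_right mult_single lookup_add lookup_single when_def)

text \<open>An ideal if \<open>T\<close> is closed under adding exponents. Membership is then read off from the monomials of a
  polynomial, which is all that is used about these ideals.\<close>
definition monomial_ideal :: "'v set \<Rightarrow> ('v \<Rightarrow>\<^sub>0 nat) set \<Rightarrow> ('v, 'k::field) mpoly set" where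
  "monomial_ideal U T = {p \<in> carrier (mpoly_ring U). Poly_Mapping.keys p \<subseteq> T}"

lemma ideal_monomial_ideal:
  assumes T: "\<And>s t. t \<in> T \<Longrightarrow> s + t \<in> T"
  shows "ideal (monomial_ideal U T) (mpoly_ring U :: ('v, 'k::field) mpoly ring)"
proof -
  interpret S: cring "mpoly_ring U :: ('v, 'k) mpoly ring" by (rule cring_mpoly_ring)
  have mult: "p * q \<in> monomial_ideal U T"
    if p: "p \<in> carrier (mpoly_ring U)" and q: "q \<in> monomial_ideal U T" for p q :: "('v, 'k) mpoly"
  proof -
    have "p * q \<in> carrier (mpoly_ring U)"
      using S.m_closed[of p q] p q by (simp add: monomial_ideal_def del: mpoly_ring_simps(1))
    moreover have "t \<in> T" if t: "t \<in> Poly_Mapping.keys (p * q)" for t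
    proof -
      obtain a b where "t = a + b" "b \<in> Poly_Mapping.keys q" using keys_mult[of p q] t by blast
      then show ?thesis using q T by (auto simp: monomial_ideal_def)
    qed
    ultimately show ?thesis by (auto simp: monomial_ideal_def)
  qed
  have neg1: "- 1 \<in> carrier (mpoly_ring U :: ('v, 'k) mpoly ring)"
    by (auto simp: in_keys_iff lookup_one when_def split: if_splits)
  show ?thesis
  proof (rule idealI)
    show "subgroup (monomial_ideal U T) (add_monoid (mpoly_ring U :: ('v, 'k) mpoly ring))"
    proof (rule subgroup.intro)
      fix p q :: "('v, 'k) mpoly"
      assume p: "p \<in> monomial_ideal U T"
      have np: "- p \<in> monomial_ideal U T" using mult[OF neg1 p] by simp
      have "\<ominus>\<^bsub>mpoly_ring U\<^esub> p = - p"
        by (rule S.minus_equality) (use p np in \<open>auto simp: monomial_ideal_def\<close>)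
      then show "inv\<^bsub>add_monoid (mpoly_ring U)\<^esub> p \<in> monomial_ideal U T" using np by (simp add: a_inv_def)
      assume q: "q \<in> monomial_ideal U T"
      have "p + q \<in> carrier (mpoly_ring U)"
        using S.a_closed[of p q] p q by (simp add: monomial_ideal_def del: mpoly_ring_simps(1))
      moreover have "Poly_Mapping.keys (p + q) \<subseteq> T"
        using Poly_Mapping.keys_add[of p q] p q by (auto simp: monomial_ideal_def)
      ultimately show "p \<otimes>\<^bsub>add_monoid (mpoly_ring U)\<^esub> q \<in> monomial_ideal U T"
        by (simp add: monomial_ideal_def)
    next
      show "\<one>\<^bsub>add_monoid (mpoly_ring U)\<^esub> \<in> (monomial_ideal U T :: ('v, 'k) mpoly set)"
        by (simp add: monomial_ideal_def)
    qed (auto simp: monomial_ideal_def)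
    show "p \<otimes>\<^bsub>mpoly_ring U\<^esub> q \<in> monomial_ideal U T" "q \<otimes>\<^bsub>mpoly_ring U\<^esub> p \<in> monomial_ideal U T"
      if "q \<in> monomial_ideal U T" "p \<in> carrier (mpoly_ring U)" for p q :: "('v, 'k) mpoly"
      using mult[OF that(2,1)] by (simp_all add: mult.commute)
  qed (rule S.ring_axioms)
qed

lemma subfield_constants:
  "subfield (range (Poly_Mapping.single 0)) (mpoly_ring U :: ('v, 'k::field) mpoly ring)"
proof -
  interpret S: cring "mpoly_ring U :: ('v, 'k) mpoly ring" by (rule cring_mpoly_ring)
  let ?K = "range (Poly_Mapping.single 0) :: ('v, 'k) mpoly set"
  have KS: "?K \<subseteq> carrier (mpoly_ring U)" by (auto split: if_splits)
  have neg: "\<ominus>\<^bsub>mpoly_ring U\<^esub> (Poly_Mapping.single 0 c) = (Poly_Mapping.single 0 (- c) :: ('v, 'k) mpoly)" for c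
    by (rule S.minus_equality) (auto simp: single_add[symmetric])
  have sr: "subcring ?K (mpoly_ring U)"
  proof (rule S.subcringI')
    show "subring ?K (mpoly_ring U)"
    proof (rule S.subringI)
      show "\<one>\<^bsub>mpoly_ring U\<^esub> \<in> ?K" by (auto simp: single_one[symmetric] simp del: single_one)
    qed (use KS in \<open>auto simp: neg mult_single single_add[symmetric] simp del: mpoly_ring_simps(1)\<close>)
  qed
  show ?thesis
  proof (rule S.subfieldI[OF sr])
    show "Units (mpoly_ring U\<lparr>carrier := ?K\<rparr>) = ?K - {\<zero>\<^bsub>mpoly_ring U\<^esub>}"
    proof (intro equalityI subsetI)
      fix x assume "x \<in> Units (mpoly_ring U\<lparr>carrier := ?K\<rparr>)"
      then have "x \<in> ?K" "\<exists>y. y * x = 1" by (auto simp: Units_def)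
      then show "x \<in> ?K - {\<zero>\<^bsub>mpoly_ring U\<^esub>}" by auto
    next
      fix x assume "x \<in> ?K - {\<zero>\<^bsub>mpoly_ring U\<^esub>}"
      then obtain c where c: "x = Poly_Mapping.single 0 c" "c \<noteq> 0" by (auto simp del: single_zero) (metis single_zero)
      then have "Poly_Mapping.single 0 (inverse c) * x = 1" "x * Poly_Mapping.single 0 (inverse c) = 1"
        by (simp_all add: mult_single)
      then show "x \<in> Units (mpoly_ring U\<lparr>carrier := ?K\<rparr>)"
        using c by (auto simp: Units_def)
    qed
  qed
qed

text \<open>The monomial ideal is generated by the powers \<open>y\<^sub>v\<^sup>k\<close> with \<open>v \<in> F\<close>.\<close>
lemma monomial_powers_annihilate:
  assumes "module (mpoly_ring U :: ('v, 'k::field) mpoly ring) E" and x: "x \<in> carrier E" and F: "F \<subseteq> U"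
    and kill: "\<And>v. v \<in> F \<Longrightarrow> (mvar v ^ k) \<odot>\<^bsub>E\<^esub> x = \<zero>\<^bsub>E\<^esub>"
    and p: "p \<in> monomial_ideal U {t. \<exists>v \<in> F. k \<le> Poly_Mapping.lookup t v}"
  shows "p \<odot>\<^bsub>E\<^esub> x = \<zero>\<^bsub>E\<^esub>"
proof -
  interpret E: module "mpoly_ring U :: ('v, 'k) mpoly ring" E by fact
  show ?thesis using p
  proof (induction p rule: mpoly_induct)
    case zero
    then show ?case using E.smult_l_null[OF x] by simp
  next
    case (monomial t c p)
    have keys: "Poly_Mapping.keys (Poly_Mapping.single t c + p) = insert t (Poly_Mapping.keys p)"
      using monomial(1,2) by (auto simp: in_keys_iff lookup_add lookup_single when_def split: if_splits)
    have pJ: "p \<in> monomial_ideal U {t. \<exists>v \<in> F. k \<le> Poly_Mapping.lookup t v}"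
      using monomial.prems by (simp add: monomial_ideal_def keys)
    have tU: "Poly_Mapping.keys t \<subseteq> U" and "\<exists>v \<in> F. k \<le> Poly_Mapping.lookup t v"
      using monomial.prems by (simp_all add: monomial_ideal_def keys)
    then obtain v where v: "v \<in> F" "k \<le> Poly_Mapping.lookup t v" by blast
    define t' where "t' = t - Poly_Mapping.single v k"
    have t: "t = t' + Poly_Mapping.single v k"
      using v by (intro poly_mapping_eqI) (auto simp: t'_def lookup_add lookup_minus lookup_single when_def)
    have t'U: "Poly_Mapping.keys t' \<subseteq> U" using tU unfolding t keys_add_nat by blast
    have cl: "Poly_Mapping.single t' c \<in> carrier (mpoly_ring U :: ('v, 'k) mpoly ring)" using t'U by simp
    have vk: "mvar v ^ k \<in> carrier (mpoly_ring U :: ('v, 'k) mpoly ring)"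
      using v F by (auto simp: mvar_power split: if_splits)
    have eq: "Poly_Mapping.single t c = Poly_Mapping.single t' c \<otimes>\<^bsub>mpoly_ring U\<^esub> mvar v ^ k"
      by (simp add: mvar_power mult_single t)
    have "Poly_Mapping.single t c \<odot>\<^bsub>E\<^esub> x = \<zero>\<^bsub>E\<^esub>"
      unfolding eq E.smult_assoc1[OF cl vk x] kill[OF v(1)] by (rule E.smult_r_null[OF cl])
    moreover have "Poly_Mapping.single t c \<in> carrier (mpoly_ring U :: ('v, 'k) mpoly ring)" using tU by simp
    moreover have "p \<in> carrier (mpoly_ring U)" using pJ by (simp add: monomial_ideal_def)
    ultimately show ?case
      using E.smult_l_distr[of "Poly_Mapping.single t c" p x] x monomial.IH[OF pJ] by simp
  qed
qed

lemma mvar_power_in_monomial_ideal: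
  assumes "v \<in> F" "F \<subseteq> U"
  shows "(mvar v :: ('v, 'k::field) mpoly) ^ k \<in> monomial_ideal U {t. \<exists>v \<in> F. k \<le> Poly_Mapping.lookup t v}"
proof -
  have "Poly_Mapping.keys (Poly_Mapping.single v k) \<subseteq> U" using assms by (auto split: if_splits)
  moreover have "\<exists>u \<in> F. k \<le> Poly_Mapping.lookup (Poly_Mapping.single v k) u"
    using assms(1) by (intro bexI[of _ v]) auto
  ultimately show ?thesis by (simp add: monomial_ideal_def mvar_power)
qed

text \<open>The variable \<open>y\<^sub>w\<close> is a nonzerodivisor modulo the ideal generated by the powers \<open>y\<^sub>v\<^sup>K\<close> with \<open>v \<in> F\<close>, since
  multiplication by \<open>y\<^sub>w\<close> changes only the exponent of \<open>w\<close>, and \<open>w \<notin> F\<close>.\<close>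
lemma injective_mpoly_module_divisible:
  fixes E :: "(('v, 'k::field) mpoly, 'c) module"
  assumes E: "injective_module (mpoly_ring U) E" and F: "finite F" "F \<subseteq> U" and w: "w \<in> U - F"
    and x: "x \<in> carrier E"
    and tor: "\<And>v. v \<in> F \<Longrightarrow> \<exists>k::nat. (mvar v [^]\<^bsub>mpoly_ring U\<^esub> k) \<odot>\<^bsub>E\<^esub> x = \<zero>\<^bsub>E\<^esub>"
  shows "\<exists>x' \<in> carrier E. mvar w \<odot>\<^bsub>E\<^esub> x' = x \<and>
    (\<forall>v \<in> F. \<exists>k::nat. (mvar v [^]\<^bsub>mpoly_ring U\<^esub> k) \<odot>\<^bsub>E\<^esub> x' = \<zero>\<^bsub>E\<^esub>)"
proof -
  interpret S: cring "mpoly_ring U :: ('v, 'k) mpoly ring" by (rule cring_mpoly_ring)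
  interpret E: module "mpoly_ring U :: ('v, 'k) mpoly ring" E using E by (simp add: injective_module_def)
  obtain k where k: "\<And>v. v \<in> F \<Longrightarrow> (mvar v ^ k v) \<odot>\<^bsub>E\<^esub> x = \<zero>\<^bsub>E\<^esub>"
    using tor unfolding mpoly_nat_pow by metis
  define K where "K = (\<Sum>v\<in>F. k v)"
  have kill: "(mvar v ^ K) \<odot>\<^bsub>E\<^esub> x = \<zero>\<^bsub>E\<^esub>" if v: "v \<in> F" for v
  proof -
    have "k v \<le> K" unfolding K_def using v F(1) by (intro member_le_sum) auto
    then have eq: "mvar v ^ K = mvar v ^ (K - k v) \<otimes>\<^bsub>mpoly_ring U\<^esub> (mvar v ^ k v :: ('v, 'k) mpoly)"
      by (simp add: power_add[symmetric])
    have cl: "(mvar v ^ n :: ('v, 'k) mpoly) \<in> carrier (mpoly_ring U)" for n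
      using v F(2) by (auto simp: mvar_power split: if_splits)
    show ?thesis unfolding eq E.smult_assoc1[OF cl cl x] k[OF v] by (rule E.smult_r_null[OF cl])
  qed
  define J :: "('v, 'k) mpoly set" where "J = monomial_ideal U {t. \<exists>v\<in>F. K \<le> Poly_Mapping.lookup t v}"
  have J: "ideal J (mpoly_ring U)"
    unfolding J_def by (rule ideal_monomial_ideal) (auto simp: lookup_add intro: trans_le_add2)
  have reg: "a \<in> J" if a: "a \<in> carrier (mpoly_ring U)" "a \<otimes>\<^bsub>mpoly_ring U\<^esub> mvar w \<in> J" for a
  proof -
    have "\<exists>v\<in>F. K \<le> Poly_Mapping.lookup t v" if t: "t \<in> Poly_Mapping.keys a" for t
    proof -
      have "t + Poly_Mapping.single w 1 \<in> Poly_Mapping.keys (a * mvar w)"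
        using t lookup_mult_monomial[of a "Poly_Mapping.single w 1" t] by (simp add: in_keys_iff mvar_def)
      then obtain v where "v \<in> F" "K \<le> Poly_Mapping.lookup (t + Poly_Mapping.single w 1) v"
        using a(2) by (auto simp: J_def monomial_ideal_def)
      moreover have "v \<noteq> w" using \<open>v \<in> F\<close> w by blast
      ultimately show ?thesis by (auto simp: lookup_add lookup_single when_def)
    qed
    then show ?thesis using a(1) by (auto simp: J_def monomial_ideal_def)
  qed
  have wU: "mvar w \<in> carrier (mpoly_ring U)" using w by (intro mvar_closed) blast
  have Jx: "a \<odot>\<^bsub>E\<^esub> x = \<zero>\<^bsub>E\<^esub>" if "a \<in> J" for a
    by (rule monomial_powers_annihilate[OF E.module_axioms x F(2) kill]) (use that J_def in auto)
  obtain x' where x': "x' \<in> carrier E" "mvar w \<odot>\<^bsub>E\<^esub> x' = x" "\<And>a. a \<in> J \<Longrightarrow> a \<odot>\<^bsub>E\<^esub> x' = \<zero>\<^bsub>E\<^esub>"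
    using S.injective_module_divide[OF E J wU reg x Jx] by blast
  have "mvar v ^ K \<in> J" if "v \<in> F" for v
    unfolding J_def using that F(2) by (rule mvar_power_in_monomial_ideal)
  then have "(mvar v [^]\<^bsub>mpoly_ring U\<^esub> K) \<odot>\<^bsub>E\<^esub> x' = \<zero>\<^bsub>E\<^esub>" if "v \<in> F" for v
    using that x'(3) by (simp add: mpoly_nat_pow)
  then show ?thesis using x' by blast
qed

section \<open>Stanley--Reisner ideals\<close>

lemma module_quotient_ring_module:
  fixes R :: "'a ring"
  assumes "cring R" "ideal J R"
  shows "module R (quotient_ring_module R J)"
proof -
  interpret R: cring R by fact
  interpret J: ideal J R by fact
  interpret RJ: cring "R Quot J" by (rule J.quotient_is_cring[OF R.is_cring])
  note h = ring_hom_memE[OF J.rcos_ring_hom]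
  show ?thesis
  proof (rule moduleI)
    show "abelian_group (quotient_ring_module R J)"
    proof (rule abelian_groupI)
      fix x assume "x \<in> carrier (quotient_ring_module R J)"
      then show "\<exists>y\<in>carrier (quotient_ring_module R J).
          y \<oplus>\<^bsub>quotient_ring_module R J\<^esub> x = \<zero>\<^bsub>quotient_ring_module R J\<^esub>"
        using RJ.l_neg[of x] RJ.a_inv_closed[of x] by (auto simp: quotient_ring_module_def)
    qed (auto simp: quotient_ring_module_def RJ.a_ac)
  qed (use h R.is_cring in \<open>auto simp: quotient_ring_module_def RJ.l_distr RJ.r_distr RJ.m_assoc\<close>)
qed

lemma prod_mvar_closed:
  assumes "F \<subseteq> U"
  shows "(\<Prod>v\<in>F. mvar v :: ('v, 'k::field) mpoly) \<in> carrier (mpoly_ring U)"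
proof (cases "finite F")
  case True
  interpret S: cring "mpoly_ring U :: ('v, 'k) mpoly ring" by (rule cring_mpoly_ring)
  have "(\<Otimes>\<^bsub>mpoly_ring U\<^esub>v\<in>F. mvar v :: ('v, 'k) mpoly) \<in> carrier (mpoly_ring U)"
    by (intro S.finprod_closed Pi_I mvar_closed subsetD[OF assms])
  then show ?thesis by (simp only: mpoly_finprod[OF True assms])
qed simp

lemma stanley_reisner_generators_closed:
  "{\<Prod>v\<in>F. mvar v | F. F \<subseteq> U \<and> F \<notin> \<Delta>} \<subseteq> (carrier (mpoly_ring U) :: ('v, 'k::field) mpoly set)"
  using prod_mvar_closed by blast

lemma ideal_stanley_reisner_ideal:
  "ideal (stanley_reisner_ideal U \<Delta> :: ('v, 'k::field) mpoly set) (mpoly_ring U)"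
  unfolding stanley_reisner_ideal_def
  by (rule ring.genideal_ideal[OF cring.axioms(1)[OF cring_mpoly_ring] stanley_reisner_generators_closed])

lemma nonface_in_stanley_reisner_ideal:
  assumes "F \<subseteq> U" "F \<notin> \<Delta>"
  shows "(\<Prod>v\<in>F. mvar v) \<in> (stanley_reisner_ideal U \<Delta> :: ('v, 'k::field) mpoly set)"
  unfolding stanley_reisner_ideal_def using assms
    ring.genideal_self[OF cring.axioms(1)[OF cring_mpoly_ring] stanley_reisner_generators_closed]
  by blast

text \<open>The polynomials all of whose monomials have a nonface as support form an ideal, because faces are closed
  under subsets; it contains the generators.\<close>
lemma stanley_reisner_ideal_keys:
  assumes U: "finite U" and \<Delta>: "abstract_simplicial_complex U \<Delta>"
    and p: "p \<in> (stanley_reisner_ideal U \<Delta> :: ('v, 'k::field) mpoly set)"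
    and t: "t \<in> Poly_Mapping.keys p"
  shows "Poly_Mapping.keys t \<notin> \<Delta>"
proof -
  interpret S: cring "mpoly_ring U :: ('v, 'k) mpoly ring" by (rule cring_mpoly_ring)
  let ?J = "monomial_ideal U {t. Poly_Mapping.keys t \<notin> \<Delta>} :: ('v, 'k) mpoly set"
  have "ideal ?J (mpoly_ring U)"
  proof (rule ideal_monomial_ideal)
    fix s t :: "'v \<Rightarrow>\<^sub>0 nat"
    assume "t \<in> {t. Poly_Mapping.keys t \<notin> \<Delta>}"
    moreover have "Poly_Mapping.keys t \<subseteq> Poly_Mapping.keys (s + t)" by (simp add: keys_add_nat)
    ultimately show "s + t \<in> {t. Poly_Mapping.keys t \<notin> \<Delta>}"
      using \<Delta> unfolding abstract_simplicial_complex_def by blast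
  qed
  moreover have "(\<Prod>v\<in>F. mvar v) \<in> ?J" if F: "F \<subseteq> U" "F \<notin> \<Delta>" for F
  proof -
    have fF: "finite F" using F U finite_subset by blast
    have "(\<Prod>v\<in>F. mvar v :: ('v, 'k) mpoly) = Poly_Mapping.single (\<Sum>v\<in>F. Poly_Mapping.single v 1) 1"
      using prod_mvar_power[OF fF, of 1] by simp
    then show ?thesis
      using F keys_sum_single[OF fF, of 1] prod_mvar_closed[OF F(1)]
      by (auto simp: monomial_ideal_def)
  qed
  ultimately have "stanley_reisner_ideal U \<Delta> \<subseteq> ?J"
    unfolding stanley_reisner_ideal_def by (intro S.genideal_minimal) auto
  then show ?thesis using p t by (auto simp: monomial_ideal_def)
qed

section \<open>The cohomological dimension\<close>

theorem proposition4p1: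
  fixes V W :: "'v set" and \<Delta> :: "'v set set"
    and S :: "('v, 'k::field) mpoly ring" and Q :: "('v, 'k) mpoly set"
  assumes "finite V" and "finite W" and "V \<inter> W = {}"
    and "abstract_simplicial_complex (V \<union> W) \<Delta>"
    and "S = mpoly_ring (V \<union> W)"
    and "Q = Idl\<^bsub>S\<^esub> (mvar ` W)"
  shows "cohomological_dimension S Q (stanley_reisner_ring (V \<union> W) \<Delta>)
       = ereal (real_of_int (complex_dim (restriction \<Delta> W) + 1))"
proof -
  define U where "U = V \<union> W"
  define I :: "('v, 'k) mpoly set" where "I = stanley_reisner_ideal U \<Delta>"
  define M :: "(('v, 'k) mpoly, ('v, 'k) mpoly set) module" where "M = stanley_reisner_ring U \<Delta>"
  have finU: "finite U" and WU: "W \<subseteq> U" using assms by (auto simp: U_def)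
  have \<Delta>: "abstract_simplicial_complex U \<Delta>" using assms by (simp add: U_def)
  have S: "S = mpoly_ring U" using assms by (simp add: U_def)
  interpret S: cring S unfolding S by (rule cring_mpoly_ring)
  have I: "ideal I S" unfolding I_def S by (rule ideal_stanley_reisner_ideal)
  interpret I: ideal I S by (rule I)
  have M_eq: "M = quotient_ring_module S I" by (simp add: M_def I_def S stanley_reisner_ring_def)
  have modM: "module S M" unfolding M_eq by (rule module_quotient_ring_module[OF S.is_cring I])
  interpret M: module S M by (rule modM)
  define cls where "cls p = I +>\<^bsub>S\<^esub> p" for p
  have M_carrier: "carrier M = cls ` carrier S"
    by (auto simp: M_eq quotient_ring_module_def FactRing_def A_RCOSETS_def' cls_def)
  have cls_smult: "a \<odot>\<^bsub>M\<^esub> cls p = cls (a * p)" if "a \<in> carrier S" "p \<in> carrier S" for a p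
    using ring_hom_mult[OF I.rcos_ring_hom that]
    by (simp add: M_eq quotient_ring_module_def cls_def S del: mpoly_ring_simps(1))
  have cls_add: "cls p \<oplus>\<^bsub>M\<^esub> cls q = cls (p + q)" if "p \<in> carrier S" "q \<in> carrier S" for p q
    using ring_hom_add[OF I.rcos_ring_hom that]
    by (simp add: M_eq quotient_ring_module_def cls_def S del: mpoly_ring_simps(1))
  have cls_zero: "cls p = \<zero>\<^bsub>M\<^esub>" if "p \<in> I" for p
    using I.a_rcos_const[OF that] by (simp add: M_eq quotient_ring_module_def cls_def FactRing_def)
  have cls_eq: "p - q \<in> I" if pq: "p \<in> carrier S" "q \<in> carrier S" and "cls p = cls q" for p q
  proof -
    have "p \<ominus>\<^bsub>S\<^esub> q \<in> I"
      using S.quotient_eq_iff_same_a_r_cos[OF I pq] that(3) by (simp add: cls_def)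
    moreover have "p \<ominus>\<^bsub>S\<^esub> q = p - q"
    proof -
      have "(p \<ominus>\<^bsub>S\<^esub> q) \<oplus>\<^bsub>S\<^esub> q = p" using pq by (simp add: S.minus_eq S.a_assoc S.l_neg)
      then have "(p \<ominus>\<^bsub>S\<^esub> q) + q = p" by (simp add: S)
      then show ?thesis by (simp add: eq_diff_eq)
    qed
    ultimately show ?thesis by simp
  qed
  have mvar_S: "mvar v \<in> carrier S" if "v \<in> W" for v
    unfolding S using that WU by (intro mvar_closed) auto
  have prod_S: "(\<Prod>v\<in>G. mvar v) \<in> carrier S" if "G \<subseteq> W" for G
    unfolding S using that WU by (intro prod_mvar_closed) auto
  have finprod_S: "(\<Otimes>\<^bsub>S\<^esub>v\<in>G. mvar v) = (\<Prod>v\<in>G. mvar v)" if "G \<subseteq> W" for G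
    unfolding S using that WU finite_subset[OF _ finU] by (intro mpoly_finprod) auto
  have pow_S: "p [^]\<^bsub>S\<^esub> (k::nat) = p ^ k" for p k unfolding S by (rule mpoly_nat_pow)
  have nonface: "(\<Prod>v\<in>G. mvar v) \<in> I" if "G \<subseteq> W" "G \<notin> \<Delta>" for G
    unfolding I_def using that WU by (intro nonface_in_stanley_reisner_ideal) auto
  have field: "subfield (range (Poly_Mapping.single 0)) S" unfolding S by (rule subfield_constants)
  obtain E d \<epsilon> where res: "injective_resolution S M E d \<epsilon>"
    and lc: "\<And>Q i. local_cohomology S Q M i = torsion_cohomology S Q E d i"
    using local_cohomology_by_resolution[OF modM field] by blast
  have inj: "injective_module S (E i)" for i using res by (simp add: injective_resolution_def)
  have dhom: "d i \<in> mod_hom S (E i) (E (Suc i))" for i using res by (simp add: injective_resolution_def)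
  have ker: "a_kernel (E (Suc i)) (E (Suc (Suc i))) (d (Suc i)) = d i ` carrier (E i)" for i
    using res by (simp add: injective_resolution_def)
  have ker0: "a_kernel (E 0) (E (Suc 0)) (d 0) = \<epsilon> ` carrier M"
    using res by (simp add: injective_resolution_def)
  have \<epsilon>hom: "\<epsilon> \<in> mod_hom S M (E 0)" and \<epsilon>inj: "inj_on \<epsilon> (carrier M)"
    using res by (simp_all add: injective_resolution_def)
  interpret divisible_complex S E d mvar W
  proof (rule divisible_complex.intro[OF S.is_cring divisible_complex_axioms.intro])
    show "module S (E i)" for i using inj by (simp add: injective_module_def)
    show "d i \<in> mod_hom S (E i) (E (Suc i))" for i by (rule dhom)
    show "d (Suc i) (d i x) = \<zero>\<^bsub>E (Suc (Suc i))\<^esub>" if "x \<in> carrier (E i)" for i x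
      using ker[of i] that by (auto simp: a_kernel_def')
    show "x \<in> d i ` carrier (E i)" if "x \<in> carrier (E (Suc i))" "d (Suc i) x = \<zero>\<^bsub>E (Suc (Suc i))\<^esub>" for i x
      using ker[of i] that by (auto simp: a_kernel_def')
    show "finite W" by fact
    show "mvar v \<in> carrier S" if "v \<in> W" for v using that by (rule mvar_S)
    fix F w i and x :: "('v, 'k) mpoly list \<Rightarrow> ('v, 'k) mpoly set"
    assume F: "F \<subseteq> W" and w: "w \<in> W - F" and x: "x \<in> carrier (E i)"
      and tor: "\<And>v. v \<in> F \<Longrightarrow> \<exists>k::nat. (mvar v [^]\<^bsub>S\<^esub> k) \<odot>\<^bsub>E i\<^esub> x = \<zero>\<^bsub>E i\<^esub>"
    have F': "finite F" "F \<subseteq> U" "w \<in> U - F" using F w WU finite_subset[OF F assms(2)] by auto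
    show "\<exists>x'\<in>carrier (E i). mvar w \<odot>\<^bsub>E i\<^esub> x' = x \<and>
        (\<forall>v\<in>F. \<exists>k::nat. (mvar v [^]\<^bsub>S\<^esub> k) \<odot>\<^bsub>E i\<^esub> x' = \<zero>\<^bsub>E i\<^esub>)"
      using injective_mpoly_module_divisible[OF inj[unfolded S] F' x tor[unfolded S]] unfolding S .
  qed
  have \<epsilon>_closed: "\<epsilon> m \<in> carrier (E 0)" if "m \<in> carrier M" for m
    using \<epsilon>hom that by (auto simp: mod_hom_def hom_def)
  have \<epsilon>_add: "\<epsilon> (m \<oplus>\<^bsub>M\<^esub> n) = \<epsilon> m \<oplus>\<^bsub>E 0\<^esub> \<epsilon> n" if "m \<in> carrier M" "n \<in> carrier M" for m n
    using \<epsilon>hom that by (auto simp: mod_hom_def hom_def)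
  have \<epsilon>_smult: "\<epsilon> (a \<odot>\<^bsub>M\<^esub> m) = a \<odot>\<^bsub>E 0\<^esub> \<epsilon> m" if "a \<in> carrier S" "m \<in> carrier M" for a m
    using \<epsilon>hom that by (auto simp: mod_hom_def)
  have \<epsilon>_zero: "\<epsilon> \<zero>\<^bsub>M\<^esub> = \<zero>\<^bsub>E 0\<^esub>"
    using \<epsilon>_smult[of "\<zero>\<^bsub>S\<^esub>" "\<zero>\<^bsub>M\<^esub>"] \<epsilon>_closed[of "\<zero>\<^bsub>M\<^esub>"] by simp
  have cls_M: "cls p \<in> carrier M" if "p \<in> carrier S" for p using that M_carrier by blast
  have \<epsilon>_cls_smult: "a \<odot>\<^bsub>E 0\<^esub> \<epsilon> (cls p) = \<epsilon> (cls (a * p))" if "a \<in> carrier S" "p \<in> carrier S" for a p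
    using \<epsilon>_smult[OF that(1) cls_M[OF that(2)]] cls_smult[OF that] by simp
  have cocycle0: "\<exists>p \<in> carrier S. x = \<epsilon> (cls p)" if "x \<in> cocycles {} 0" for x
    using that ker0 M_carrier by (auto simp: a_kernel_def' cocycles_def tors_empty)
  have \<epsilon>_kernel: "d 0 (\<epsilon> m) = \<zero>\<^bsub>E (Suc 0)\<^esub>" if "m \<in> carrier M" for m
    using that ker0 by (auto simp: a_kernel_def')
  have kill: "(\<Prod>v\<in>G. mvar v) \<odot>\<^bsub>E 0\<^esub> \<epsilon> (cls p) = \<zero>\<^bsub>E 0\<^esub>"
    if "G \<subseteq> W" "G \<notin> \<Delta>" "p \<in> carrier S" for G p
  proof -
    have "(\<Prod>v\<in>G. mvar v) * p \<in> I"
      using I.I_r_closed[OF nonface[OF that(1,2)] that(3)] by (simp add: S del: mpoly_ring_simps(1))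
    then show ?thesis
      using \<epsilon>_cls_smult[OF prod_S[OF that(1)] that(3)] cls_zero \<epsilon>_zero by simp
  qed
  \<comment> \<open>A nonface monomial annihilates \<open>K[\<Delta>]\<close>, so the localizations at it vanish.\<close>
  have base: "local_vanishing {} (\<Otimes>\<^bsub>S\<^esub>v\<in>G. mvar v) 0" if G: "G \<subseteq> W" "G \<notin> \<Delta>" for G
    unfolding local_vanishing_def
  proof
    fix x assume "x \<in> cocycles {} 0"
    then obtain p where p: "p \<in> carrier S" "x = \<epsilon> (cls p)" using cocycle0 by blast
    have "((\<Otimes>\<^bsub>S\<^esub>v\<in>G. mvar v) [^]\<^bsub>S\<^esub> (1::nat)) \<odot>\<^bsub>E 0\<^esub> x \<in> coboundaries {} 0"
      unfolding finprod_S[OF G(1)] pow_S p(2) using kill[OF G p(1)] by (simp add: coboundaries_def)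
    then show "\<exists>k::nat. ((\<Otimes>\<^bsub>S\<^esub>v\<in>G. mvar v) [^]\<^bsub>S\<^esub> k) \<odot>\<^bsub>E 0\<^esub> x \<in> coboundaries {} 0" by blast
  qed
  have nonzero_iff: "carrier (local_cohomology S Q M i) \<noteq> {\<zero>\<^bsub>local_cohomology S Q M i\<^esub>}
      \<longleftrightarrow> \<not> cocycles W i \<subseteq> coboundaries W i" for i
    unfolding lc assms(6) by (rule torsion_cohomology_nonzero_iff)
  have fin\<Delta>: "finite (restriction \<Delta> W)" and ne: "restriction \<Delta> W \<noteq> {}"
    using \<Delta> assms(2) by (auto simp: restriction_def abstract_simplicial_complex_def
        intro: finite_subset[of _ "Pow W"])
  define D where "D = Max (card ` restriction \<Delta> W)"
  have "D \<in> card ` restriction \<Delta> W" unfolding D_def using fin\<Delta> ne by (intro Max_in) auto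
  then obtain F where F: "F \<in> \<Delta>" "F \<subseteq> W" "card F = D" by (auto simp: restriction_def)
  have card_le: "card A \<le> D" if "A \<in> \<Delta>" "A \<subseteq> W" for A
    unfolding D_def using that fin\<Delta> by (intro Max_ge) (auto simp: restriction_def)
  have dim: "complex_dim (restriction \<Delta> W) + 1 = int D"
  proof -
    have "Max ((\<lambda>F. int (card F) - 1) ` restriction \<Delta> W) = int D - 1"
    proof (rule Max_eqI)
      show "finite ((\<lambda>F. int (card F) - 1) ` restriction \<Delta> W)" using fin\<Delta> by simp
      show "n \<le> int D - 1" if n: "n \<in> (\<lambda>F. int (card F) - 1) ` restriction \<Delta> W" for n
      proof -
        obtain A where "A \<in> \<Delta>" "A \<subseteq> W" "n = int (card A) - 1"
          using n by (auto simp: restriction_def)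
        then show ?thesis using card_le[of A] by simp
      qed
      show "int D - 1 \<in> (\<lambda>F. int (card F) - 1) ` restriction \<Delta> W"
        using F by (intro image_eqI[of _ _ F]) (auto simp: restriction_def)
    qed
    then show ?thesis by (simp add: complex_dim_def)
  qed
  have vanish: "cocycles W i \<subseteq> coboundaries W i" if "D < i" for i
  proof
    fix x assume x: "x \<in> cocycles W i"
    have "local_vanishing W (\<Otimes>\<^bsub>S\<^esub>v\<in>{}. mvar v) i"
    proof (rule local_vanishing_faces[OF base])
      show "card A < i" if "A \<subseteq> W" "A \<union> {} \<in> \<Delta>" for A
        using card_le[of A] that \<open>D < i\<close> by simp
    qed auto
    then obtain k :: nat where "(\<one>\<^bsub>S\<^esub> [^]\<^bsub>S\<^esub> k) \<odot>\<^bsub>E i\<^esub> x \<in> coboundaries W i"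
      using x by (auto simp: local_vanishing_def)
    moreover have "x \<in> carrier (E i)" using x tors_carrier by (auto simp: cocycles_def)
    ultimately show "x \<in> coboundaries W i" by simp
  qed
  have finF: "finite F" using F(2) assms(2) finite_subset by blast
  \<comment> \<open>The class of \<open>1/y\<^sub>F\<close> in \<open>K[\<Delta>][1/y\<^sub>F]\<close>, written as \<open>y\<^sub>F/y\<^sub>F\<^sup>2\<close>. The numerator \<open>y\<^sub>F\<close> is killed by all
    variables of \<open>W - F\<close>, because \<open>F\<close> has the largest possible number of vertices.\<close>
  define z where "z = \<epsilon> (cls (\<Prod>v\<in>F. mvar v))"
  have zE: "z \<in> carrier (E 0)" unfolding z_def by (intro \<epsilon>_closed cls_M prod_S F)
  have "z \<in> cocycles ({} \<union> (W - F)) 0"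
  proof -
    have "(mvar v [^]\<^bsub>S\<^esub> (1::nat)) \<odot>\<^bsub>E 0\<^esub> z = \<zero>\<^bsub>E 0\<^esub>" if v: "v \<in> W - F" for v
    proof -
      have vF: "insert v F \<subseteq> W" using v F by blast
      have "card (insert v F) = Suc D" using v finF F(3) by simp
      then have "insert v F \<notin> \<Delta>" using card_le[OF _ vF] by auto
      moreover have "\<one>\<^bsub>S\<^esub> \<in> carrier S" by simp
      ultimately have "(\<Prod>u\<in>insert v F. mvar u) \<odot>\<^bsub>E 0\<^esub> \<epsilon> (cls \<one>\<^bsub>S\<^esub>) = \<zero>\<^bsub>E 0\<^esub>"
        using kill[OF vF] by blast
      moreover have "(\<Prod>u\<in>insert v F. mvar u) * \<one>\<^bsub>S\<^esub> = mvar v * (\<Prod>u\<in>F. mvar u)"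
        using v finF by (simp add: S)
      ultimately have "\<epsilon> (cls (mvar v * (\<Prod>u\<in>F. mvar u))) = \<zero>\<^bsub>E 0\<^esub>"
        using \<epsilon>_cls_smult[OF prod_S[OF vF] S.one_closed] by simp
      then show ?thesis
        unfolding z_def pow_S using \<epsilon>_cls_smult[OF mvar_S prod_S[OF F(2)], of v] v by simp
    qed
    moreover have "d 0 z = \<zero>\<^bsub>E (Suc 0)\<^esub>" unfolding z_def by (intro \<epsilon>_kernel cls_M prod_S F)
    ultimately show ?thesis using zE unfolding cocycles_def tors_def by blast
  qed
  \<comment> \<open>Over-divisibility would mean \<open>y\<^sub>F\<^sup>k\<^sup>+\<^sup>1 \<in> I + (y\<^sub>w\<^sup>k\<^sup>+\<^sup>2 | w \<in> F)\<close>. But the support \<open>F\<close> of this monomial is a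
    face, and none of its exponents reaches \<open>k + 2\<close>.\<close>
  moreover have "\<not> over_divisible {} F 0 z"
  proof
    assume "over_divisible {} F 0 z"
    then obtain k s where s: "s \<in> power_span {} F (k + 2) 0"
      and eq: "((\<Prod>v\<in>F. mvar v) ^ k) \<odot>\<^bsub>E 0\<^esub> z = s \<oplus>\<^bsub>E 0\<^esub> \<zero>\<^bsub>E 0\<^esub>"
      unfolding over_divisible_def finprod_S[OF F(2)] pow_S by (auto simp: coboundaries_def)
    let ?J = "monomial_ideal U {t. \<exists>w\<in>F. k + 2 \<le> Poly_Mapping.lookup t w} :: ('v, 'k) mpoly set"
    have J: "ideal ?J S"
      unfolding S by (rule ideal_monomial_ideal) (auto simp: lookup_add intro: trans_le_add2)
    interpret J: ideal ?J S by (rule J)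
    have "\<exists>p \<in> ?J. s = \<epsilon> (cls p)"
      using s
    proof induction
      case zero
      have "cls 0 = \<zero>\<^bsub>M\<^esub>" using I.zero_closed by (intro cls_zero) (simp add: S)
      moreover have "0 \<in> ?J" using J.zero_closed by (simp add: S)
      ultimately show ?case using \<epsilon>_zero by metis
    next
      case (gen w c)
      obtain q where q: "q \<in> carrier S" "c = \<epsilon> (cls q)" using cocycle0 gen(2) by blast
      have wS: "mvar w \<in> carrier S" using gen(1) F mvar_S by blast
      have "mvar w ^ (k + 2) \<in> ?J"
        using gen(1) subset_trans[OF F(2) WU] by (rule mvar_power_in_monomial_ideal)
      then have "mvar w ^ (k + 2) * q \<in> ?J"
        using J.I_r_closed[OF _ q(1)] by (simp add: S del: mpoly_ring_simps(1))
      moreover have "(mvar w [^]\<^bsub>S\<^esub> (k + 2)) \<odot>\<^bsub>E 0\<^esub> c = \<epsilon> (cls (mvar w ^ (k + 2) * q))"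
        using \<epsilon>_cls_smult[OF S.nat_pow_closed[OF wS] q(1)] unfolding q(2) pow_S .
      ultimately show ?case by blast
    next
      case (add s t)
      then obtain p q where p: "p \<in> ?J" "s = \<epsilon> (cls p)" and q: "q \<in> ?J" "t = \<epsilon> (cls q)" by blast
      have pq: "p \<in> carrier S" "q \<in> carrier S" using p q J.a_Hcarr by auto
      have "p + q \<in> ?J" using J.a_closed[OF p(1) q(1)] by (simp add: S)
      moreover have "s \<oplus>\<^bsub>E 0\<^esub> t = \<epsilon> (cls (p + q))"
        using \<epsilon>_add[OF cls_M[OF pq(1)] cls_M[OF pq(2)]] cls_add[OF pq] p q by simp
      ultimately show ?case by blast
    qed
    then obtain p where p: "p \<in> ?J" "s = \<epsilon> (cls p)" by blast
    have pS: "p \<in> carrier S" using p J.a_Hcarr by blast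
    let ?m = "(\<Prod>v\<in>F. mvar v) ^ (k + 1) :: ('v, 'k) mpoly"
    have mS: "?m \<in> carrier S" using S.nat_pow_closed[OF prod_S[OF F(2)], of "k + 1"] unfolding pow_S .
    have kS: "(\<Prod>v\<in>F. mvar v) ^ k \<in> carrier S" using S.nat_pow_closed[OF prod_S[OF F(2)], of k] unfolding pow_S .
    have "\<epsilon> (cls ?m) = ((\<Prod>v\<in>F. mvar v) ^ k) \<odot>\<^bsub>E 0\<^esub> z"
      unfolding z_def using \<epsilon>_cls_smult[OF kS prod_S[OF F(2)]] by (simp add: mult.commute)
    also have "\<dots> = \<epsilon> (cls p)" using eq p(2) \<epsilon>_closed[OF cls_M[OF pS]] by simp
    finally have "cls ?m = cls p" using inj_onD[OF \<epsilon>inj _ cls_M[OF mS] cls_M[OF pS]] by blast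
    then have mp: "?m - p \<in> I" by (rule cls_eq[OF mS pS])
    define t where "t = (\<Sum>v\<in>F. Poly_Mapping.single v (k + 1))"
    have m: "?m = Poly_Mapping.single t 1" unfolding t_def by (rule prod_mvar_power[OF finF])
    have "t \<notin> Poly_Mapping.keys p"
    proof
      assume "t \<in> Poly_Mapping.keys p"
      then obtain w where "w \<in> F" "k + 2 \<le> Poly_Mapping.lookup t w"
        using p(1) by (auto simp: monomial_ideal_def)
      then show False by (simp add: t_def lookup_sum_single[OF finF])
    qed
    then have "Poly_Mapping.lookup (?m - p) t = 1" unfolding m by (simp add: lookup_minus in_keys_iff)
    then have "t \<in> Poly_Mapping.keys (?m - p)" by (simp add: in_keys_iff)
    from stanley_reisner_ideal_keys[OF finU \<Delta> mp[unfolded I_def] this]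
    have "Poly_Mapping.keys t \<notin> \<Delta>" .
    then show False using F(1) keys_sum_single[OF finF, of "k + 1"] by (simp add: t_def)
  qed
  ultimately have "\<exists>\<xi> \<in> cocycles ({} \<union> F \<union> (W - F)) (0 + card F). \<xi> \<notin> coboundaries ({} \<union> F) (0 + card F)"
    using F(2) by (intro nonvanishing[OF _ finF]) auto
  then obtain \<xi> where \<xi>: "\<xi> \<in> cocycles W D" "\<xi> \<notin> coboundaries F D"
    using F by (auto simp: Un_absorb1)
  have "coboundaries W D \<subseteq> coboundaries F D"
    using tors_mono[OF F(2)] by (auto simp: coboundaries_def split: nat.split)
  then have nonvan: "\<not> cocycles W D \<subseteq> coboundaries W D" using \<xi> by blast
  have "Sup {ereal (real i) | i. carrier (local_cohomology S Q M i) \<noteq> {\<zero>\<^bsub>local_cohomology S Q M i\<^esub>}} = ereal (real D)"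
    unfolding nonzero_iff
  proof (rule Sup_eqI)
    show "x \<le> ereal (real D)" if "x \<in> {ereal (real i) | i. \<not> cocycles W i \<subseteq> coboundaries W i}" for x
      using that vanish by (force simp: not_less[symmetric])
    show "ereal (real D) \<le> b" if "\<And>x. x \<in> {ereal (real i) | i. \<not> cocycles W i \<subseteq> coboundaries W i} \<Longrightarrow> x \<le> b" for b
      using that nonvan by blast
  qed
  then show ?thesis
    unfolding cohomological_dimension_def dim M_def[symmetric, unfolded U_def] by simp
qed

end
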